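(* Let $m,n\ge 2$ be integers with $\frac1m+\frac1n\le\frac12$, and let $\hat{\mathcal M}(m,n)$ be the universal map of type $\{m,n\}$ (the tessellation of the Euclidean plane if $\frac1m+\frac1n=\frac12$, or of the hyperbolic plane if $\frac1m+\frac1n<\frac12$, by regular $m$-gons, $n$ meeting at each vertex). Fix a $(2,m,n)$-triangle $T$ of its barycentric subdivision, with corners at a vertex (label $\mathbf 0$), an edge-centre (label $\mathbf 1$) and a face-centre (label $\mathbf 2$), and let $P$, $Q$, $R$ be the reflections in the $\mathbf{01}$-side, the $\mathbf{12}$-side and the $\mathbf{02}$-side of $T$ respectively. Then the patterns of the mirrors (fixed lines) of $P$, $Q$, $R$ (and hence of all their conjugates) are: (1) if $m$ and $n$ are both odd: $P,Q,R$ all have pattern $(\mathbf{010212})^\infty$; (2) if $m$ is odd and $n$ is even: $P$ has pattern $(\mathbf{01})^\infty$, and $Q,R$ have pattern $(\mathbf{0212})^\infty$; (3) if $m$ and $n$ are both even: $P$ has pattern $(\mathbf{01})^\infty$, $Q$ has pattern $(\mathbf{12})^\infty$, $R$ has pattern $(\mathbf{02})^\infty$; (4) if $m$ is even and $n$ is odd: $P,R$ have pattern $(\mathbf{0102})^\infty$ and $Q$ has pattern $(\mathbf{12})^\infty$.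
   Context: A map of type $\{m,n\}$ is an embedding of a graph in a surface whose faces are simply connected polygons, $m$ being the lcm of face sizes and $n$ the lcm of vertex valencies. Subdividing each face by joining its centre to its vertices and edge-centres gives a triangulation by $(2,m,n)$-triangles (angles $\pi/2,\pi/m,\pi/n$ at the edge-centre, face-centre and vertex). The reflections $P,Q,R$ satisfy $P^2=Q^2=R^2=(PQ)^2=(QR)^m=(RP)^n=1$ and generate the full automorphism group of $\hat{\mathcal M}(m,n)$. The geometric points of a map are its vertices (denoted $\mathbf 0$), edge-centres (denoted $\mathbf 1$) and face-centres (denoted $\mathbf 2$). The pattern of a mirror (the fixed curve/line of a reflection) is the sequence of geometric points met in succession when travelling along it; $(\ell)^\infty$ means the finite word $\ell$ (the link) repeated periodically indefinitely. *)

theory Defs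
  imports "HOL-Analysis.Analysis"
begin

text \<open>The Poincare disc model of the hyperbolic plane (curvature -1) has carrier \<open>ball 0 1\<close>.\<close>

definition hyp_dist :: "complex \<Rightarrow> complex \<Rightarrow> real" where
  "hyp_dist z w = arcosh (1 + 2 * (cmod (z - w))\<^sup>2 / ((1 - (cmod z)\<^sup>2) * (1 - (cmod w)\<^sup>2)))"

definition plane :: "nat \<Rightarrow> nat \<Rightarrow> complex set" where
  "plane m n = (if 1 / real m + 1 / real n = 1 / 2 then UNIV else ball 0 1)"

definition plane_dist :: "nat \<Rightarrow> nat \<Rightarrow> complex \<Rightarrow> complex \<Rightarrow> real" where
  "plane_dist m n = (if 1 / real m + 1 / real n = 1 / 2 then dist else hyp_dist)"

text \<open>
  The elementary geometry below is expressed through the distance \<open>d\<close> on the carrier \<open>X\<close> only,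
  so that the same definitions serve the Euclidean and the hyperbolic plane.
\<close>

context
  fixes X :: "'a set" and d :: "'a \<Rightarrow> 'a \<Rightarrow> real"
begin

definition seg :: "'a \<Rightarrow> 'a \<Rightarrow> 'a set" where
  "seg a b = {x \<in> X. d a x + d x b = d a b}"

definition ray :: "'a \<Rightarrow> 'a \<Rightarrow> 'a set" where
  "ray a b = {x \<in> X. x \<in> seg a b \<or> b \<in> seg a x}"

text \<open>Meaningful for \<open>a \<noteq> b\<close> only.\<close>

definition line_through :: "'a \<Rightarrow> 'a \<Rightarrow> 'a set" where
  "line_through a b = {x \<in> X. x \<in> seg a b \<or> b \<in> seg a x \<or> a \<in> seg x b}"

definition is_midpoint :: "'a \<Rightarrow> 'a \<Rightarrow> 'a \<Rightarrow> bool" where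
  "is_midpoint a b x \<longleftrightarrow> x \<in> X \<and> d a x = d a b / 2 \<and> d x b = d a b / 2"

definition same_side :: "'a set \<Rightarrow> 'a \<Rightarrow> 'a \<Rightarrow> bool" where
  "same_side L x y \<longleftrightarrow> x \<in> X - L \<and> y \<in> X - L \<and> seg x y \<inter> L = {}"

definition geod_convex :: "'a set \<Rightarrow> bool" where
  "geod_convex S \<longleftrightarrow> S \<subseteq> X \<and> (\<forall>x\<in>S. \<forall>y\<in>S. seg x y \<subseteq> S)"

definition is_isometry :: "('a \<Rightarrow> 'a) \<Rightarrow> bool" where
  "is_isometry g \<longleftrightarrow> bij_betw g X X \<and> (\<forall>x\<in>X. \<forall>y\<in>X. d (g x) (g y) = d x y)"

definition mirror :: "('a \<Rightarrow> 'a) \<Rightarrow> 'a set" where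
  "mirror g = {x \<in> X. g x = x}"

definition is_reflection :: "'a set \<Rightarrow> ('a \<Rightarrow> 'a) \<Rightarrow> bool" where
  "is_reflection L g \<longleftrightarrow> is_isometry g \<and> mirror g = L"

definition conjugate :: "('a \<Rightarrow> 'a) \<Rightarrow> ('a \<Rightarrow> 'a) \<Rightarrow> 'a \<Rightarrow> 'a" where
  "conjugate g f = (\<lambda>x. g (f (inv_into X g x)))"

definition angle_cong :: "'a \<Rightarrow> 'a \<Rightarrow> 'a \<Rightarrow> 'a \<Rightarrow> 'a \<Rightarrow> 'a \<Rightarrow> bool" where
  "angle_cong a b c a' b' c' \<longleftrightarrow>
     (\<exists>h. is_isometry h \<and> h b = b' \<and> h ` ray b a = ray b' a' \<and> h ` ray b c = ray b' c')"

text \<open>Polygons are given by the list of their corners in cyclic order.\<close>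

definition corner :: "'a list \<Rightarrow> nat \<Rightarrow> 'a" where
  "corner vs i = vs ! (i mod length vs)"

text \<open>The one-sidedness condition also excludes star polygons.\<close>

definition convex_polygon :: "'a list \<Rightarrow> bool" where
  "convex_polygon vs \<longleftrightarrow>
     3 \<le> length vs \<and> set vs \<subseteq> X \<and>
     (\<forall>i < length vs. corner vs i \<noteq> corner vs (i + 1) \<and>
        (\<forall>j < length vs. \<forall>k < length vs.
           j \<notin> {i, (i + 1) mod length vs} \<longrightarrow> k \<notin> {i, (i + 1) mod length vs} \<longrightarrow>
           same_side (line_through (corner vs i) (corner vs (i + 1))) (corner vs j) (corner vs k)))"

definition regular_polygon :: "'a list \<Rightarrow> bool" where
  "regular_polygon vs \<longleftrightarrow>
     convex_polygon vs \<and>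
     (\<forall>i j. d (corner vs i) (corner vs (i + 1)) = d (corner vs j) (corner vs (j + 1))) \<and>
     (\<forall>i j. angle_cong (corner vs i) (corner vs (i + 1)) (corner vs (i + 2))
                       (corner vs j) (corner vs (j + 1)) (corner vs (j + 2)))"

definition region :: "'a list \<Rightarrow> 'a set" where
  "region vs = geod_convex hull set vs"

definition sides :: "'a list \<Rightarrow> 'a set set" where
  "sides vs = {seg (corner vs i) (corner vs (i + 1)) | i. i < length vs}"

definition is_centre :: "'a list \<Rightarrow> 'a \<Rightarrow> bool" where
  "is_centre vs c \<longleftrightarrow> c \<in> X \<and> (\<forall>a \<in> set vs. \<forall>b \<in> set vs. d c a = d c b)"

text \<open>
  Edge-to-edge, locally finite tessellations by regular \<open>m\<close>-gons, \<open>n\<close> meeting at each vertex.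
  The set \<open>F\<close> consists of the closed faces; \<open>face_cycles F\<close> are the corner lists of its faces.
\<close>

definition face_cycles :: "'a set set \<Rightarrow> 'a list set" where
  "face_cycles F = {vs. regular_polygon vs \<and> region vs \<in> F}"

definition regular_tessellation :: "nat \<Rightarrow> nat \<Rightarrow> 'a set set \<Rightarrow> bool" where
  "regular_tessellation m n F \<longleftrightarrow>
     (\<forall>f \<in> F. \<exists>vs. length vs = m \<and> regular_polygon vs \<and> f = region vs) \<and>
     \<Union> F = X \<and>
     (\<forall>x \<in> X. \<exists>r > 0. finite {f \<in> F. \<exists>y \<in> f. d x y < r}) \<and>
     (\<forall>us \<in> face_cycles F. \<forall>vs \<in> face_cycles F. region us \<noteq> region vs \<longrightarrow>
        region us \<inter> region vs = {} \<or>
        (\<exists>x \<in> set us \<inter> set vs. region us \<inter> region vs = {x}) \<or>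
        region us \<inter> region vs \<in> sides us \<inter> sides vs) \<and>
     (\<forall>vs \<in> face_cycles F. \<forall>x \<in> set vs. card {f \<in> F. x \<in> f} = n)"

definition vertices :: "'a set set \<Rightarrow> 'a set" where
  "vertices F = (\<Union>vs \<in> face_cycles F. set vs)"

definition edge_centres :: "'a set set \<Rightarrow> 'a set" where
  "edge_centres F = {x. \<exists>vs \<in> face_cycles F. \<exists>i. is_midpoint (corner vs i) (corner vs (i + 1)) x}"

definition face_centres :: "'a set set \<Rightarrow> 'a set" where
  "face_centres F = {x. \<exists>vs \<in> face_cycles F. is_centre vs x}"

definition geom_points :: "'a set set \<Rightarrow> nat \<Rightarrow> 'a set" where
  "geom_points F k =
     (if k = 0 then vertices F else if k = 1 then edge_centres F
      else if k = 2 then face_centres F else {})"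

definition barycentric_triangle :: "'a set set \<Rightarrow> 'a \<Rightarrow> 'a \<Rightarrow> 'a \<Rightarrow> bool" where
  "barycentric_triangle F v0 v1 v2 \<longleftrightarrow>
     (\<exists>vs \<in> face_cycles F. \<exists>i. v0 \<in> {corner vs i, corner vs (i + 1)} \<and>
        is_midpoint (corner vs i) (corner vs (i + 1)) v1 \<and> is_centre vs v2)"

definition map_aut :: "'a set set \<Rightarrow> ('a \<Rightarrow> 'a) set" where
  "map_aut F = {g. is_isometry g \<and> (`) g ` F = F}"

text \<open>
  The line \<open>L\<close>, travelled along by the arc length parametrisation \<open>\<gamma>\<close>, meets geometric points exactly
  at the times \<open>\<dots> < t (-1) < t 0 < t 1 < \<dots>\<close>, and their labels are the letters of the
  bi-infinite periodic word with link \<open>w\<close>.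
\<close>

definition has_pattern :: "'a set set \<Rightarrow> 'a set \<Rightarrow> nat list \<Rightarrow> bool" where
  "has_pattern F L w \<longleftrightarrow>
     (\<exists>(\<gamma> :: real \<Rightarrow> 'a) (t :: int \<Rightarrow> real).
        (\<forall>r s. d (\<gamma> r) (\<gamma> s) = \<bar>r - s\<bar>) \<and> range \<gamma> = L \<and>
        strict_mono t \<and> {s. \<exists>k. \<gamma> s \<in> geom_points F k} = range t \<and>
        (\<forall>i k. \<gamma> (t i) \<in> geom_points F k \<longleftrightarrow> k = w ! nat (i mod int (length w))))"

definition mirrors_have_pattern :: "'a set set \<Rightarrow> ('a \<Rightarrow> 'a) \<Rightarrow> nat list \<Rightarrow> bool" where
  "mirrors_have_pattern F f w \<longleftrightarrow>
     has_pattern F (mirror f) w \<and>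
     (\<forall>g \<in> map_aut F. has_pattern F (mirror (conjugate g f)) w)"

end

end

theory Submission
  imports Defs
begin

text \<open>
  In a chart in which geodesics are straight (the Euclidean plane itself, or the Klein disc) faces are
  convex hulls and everything about incidence and order is ordinary planar convexity; only distances
  differ. A regular polygon has a rotation permuting its corners cyclically, hence a centre. When the
  centre is moved to the origin the corners become a multiple of the powers of \<open>cis (\<plusminus>2\<pi>/m)\<close>. When
  a vertex is moved to the origin, adjacent faces are congruent because they share a side, so the \<open>n\<close>
  edges there point in the directions of the powers of \<open>cis (\<plusminus>2\<pi>/n)\<close>, with the face-centres on the
  bisectors. Hence a mirror running along a side of a barycentric triangle continues, beyond each
  geometric point, along a side of another barycentric triangle: at an edge-centre, or at a vertex or
  face-centre with an even number of edges or corners around it, it leaves towards a point with the same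
  label as the one it came from, otherwise towards the third label. Iterating this rule in both
  directions gives the words; local finiteness shows that the walk exhausts the whole line.
\<close>

subsection \<open>Transport along isometries\<close>

text \<open>All notions are metric, so each computation can be done with the relevant point moved to
  the origin. The Klein chart distorts lengths, and the main link kept between its distance and the
  Euclidean one is \<open>equidistant\<close>: points of equal modulus are equally far from
  \<open>p\<close> in both senses or in neither. That suffices, because corners around a centre and
  neighbours around a vertex have equal modulus. Angles are never measured; their equality is
  expressed by the distance between the ends of arms of known length.

  The obstacle is that nothing prescribes how corners turn: a corner list may run either way, and
  multiple turns must be excluded. Hence orientations appear with an unspecified factor
  \<open>s\<close>, roots of unity are known up to conjugation, and the number of turns is settled
  by convexity: a power of the root strictly inside the first sector would be a corner or an edge
  where none can be. At a vertex this yields a fan of some \<open>N\<close> faces, and only the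
  count of the faces containing the vertex identifies \<open>N\<close> with
  \<open>n\<close>.\<close>

lemma
  assumes "regular_tessellation X d m n F"
  shows tessellation_face: "f \<in> F \<Longrightarrow> \<exists>vs. length vs = m \<and> regular_polygon X d vs \<and> f = region X d vs"
    and tessellation_Union: "\<Union> F = X"
    and tessellation_finite: "x \<in> X \<Longrightarrow> \<exists>r > 0. finite {f \<in> F. \<exists>y \<in> f. d x y < r}"
    and tessellation_Int: "us \<in> face_cycles X d F \<Longrightarrow> vs \<in> face_cycles X d F \<Longrightarrow>
        region X d us \<noteq> region X d vs \<Longrightarrow>
        region X d us \<inter> region X d vs = {} \<or>
        (\<exists>x \<in> set us \<inter> set vs. region X d us \<inter> region X d vs = {x}) \<or>
        region X d us \<inter> region X d vs \<in> sides X d us \<inter> sides X d vs"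
    and tessellation_card: "vs \<in> face_cycles X d F \<Longrightarrow> x \<in> set vs \<Longrightarrow> card {f \<in> F. x \<in> f} = n"
  using assms unfolding regular_tessellation_def by simp_all

lemma corner_map: "vs \<noteq> [] \<Longrightarrow> corner (map h vs) i = h (corner vs i)"
  by (simp add: corner_def)

text \<open>Source and target may differ, so one set of transport lemmas serves both the
  self-isometries that bring a point to the origin and the passage from the Poincare disc to the
  Klein disc.\<close>

locale isom =
  fixes X :: "'a set" and d :: "'a \<Rightarrow> 'a \<Rightarrow> real"
    and Y :: "'b set" and e :: "'b \<Rightarrow> 'b \<Rightarrow> real" and h :: "'a \<Rightarrow> 'b"
  assumes bij: "bij_betw h X Y"
    and iso: "\<And>x y. x \<in> X \<Longrightarrow> y \<in> X \<Longrightarrow> e (h x) (h y) = d x y"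
begin

lemma in_target [simp]: "x \<in> X \<Longrightarrow> h x \<in> Y"
  using bij by (auto simp: bij_betw_def)

lemma target_eq: "Y = h ` X"
  using bij by (auto simp: bij_betw_def)

lemma eq_iff [simp]: "x \<in> X \<Longrightarrow> y \<in> X \<Longrightarrow> h x = h y \<longleftrightarrow> x = y"
  using bij by (auto simp: bij_betw_def inj_on_def)

lemma mem_image_iff: "x \<in> X \<Longrightarrow> S \<subseteq> X \<Longrightarrow> h x \<in> h ` S \<longleftrightarrow> x \<in> S"
  using bij by (auto simp: bij_betw_def inj_on_def)

lemma inj_image: "S \<subseteq> X \<Longrightarrow> S' \<subseteq> X \<Longrightarrow> h ` S = h ` S' \<longleftrightarrow> S = S'"
  using mem_image_iff by blast

lemma image_Int: "S \<subseteq> X \<Longrightarrow> S' \<subseteq> X \<Longrightarrow> h ` (S \<inter> S') = h ` S \<inter> h ` S'"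
  using mem_image_iff by blast

lemma inverse: "isom Y e X d (inv_into X h)"
proof
  show "bij_betw (inv_into X h) Y X" by (rule bij_betw_inv_into [OF bij])
  fix x y assume "x \<in> Y" "y \<in> Y"
  then show "d (inv_into X h x) (inv_into X h y) = e x y"
    unfolding target_eq using iso
    by (metis f_inv_into_f inv_into_into)
qed

lemma inv_h [simp]: "x \<in> X \<Longrightarrow> inv_into X h (h x) = x"
  using bij by (simp add: bij_betw_def)

lemma h_inv [simp]: "y \<in> Y \<Longrightarrow> h (inv_into X h y) = y"
  using target_eq by (metis f_inv_into_f)

lemma inv_in [simp]: "y \<in> Y \<Longrightarrow> inv_into X h y \<in> X"
  using target_eq by (metis inv_into_into)

lemma image_inv_image [simp]: "S \<subseteq> X \<Longrightarrow> inv_into X h ` h ` S = S"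
  using bij by (simp add: bij_betw_def inv_into_image_cancel)

lemma seg_sub: "seg X d a b \<subseteq> X"
  by (auto simp: seg_def)

lemma line_sub: "line_through X d a b \<subseteq> X"
  by (auto simp: line_through_def)

lemma seg_iff: "a \<in> X \<Longrightarrow> b \<in> X \<Longrightarrow> x \<in> X \<Longrightarrow> h x \<in> seg Y e (h a) (h b) \<longleftrightarrow> x \<in> seg X d a b"
  by (simp add: seg_def iso)

lemma seg_image: "a \<in> X \<Longrightarrow> b \<in> X \<Longrightarrow> seg Y e (h a) (h b) = h ` seg X d a b"
  by (auto simp: seg_def iso target_eq)

lemma target_set_eqI: "S \<subseteq> X \<Longrightarrow> T \<subseteq> Y \<Longrightarrow> (\<And>x. x \<in> X \<Longrightarrow> h x \<in> T \<longleftrightarrow> x \<in> S) \<Longrightarrow> T = h ` S"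
  using target_eq by blast

lemma ray_image: "a \<in> X \<Longrightarrow> b \<in> X \<Longrightarrow> ray Y e (h a) (h b) = h ` ray X d a b"
  by (rule target_set_eqI) (auto simp: ray_def seg_iff)

lemma line_image: "a \<in> X \<Longrightarrow> b \<in> X \<Longrightarrow> line_through Y e (h a) (h b) = h ` line_through X d a b"
  by (rule target_set_eqI) (auto simp: line_through_def seg_iff)

lemma midpoint_iff:
  "a \<in> X \<Longrightarrow> b \<in> X \<Longrightarrow> x \<in> X \<Longrightarrow> is_midpoint Y e (h a) (h b) (h x) \<longleftrightarrow> is_midpoint X d a b x"
  by (simp add: is_midpoint_def iso)

lemma same_side_iff:
  "L \<subseteq> X \<Longrightarrow> x \<in> X \<Longrightarrow> y \<in> X \<Longrightarrow> same_side Y e (h ` L) (h x) (h y) \<longleftrightarrow> same_side X d L x y"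
  using seg_sub [of x y]
  by (auto simp: same_side_def seg_image mem_image_iff image_Int [symmetric])

lemma geod_convex_iff:
  assumes "S \<subseteq> X" shows "geod_convex Y e (h ` S) \<longleftrightarrow> geod_convex X d S"
proof -
  have "h ` seg X d x y \<subseteq> h ` S \<longleftrightarrow> seg X d x y \<subseteq> S" for x y
    using assms seg_sub [of x y] mem_image_iff by blast
  moreover have "h ` S \<subseteq> Y" using assms by (auto simp: target_eq)
  moreover have "seg Y e (h x) (h y) = h ` seg X d x y" if "x \<in> S" "y \<in> S" for x y
    using that assms by (intro seg_image) auto
  ultimately show ?thesis
    using assms by (simp add: geod_convex_def)
qed

lemma is_isometry_conj:
  assumes "is_isometry X d g"
  shows "is_isometry Y e (h \<circ> g \<circ> inv_into X h)"
  unfolding is_isometry_def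
proof (intro conjI ballI)
  have g: "bij_betw g X X" using assms by (simp add: is_isometry_def)
  show "bij_betw (h \<circ> g \<circ> inv_into X h) Y Y"
    using bij_betw_trans [OF bij_betw_inv_into [OF bij] bij_betw_trans [OF g bij]]
    by (simp add: comp_assoc)
  have gX: "g x \<in> X" if "x \<in> X" for x using g that by (auto simp: bij_betw_def)
  fix x y assume "x \<in> Y" "y \<in> Y"
  then show "e ((h \<circ> g \<circ> inv_into X h) x) ((h \<circ> g \<circ> inv_into X h) y) = e x y"
    using assms iso [of "inv_into X h x" "inv_into X h y"] by (simp add: is_isometry_def iso gX)
qed

lemma angle_cong_image:
  assumes X: "a \<in> X" "b \<in> X" "c \<in> X" "a' \<in> X" "b' \<in> X" "c' \<in> X"
    and "angle_cong X d a b c a' b' c'"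
  shows "angle_cong Y e (h a) (h b) (h c) (h a') (h b') (h c')"
proof -
  obtain g where g: "is_isometry X d g" "g b = b'" "g ` ray X d b a = ray X d b' a'"
      "g ` ray X d b c = ray X d b' c'"
    using assms(7) by (auto simp: angle_cong_def)
  have r: "(h \<circ> g \<circ> inv_into X h) ` h ` ray X d x y = h ` g ` ray X d x y" for x y
  proof -
    have "ray X d x y \<subseteq> X" by (auto simp: ray_def)
    then show ?thesis by (metis image_comp image_inv_image)
  qed
  show ?thesis
    unfolding angle_cong_def
    by (rule exI [of _ "h \<circ> g \<circ> inv_into X h"])
       (use X g is_isometry_conj [OF g(1)] r in \<open>simp add: ray_image o_def\<close>)
qed

lemma corner_in: "vs \<noteq> [] \<Longrightarrow> set vs \<subseteq> X \<Longrightarrow> corner vs i \<in> X"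
  by (auto simp: corner_def)

lemma convex_polygon_image:
  assumes "convex_polygon X d vs"
  shows "convex_polygon Y e (map h vs)"
proof -
  have ne: "vs \<noteq> []" and sub: "set vs \<subseteq> X" using assms by (auto simp: convex_polygon_def)
  have cX: "corner vs i \<in> X" for i by (rule corner_in [OF ne sub])
  have s: "same_side Y e (line_through Y e (h (corner vs i)) (h (corner vs (i + 1)))) (h (corner vs j)) (h (corner vs k))
      \<longleftrightarrow> same_side X d (line_through X d (corner vs i) (corner vs (i + 1))) (corner vs j) (corner vs k)" for i j k
    by (simp only: line_image [OF cX cX] same_side_iff [OF line_sub cX cX])
  have "set (map h vs) \<subseteq> Y" using sub by (auto simp: target_eq)
  then show ?thesis
    using assms unfolding convex_polygon_def
    by (simp only: corner_map [OF ne] s length_map eq_iff [OF cX cX] simp_thms) blast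
qed

lemma regular_polygon_image:
  assumes "regular_polygon X d vs"
  shows "regular_polygon Y e (map h vs)"
proof -
  have ne: "vs \<noteq> []" and sub: "set vs \<subseteq> X"
    using assms by (auto simp: regular_polygon_def convex_polygon_def)
  have cX: "corner vs i \<in> X" for i by (rule corner_in [OF ne sub])
  show ?thesis
    unfolding regular_polygon_def corner_map [OF ne] iso [OF cX cX]
    using assms angle_cong_image [OF cX cX cX cX cX cX]
    by (simp add: regular_polygon_def convex_polygon_image)
qed

lemma region_sub: "set vs \<subseteq> X \<Longrightarrow> region X d vs \<subseteq> X"
  unfolding region_def by (rule hull_minimal) (auto simp: geod_convex_def seg_sub)

lemma region_image:
  assumes "set vs \<subseteq> X"
  shows "region Y e (map h vs) = h ` region X d vs"
proof
  \<comment> \<open>\<open>hull\<close> intersects all convex supersets; since \<open>X\<close> is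
    one of them, the intersection stays inside \<open>X\<close>, as \<open>geod_convex\<close>
    demands.\<close>
  have gX: "geod_convex X d (region X d vs)"
  proof -
    have "x \<in> S \<Longrightarrow> S \<in> {T. geod_convex X d T \<and> set vs \<subseteq> T} \<Longrightarrow> x \<in> X" for x S
      by (auto simp: geod_convex_def)
    moreover have "X \<in> {T. geod_convex X d T \<and> set vs \<subseteq> T}"
      using assms by (auto simp: geod_convex_def seg_sub)
    ultimately show ?thesis
      unfolding region_def hull_def geod_convex_def by blast
  qed
  have vsr: "set vs \<subseteq> region X d vs" unfolding region_def by (rule hull_subset)
  show "region Y e (map h vs) \<subseteq> h ` region X d vs"
    unfolding region_def [of Y]
    by (rule hull_minimal) (use vsr gX geod_convex_iff region_sub [OF assms] in auto)
  \<comment> \<open>A convex superset of the image corners pulls back to a convex superset of the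
    corners, which therefore contains the region.\<close>
  have "region X d vs \<subseteq> {x \<in> X. h x \<in> S}" if S: "geod_convex Y e S" "h ` set vs \<subseteq> S" for S
    unfolding region_def
  proof (rule hull_minimal)
    show "set vs \<subseteq> {x \<in> X. h x \<in> S}" using assms S by auto
    have "h ` {x \<in> X. h x \<in> S} = S" using S(1) by (auto simp: geod_convex_def target_eq)
    then show "geod_convex X d {x \<in> X. h x \<in> S}"
      using geod_convex_iff [of "{x \<in> X. h x \<in> S}"] S by simp
  qed
  then show "h ` region X d vs \<subseteq> region Y e (map h vs)"
    unfolding region_def [of Y] hull_def by auto
qed

lemma sides_image:
  assumes "vs \<noteq> []" "set vs \<subseteq> X"
  shows "sides Y e (map h vs) = (`) h ` sides X d vs"
proof -
  have cX: "corner vs i \<in> X" for i by (rule corner_in [OF assms])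
  show ?thesis
    by (auto simp: sides_def corner_map [OF assms(1)] cX seg_image image_iff)
qed

lemma is_centre_iff: "set vs \<subseteq> X \<Longrightarrow> c \<in> X \<Longrightarrow> is_centre Y e (map h vs) (h c) \<longleftrightarrow> is_centre X d vs c"
  by (auto simp: is_centre_def iso subset_iff)

lemma face_cycles_image_sub:
  "map h ` face_cycles X d F \<subseteq> face_cycles Y e ((`) h ` F)"
proof
  fix ws assume "ws \<in> map h ` face_cycles X d F"
  then obtain vs where vs: "ws = map h vs" "regular_polygon X d vs" "region X d vs \<in> F"
    by (auto simp: face_cycles_def)
  then have "set vs \<subseteq> X" by (auto simp: regular_polygon_def convex_polygon_def)
  then show "ws \<in> face_cycles Y e ((`) h ` F)"
    using vs by (auto simp: face_cycles_def regular_polygon_image region_image)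
qed

lemma image_family_inverse: "\<Union> F \<subseteq> X \<Longrightarrow> (`) (inv_into X h) ` (`) h ` F = F"
proof -
  assume F: "\<Union> F \<subseteq> X"
  have "inv_into X h ` h ` f = f" if "f \<in> F" for f using that F by (intro image_inv_image) auto
  then show ?thesis by (force simp: image_iff)
qed

lemma face_cycles_image:
  assumes "\<Union> F \<subseteq> X"
  shows "face_cycles Y e ((`) h ` F) = map h ` face_cycles X d F"
proof
  interpret I: isom Y e X d "inv_into X h" by (rule inverse)
  show "face_cycles Y e ((`) h ` F) \<subseteq> map h ` face_cycles X d F"
  proof
    fix ws assume ws: "ws \<in> face_cycles Y e ((`) h ` F)"
    then have "map (inv_into X h) ws \<in> face_cycles X d ((`) (inv_into X h) ` (`) h ` F)"
      using I.face_cycles_image_sub by blast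
    then have "map (inv_into X h) ws \<in> face_cycles X d F"
      using image_family_inverse [OF assms] by simp
    moreover have "set ws \<subseteq> Y"
      using ws by (auto simp: face_cycles_def regular_polygon_def convex_polygon_def)
    then have "map h (map (inv_into X h) ws) = ws" by (auto simp: map_idI subset_iff)
    ultimately show "ws \<in> map h ` face_cycles X d F" by (metis image_eqI)
  qed
qed (rule face_cycles_image_sub)

lemma face_cycles_sub: "vs \<in> face_cycles X d F \<Longrightarrow> vs \<noteq> [] \<and> set vs \<subseteq> X"
  by (auto simp: face_cycles_def regular_polygon_def convex_polygon_def)

lemma geom_points_image:
  assumes F: "\<Union> F \<subseteq> X"
  shows "geom_points Y e ((`) h ` F) k = h ` geom_points X d F k"
proof -
  note fc = face_cycles_image [OF F] face_cycles_sub
  have v: "vertices Y e ((`) h ` F) = h ` vertices X d F"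
    by (auto simp: vertices_def fc)
  have e: "edge_centres Y e ((`) h ` F) = h ` edge_centres X d F"
  proof -
    have "x \<in> edge_centres Y e ((`) h ` F) \<longleftrightarrow> x \<in> h ` edge_centres X d F" for x
    proof (cases "x \<in> Y")
      case True
      then obtain y where y: "x = h y" "y \<in> X" by (auto simp: target_eq)
      have sub: "edge_centres X d F \<subseteq> X" by (auto simp: edge_centres_def is_midpoint_def)
      have "is_midpoint Y e (corner (map h vs) i) (corner (map h vs) (i + 1)) (h y) \<longleftrightarrow>
            is_midpoint X d (corner vs i) (corner vs (i + 1)) y" if "vs \<in> face_cycles X d F" for vs i
        using fc(2) [OF that] y by (simp add: corner_map corner_in midpoint_iff)
      then show ?thesis
        unfolding y(1) mem_image_iff [OF y(2) sub]
        by (auto simp: edge_centres_def fc(1))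
    next
      case False
      then show ?thesis by (auto simp: edge_centres_def is_midpoint_def)
    qed
    then show ?thesis by blast
  qed
  have f: "face_centres Y e ((`) h ` F) = h ` face_centres X d F"
  proof -
    have "x \<in> face_centres Y e ((`) h ` F) \<longleftrightarrow> x \<in> h ` face_centres X d F" for x
    proof (cases "x \<in> Y")
      case True
      then obtain y where y: "x = h y" "y \<in> X" by (auto simp: target_eq)
      have sub: "face_centres X d F \<subseteq> X" by (auto simp: face_centres_def is_centre_def)
      have "is_centre Y e (map h vs) (h y) \<longleftrightarrow> is_centre X d vs y" if "vs \<in> face_cycles X d F" for vs
        using fc(2) [OF that] y by (simp add: is_centre_iff)
      then show ?thesis
        unfolding y(1) mem_image_iff [OF y(2) sub]
        by (auto simp: face_centres_def fc(1))
    next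
      case False
      then show ?thesis by (auto simp: face_centres_def is_centre_def)
    qed
    then show ?thesis by blast
  qed
  show ?thesis by (simp add: geom_points_def v e f)
qed

lemma barycentric_triangle_image:
  assumes F: "\<Union> F \<subseteq> X" and b: "barycentric_triangle X d F v0 v1 v2"
  shows "barycentric_triangle Y e ((`) h ` F) (h v0) (h v1) (h v2)"
proof -
  obtain vs i where vs: "vs \<in> face_cycles X d F" "v0 \<in> {corner vs i, corner vs (i + 1)}"
      "is_midpoint X d (corner vs i) (corner vs (i + 1)) v1" "is_centre X d vs v2"
    using b by (auto simp: barycentric_triangle_def)
  have "v1 \<in> X" "v2 \<in> X" using vs by (auto simp: is_midpoint_def is_centre_def)
  with vs face_cycles_sub [OF vs(1)] show ?thesis
    unfolding barycentric_triangle_def face_cycles_image [OF F]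
    by (intro bexI [of _ "map h vs"] exI [of _ i])
       (auto simp: corner_map corner_in midpoint_iff is_centre_iff)
qed

lemma regular_tessellation_image:
  assumes t: "regular_tessellation X d m n F"
  shows "regular_tessellation Y e m n ((`) h ` F)"
proof -
  have U: "\<Union> F = X" using t by (rule tessellation_Union)
  then have UX: "\<Union> F \<subseteq> X" by simp
  then have fX: "f \<subseteq> X" if "f \<in> F" for f using that by auto
  have injF: "inj_on ((`) h) F" using fX by (auto simp: inj_on_def inj_image)
  show ?thesis
    unfolding regular_tessellation_def face_cycles_image [OF UX]
  proof (intro conjI ballI impI)
    fix f assume "f \<in> (`) h ` F"
    then obtain g where g: "f = h ` g" "g \<in> F" by auto
    then obtain vs where vs: "length vs = m" "regular_polygon X d vs" "g = region X d vs"
      using tessellation_face [OF t g(2)] by auto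
    then have "set vs \<subseteq> X" by (auto simp: regular_polygon_def convex_polygon_def)
    then show "\<exists>vs. length vs = m \<and> regular_polygon Y e vs \<and> f = region Y e vs"
      using vs g by (intro exI [of _ "map h vs"]) (simp add: regular_polygon_image region_image)
  next
    show "\<Union> ((`) h ` F) = Y" using U target_eq by blast
  next
    fix x assume "x \<in> Y"
    then obtain y where y: "x = h y" "y \<in> X" by (auto simp: target_eq)
    then obtain r where r: "r > 0" "finite {f \<in> F. \<exists>z \<in> f. d y z < r}"
      using tessellation_finite [OF t y(2)] by auto
    have "{f \<in> (`) h ` F. \<exists>z \<in> f. e x z < r} \<subseteq> (`) h ` {f \<in> F. \<exists>z \<in> f. d y z < r}"
    proof
      fix f assume "f \<in> {f \<in> (`) h ` F. \<exists>z \<in> f. e x z < r}"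
      then obtain g z where g: "g \<in> F" "f = h ` g" "z \<in> g" "e x (h z) < r" by auto
      then have "z \<in> X" using fX by auto
      then have "d y z < r" using g iso y by simp
      then show "f \<in> (`) h ` {f \<in> F. \<exists>z \<in> f. d y z < r}" using g by blast
    qed
    then show "\<exists>r>0. finite {f \<in> (`) h ` F. \<exists>z \<in> f. e x z < r}"
      using r by (meson finite_imageI finite_subset)
  next
    fix us' vs' assume "us' \<in> map h ` face_cycles X d F" "vs' \<in> map h ` face_cycles X d F"
      and ne: "region Y e us' \<noteq> region Y e vs'"
    then obtain us vs where uv: "us' = map h us" "vs' = map h vs" "us \<in> face_cycles X d F"
      "vs \<in> face_cycles X d F" by auto
    note s = face_cycles_sub [OF uv(3)] face_cycles_sub [OF uv(4)]
    have ru: "region Y e us' = h ` region X d us" "region Y e vs' = h ` region X d vs"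
      using s uv by (auto simp: region_image)
    have su: "sides Y e us' = (`) h ` sides X d us" "sides Y e vs' = (`) h ` sides X d vs"
      using s uv by (auto simp: sides_image)
    have I: "region Y e us' \<inter> region Y e vs' = h ` (region X d us \<inter> region X d vs)"
      using s ru region_sub by (simp add: image_Int)
    have "region X d us \<noteq> region X d vs" using ne ru by auto
    then consider "region X d us \<inter> region X d vs = {}"
      | x where "x \<in> set us \<inter> set vs" "region X d us \<inter> region X d vs = {x}"
      | "region X d us \<inter> region X d vs \<in> sides X d us \<inter> sides X d vs"
      using tessellation_Int [OF t uv(3,4)] by blast
    then show "region Y e us' \<inter> region Y e vs' = {} \<or>
      (\<exists>x\<in>set us' \<inter> set vs'. region Y e us' \<inter> region Y e vs' = {x}) \<or>
      region Y e us' \<inter> region Y e vs' \<in> sides Y e us' \<inter> sides Y e vs'"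
    proof cases
      case 1 then show ?thesis using I by simp
    next
      case 2 then show ?thesis using I uv by auto
    next
      case 3 then show ?thesis unfolding I su by blast
    qed
  next
    fix vs' x' assume "vs' \<in> map h ` face_cycles X d F" "x' \<in> set vs'"
    then obtain vs x where vs: "vs \<in> face_cycles X d F" "x' = h x" "x \<in> set vs" by auto
    then have xX: "x \<in> X" using face_cycles_sub by blast
    have "{f \<in> (`) h ` F. x' \<in> f} = (`) h ` {f \<in> F. x \<in> f}"
    proof -
      have "x' \<in> h ` f \<longleftrightarrow> x \<in> f" if "f \<in> F" for f
        unfolding vs(2) by (rule mem_image_iff [OF xX fX [OF that]])
      then show ?thesis by blast
    qed
    moreover have "inj_on ((`) h) {f \<in> F. x \<in> f}" using injF by (rule inj_on_subset) auto
    ultimately show "card {f \<in> (`) h ` F. x' \<in> f} = n"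
      using tessellation_card [OF t vs(1,3)] by (simp add: card_image)
  qed
qed

lemma has_pattern_image:
  assumes F: "\<Union> F \<subseteq> X" and L: "L \<subseteq> X" and "has_pattern X d F L w"
  shows "has_pattern Y e ((`) h ` F) (h ` L) w"
proof -
  obtain \<gamma> :: "real \<Rightarrow> 'a" and t :: "int \<Rightarrow> real" where g: "\<And>r s. d (\<gamma> r) (\<gamma> s) = \<bar>r - s\<bar>"
      "range \<gamma> = L" "strict_mono t" "{s. \<exists>k. \<gamma> s \<in> geom_points X d F k} = range t"
      "\<And>i k. \<gamma> (t i) \<in> geom_points X d F k \<longleftrightarrow> k = w ! nat (i mod int (length w))"
    using assms(3) unfolding has_pattern_def by metis
  have gX: "\<gamma> s \<in> X" for s using g(2) L by auto
  have sub: "geom_points X d F k \<subseteq> X" for k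
    using face_cycles_sub [of _ F]
    by (auto simp: geom_points_def vertices_def edge_centres_def face_centres_def is_midpoint_def is_centre_def)
  have m: "h (\<gamma> s) \<in> geom_points Y e ((`) h ` F) k \<longleftrightarrow> \<gamma> s \<in> geom_points X d F k" for s k
    by (simp add: geom_points_image [OF F] mem_image_iff [OF gX sub])
  show ?thesis
    unfolding has_pattern_def
  proof (rule exI [of _ "h \<circ> \<gamma>"], rule exI [of _ t], intro conjI allI)
    show "e ((h \<circ> \<gamma>) r) ((h \<circ> \<gamma>) s) = \<bar>r - s\<bar>" for r s by (simp add: iso gX g(1))
    show "range (h \<circ> \<gamma>) = h ` L" unfolding g(2) [symmetric] by (rule image_comp [symmetric])
    show "strict_mono t" by (rule g(3))
    show "{s. \<exists>k. (h \<circ> \<gamma>) s \<in> geom_points Y e ((`) h ` F) k} = range t" using g(4) m by simp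
    show "(h \<circ> \<gamma>) (t i) \<in> geom_points Y e ((`) h ` F) k \<longleftrightarrow> k = w ! nat (i mod int (length w))" for i k
      using g(5) m by simp
  qed
qed

end

lemma is_isometry_iff: "is_isometry X d g \<longleftrightarrow> isom X d X d g"
  by (auto simp: is_isometry_def isom_def)

lemma mirror_conjugate:
  assumes g: "is_isometry X d g" and f: "is_isometry X d f"
  shows "mirror X (conjugate X g f) = g ` mirror X f"
proof -
  interpret isom X d X d g using g by (simp add: is_isometry_iff)
  have fX: "f x \<in> X" if "x \<in> X" for x using f that by (auto simp: is_isometry_def bij_betw_def)
  show ?thesis
    by (rule target_set_eqI) (auto simp: mirror_def conjugate_def fX)
qed

text \<open>An automorphism \<open>g\<close> maps the mirror of \<open>f\<close> onto the mirror of
  the conjugate and permutes the faces, so the pattern is transported with the same word. The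
  theorem thus reduces to one pattern for each side line.\<close>

lemma mirrors_have_pattern_of_mirror:
  assumes "\<Union> F \<subseteq> X" and "is_reflection X d L f" and "has_pattern X d F L w"
  shows "mirrors_have_pattern X d F f w"
  unfolding mirrors_have_pattern_def
proof (intro conjI ballI)
  have f: "is_isometry X d f" "mirror X f = L" using assms(2) by (auto simp: is_reflection_def)
  then show "has_pattern X d F (mirror X f) w" using assms(3) by simp
  have L: "L \<subseteq> X" using f(2) by (auto simp: mirror_def)
  fix g assume "g \<in> map_aut X d F"
  then have g: "is_isometry X d g" "(`) g ` F = F" by (auto simp: map_aut_def)
  interpret isom X d X d g using g(1) by (simp add: is_isometry_iff)
  show "has_pattern X d F (mirror X (conjugate X g f)) w"
    using has_pattern_image [OF assms(1) L assms(3)] g f by (simp add: mirror_conjugate)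
qed

subsection \<open>Charts with straight geodesics\<close>

text \<open>
  The polar coordinate \<open>T\<close> turns distance from the origin into the modulus: the identity for the
  Euclidean plane, \<open>tanh\<close> for the Klein disc.
\<close>

locale model_plane =
  fixes U :: "complex set" and d :: "complex \<Rightarrow> complex \<Rightarrow> real" and T :: "real \<Rightarrow> real"
  assumes zero_in: "0 \<in> U"
    and open_U: "open U"
    and convex_U: "convex U"
    and seg_eq: "\<And>a b. a \<in> U \<Longrightarrow> b \<in> U \<Longrightarrow> seg U d a b = closed_segment a b"
    and d_sym: "\<And>a b. d a b = d b a"
    and d_nonneg: "\<And>a b. a \<in> U \<Longrightarrow> b \<in> U \<Longrightarrow> 0 \<le> d a b"
    and d_zero: "\<And>a b. a \<in> U \<Longrightarrow> b \<in> U \<Longrightarrow> d a b = 0 \<longleftrightarrow> a = b"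
    and homogeneous: "\<And>p. p \<in> U \<Longrightarrow> \<exists>h. isom U d U d h \<and> h p = 0"
    and rotation: "\<And>u. cmod u = 1 \<Longrightarrow> isom U d U d ((*) u)"
    and T_mono: "strict_mono T"
    and T_minus: "\<And>s. T (- s) = - T s"
    and T_surj: "\<And>z. z \<in> U \<Longrightarrow> \<exists>s. T s = cmod z"
    and T_in: "\<And>s u. cmod u = 1 \<Longrightarrow> of_real (T s) * u \<in> U"
    and T_dist: "\<And>r s u. cmod u = 1 \<Longrightarrow> d (of_real (T r) * u) (of_real (T s) * u) = \<bar>r - s\<bar>"
    and equidistant: "\<And>p x y. p \<in> U \<Longrightarrow> x \<in> U \<Longrightarrow> y \<in> U \<Longrightarrow> cmod x = cmod y \<Longrightarrow>
          d p x = d p y \<longleftrightarrow> cmod (p - x) = cmod (p - y)"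
    and scale_mono: "\<And>r s u v. 0 \<le> r \<Longrightarrow> r < s \<Longrightarrow> cmod u = 1 \<Longrightarrow> cmod v = 1 \<Longrightarrow> u \<noteq> v \<Longrightarrow>
          of_real s * u \<in> U \<Longrightarrow> d (of_real r * u) (of_real r * v) < d (of_real s * u) (of_real s * v)"
    and barycentre: "\<And>A. finite A \<Longrightarrow> A \<noteq> {} \<Longrightarrow> A \<subseteq> U \<Longrightarrow>
          \<exists>c\<in>U. \<forall>h. isom U d U d h \<longrightarrow> h ` A = A \<longrightarrow> h c = c"
    and small_dist: "\<And>p r. p \<in> U \<Longrightarrow> r > 0 \<Longrightarrow> \<exists>e>0. \<forall>y\<in>U. dist y p < e \<longrightarrow> d p y < r"

text \<open>The centroid is recognised by distances alone: the sum of squared distances from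
  \<open>x\<close> to \<open>A\<close> exceeds its value at the centroid by a multiple of the
  squared distance from \<open>x\<close> to the centroid. As \<open>h\<close> permutes
  \<open>A\<close>, the sum takes the same value at the image of the centroid, which forces
  equality.\<close>

lemma euclid_barycentre:
  assumes A: "finite A" "A \<noteq> {}" and h: "isom UNIV dist UNIV dist h" "h ` A = A"
  shows "h ((\<Sum>a\<in>A. a) /\<^sub>R card A) = ((\<Sum>a\<in>A. a) /\<^sub>R card A :: complex)"
proof -
  define c where "c = (\<Sum>a\<in>A. a) /\<^sub>R card A"
  interpret isom UNIV dist UNIV dist h by (rule h)
  have card: "real (card A) > 0" using A by (simp add: card_gt_0_iff)
  have sc: "(\<Sum>a\<in>A. c - a) = 0"
    using card by (simp add: sum_subtractf c_def scaleR_conv_of_real)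
  have key: "(\<Sum>a\<in>A. (dist x a)\<^sup>2) = card A * (dist x c)\<^sup>2 + (\<Sum>a\<in>A. (dist c a)\<^sup>2)" for x
  proof -
    have "(dist x a)\<^sup>2 = (dist x c)\<^sup>2 + 2 * inner (x - c) (c - a) + (dist c a)\<^sup>2" for a
      by (simp add: dist_norm power2_norm_eq_inner inner_diff_left inner_diff_right inner_commute)
    then have "(\<Sum>a\<in>A. (dist x a)\<^sup>2) =
        (\<Sum>a\<in>A. (dist x c)\<^sup>2 + 2 * inner (x - c) (c - a) + (dist c a)\<^sup>2)"
      by (intro sum.cong refl)
    then have "(\<Sum>a\<in>A. (dist x a)\<^sup>2) =
        card A * (dist x c)\<^sup>2 + 2 * inner (x - c) (\<Sum>a\<in>A. c - a) + (\<Sum>a\<in>A. (dist c a)\<^sup>2)"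
      by (simp add: sum.distrib inner_sum_right sum_distrib_left)
    then show ?thesis by (simp add: sc)
  qed
  have inj: "inj_on h A" using bij by (auto simp: bij_betw_def intro: inj_on_subset)
  have "(\<Sum>a\<in>A. (dist (h c) a)\<^sup>2) = (\<Sum>a\<in>h ` A. (dist (h c) a)\<^sup>2)" using h by simp
  also have "\<dots> = (\<Sum>a\<in>A. (dist (h c) (h a))\<^sup>2)" by (rule sum.reindex_cong [OF inj refl refl])
  also have "\<dots> = (\<Sum>a\<in>A. (dist c a)\<^sup>2)" by (simp add: iso)
  finally have "real (card A) * (dist (h c) c)\<^sup>2 = 0" using key [of "h c"] by simp
  then show ?thesis using card by (simp add: c_def)
qed

lemma isom_translation: "isom UNIV dist UNIV dist (\<lambda>z. z - p :: complex)"
proof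
  show "bij_betw (\<lambda>z. z - p) UNIV UNIV"
    by (rule bij_betw_byWitness [where f' = "\<lambda>z. z + p"]) auto
qed (simp add: dist_norm)

lemma isom_rotation:
  assumes "cmod u = 1" shows "isom UNIV dist UNIV dist ((*) u)"
proof
  have "u \<noteq> 0" using assms by auto
  then show "bij_betw ((*) u) UNIV UNIV"
    by (intro bij_betw_byWitness [where f' = "\<lambda>z. z / u"]) auto
qed (use assms in \<open>simp add: dist_norm norm_mult flip: right_diff_distrib\<close>)

lemma euclid_model: "model_plane UNIV dist (\<lambda>s. s)"
proof (rule model_plane.intro)
  show "seg UNIV dist a b = closed_segment a b" for a b :: complex
  proof -
    have "dist a x + dist x b = dist a b \<longleftrightarrow> x \<in> closed_segment a b" for x
      unfolding between_mem_segment [symmetric] between by (rule eq_commute)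
    then show ?thesis by (simp add: seg_def)
  qed
  show "\<exists>h :: complex \<Rightarrow> complex. isom UNIV dist UNIV dist h \<and> h p = 0" for p
    by (rule exI [of _ "\<lambda>z. z - p"]) (simp add: isom_translation)
  show "strict_mono (\<lambda>s :: real. s)" by (simp add: strict_mono_def)
  show "dist (complex_of_real r * u) (complex_of_real s * u) = \<bar>r - s\<bar>" if "cmod u = 1" for r s u
    using that by (simp add: dist_norm norm_mult flip: left_diff_distrib of_real_diff)
  show "dist (complex_of_real r * u) (complex_of_real r * v) < dist (complex_of_real s * u) (complex_of_real s * v)"
    if "0 \<le> r" "r < s" "u \<noteq> v" for r s u v
    using that by (simp add: dist_norm norm_mult flip: right_diff_distrib)
  show "\<exists>c\<in>UNIV. \<forall>h. isom UNIV dist UNIV dist h \<longrightarrow> h ` A = A \<longrightarrow> h c = c"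
    if "finite A" "A \<noteq> {}" for A :: "complex set"
    using euclid_barycentre [OF that] by blast
  show "\<exists>e>0. \<forall>y\<in>UNIV. dist y p < e \<longrightarrow> dist p y < r" if "r > 0" for p :: complex and r
    using that by (metis dist_commute)
qed (auto simp: isom_rotation dist_norm norm_minus_commute)

text \<open>The Lorentz product of the lifts \<open>(1, z) / sqrt (1 - |z|^2)\<close> and
  \<open>(1, w) / sqrt (1 - |w|^2)\<close> to the hyperboloid, which is the hyperbolic cosine of the
  distance in curvature -1.\<close>

definition klein_cosh :: "complex \<Rightarrow> complex \<Rightarrow> real" where
  "klein_cosh z w = (1 - inner z w) / (sqrt (1 - (cmod z)\<^sup>2) * sqrt (1 - (cmod w)\<^sup>2))"

definition klein_dist :: "complex \<Rightarrow> complex \<Rightarrow> real" where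
  "klein_dist z w = arcosh (klein_cosh z w)"

lemma disc_pos: "z \<in> ball 0 1 \<Longrightarrow> 0 < 1 - (cmod z)\<^sup>2"
  by (simp add: power_less_one_iff)

lemma disc_sqrt_pos: "z \<in> ball 0 1 \<Longrightarrow> 0 < sqrt (1 - (cmod z)\<^sup>2)"
  using disc_pos by simp

text \<open>Written as 1 plus a visibly nonnegative quotient, the Lorentz product is at least 1,
  where \<open>arcosh\<close> inverts \<open>cosh\<close>, and it is 1 only for
  \<open>z = w\<close>.\<close>

lemma klein_cosh_eq:
  assumes "z \<in> ball 0 1" "w \<in> ball 0 1"
  shows "klein_cosh z w = 1 + ((sqrt (1 - (cmod z)\<^sup>2) - sqrt (1 - (cmod w)\<^sup>2))\<^sup>2 + (cmod (z - w))\<^sup>2)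
            / (2 * (sqrt (1 - (cmod z)\<^sup>2) * sqrt (1 - (cmod w)\<^sup>2)))"
proof -
  define p q where "p = sqrt (1 - (cmod z)\<^sup>2)" and "q = sqrt (1 - (cmod w)\<^sup>2)"
  have pq: "p > 0" "q > 0" using assms disc_sqrt_pos by (auto simp: p_def q_def)
  have "p\<^sup>2 = 1 - (cmod z)\<^sup>2" "q\<^sup>2 = 1 - (cmod w)\<^sup>2"
    using assms disc_pos by (auto simp: p_def q_def less_imp_le)
  moreover have "(cmod (z - w))\<^sup>2 = (cmod z)\<^sup>2 + (cmod w)\<^sup>2 - 2 * inner z w"
    by (simp add: power2_norm_eq_inner inner_diff_left inner_diff_right inner_commute)
  ultimately have "2 * (1 - inner z w) = 2 * (p * q) + ((p - q)\<^sup>2 + (cmod (z - w))\<^sup>2)"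
    by (simp add: power2_diff)
  then have "1 - inner z w = p * q + ((p - q)\<^sup>2 + (cmod (z - w))\<^sup>2) / 2"
  proof -
    have "a = b + n / 2" if "2 * a = 2 * b + n" for a b n :: real using that by simp
    from this [OF \<open>2 * (1 - inner z w) = _\<close>] show ?thesis .
  qed
  then show ?thesis
    unfolding klein_cosh_def p_def [symmetric] q_def [symmetric]
    using pq by (simp add: add_divide_distrib)
qed

lemma klein_cosh_ge_1: "z \<in> ball 0 1 \<Longrightarrow> w \<in> ball 0 1 \<Longrightarrow> 1 \<le> klein_cosh z w"
  using disc_sqrt_pos [of z] disc_sqrt_pos [of w]
  by (simp add: klein_cosh_eq del: mem_ball mem_ball_0)

lemma klein_cosh_eq_1: "z \<in> ball 0 1 \<Longrightarrow> w \<in> ball 0 1 \<Longrightarrow> klein_cosh z w = 1 \<longleftrightarrow> z = w"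
  using disc_sqrt_pos [of z] disc_sqrt_pos [of w]
  by (auto simp add: klein_cosh_eq add_nonneg_eq_0_iff simp del: mem_ball mem_ball_0)

lemma cosh_klein_dist: "z \<in> ball 0 1 \<Longrightarrow> w \<in> ball 0 1 \<Longrightarrow> cosh (klein_dist z w) = klein_cosh z w"
  by (simp add: klein_dist_def klein_cosh_ge_1 del: mem_ball mem_ball_0)

lemma klein_dist_nonneg: "z \<in> ball 0 1 \<Longrightarrow> w \<in> ball 0 1 \<Longrightarrow> 0 \<le> klein_dist z w"
  by (simp add: klein_dist_def klein_cosh_ge_1 del: mem_ball mem_ball_0)

lemma klein_dist_eqI:
  assumes "z \<in> ball 0 1" "w \<in> ball 0 1" "klein_cosh z w = cosh r" "r \<ge> 0"
  shows "klein_dist z w = r"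
  using assms by (simp add: klein_dist_def arcosh_cosh_real)

lemma klein_dist_eq_iff:
  assumes "z \<in> ball 0 1" "w \<in> ball 0 1" "z' \<in> ball 0 1" "w' \<in> ball 0 1"
  shows "klein_dist z w = klein_dist z' w' \<longleftrightarrow> klein_cosh z w = klein_cosh z' w'"
  using cosh_klein_dist assms by (metis klein_dist_def)

section \<open>Isometries of the Klein disc: rotations and boosts\<close>

lemma klein_isomI:
  assumes bij: "bij_betw h (ball 0 1) (ball 0 1)"
    and "\<And>z w. z \<in> ball 0 1 \<Longrightarrow> w \<in> ball 0 1 \<Longrightarrow> klein_cosh (h z) (h w) = klein_cosh z w"
  shows "isom (ball 0 1) klein_dist (ball 0 1) klein_dist h"
  using assms by (simp add: isom_def klein_dist_def)

lemma klein_rotation: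
  assumes "cmod u = 1"
  shows "isom (ball 0 1) klein_dist (ball 0 1) klein_dist ((*) u)"
proof (rule klein_isomI)
  have "u \<noteq> 0" using assms by auto
  then show "bij_betw ((*) u) (ball 0 1) (ball 0 1)"
    using assms
    by (intro bij_betw_byWitness [where f' = "\<lambda>z. z / u"]) (auto simp: norm_mult norm_divide)
  fix z w
  have "(cmod (u * z - u * w))\<^sup>2 = (cmod (z - w))\<^sup>2"
    using assms by (simp add: norm_mult flip: right_diff_distrib)
  then have "inner (u * z) (u * w) = inner z w"
    using assms by (simp add: power2_norm_eq_inner inner_diff_left inner_diff_right inner_commute)
      (simp add: norm_mult flip: power2_norm_eq_inner)
  then show "klein_cosh (u * z) (u * w) = klein_cosh z w"
    using assms by (simp add: klein_cosh_def norm_mult)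
qed

text \<open>The Lorentz boost along the real axis as a projective map of the Klein disc. It carries
  the real point \<open>p\<close> to the origin, and \<open>boost (- p)\<close> undoes it.\<close>

definition boost :: "real \<Rightarrow> complex \<Rightarrow> complex" where
  "boost p z = Complex ((Re z - p) / (1 - p * Re z)) (sqrt (1 - p\<^sup>2) * Im z / (1 - p * Re z))"

lemma boost_denom:
  assumes "\<bar>p\<bar> < 1" "z \<in> ball 0 1" shows "0 < 1 - p * Re z"
proof -
  have "\<bar>Re z\<bar> < 1" using assms(2) abs_Re_le_cmod [of z] by simp
  then have "\<bar>p * Re z\<bar> < 1"
    using assms(1) mult_left_le [of "\<bar>Re z\<bar>" "\<bar>p\<bar>"] by (simp add: abs_mult)
  then show ?thesis by simp
qed

text \<open>On lifts \<open>(1, z)\<close> a boost is linear and preserves the Lorentz form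
  \<open>1 - inner z w\<close>. The extra factors come from rescaling the first coordinate of each
  image back to 1.\<close>

lemma boost_inner:
  assumes "\<bar>p\<bar> < 1" "z \<in> ball 0 1" "w \<in> ball 0 1"
  shows "1 - inner (boost p z) (boost p w) =
     (1 - p\<^sup>2) * (1 - inner z w) / ((1 - p * Re z) * (1 - p * Re w))"
proof -
  have p: "(sqrt (1 - p\<^sup>2))\<^sup>2 = 1 - p\<^sup>2" using assms(1) by (simp add: abs_square_le_1 less_imp_le)
  define q where "q = sqrt (1 - p\<^sup>2)"
  have q: "q * q = 1 - p * p" using p by (simp add: q_def power2_eq_square)
  define a b where "a = 1 - p * Re z" and "b = 1 - p * Re w"
  have ab: "a \<noteq> 0" "b \<noteq> 0" using boost_denom assms by (force simp: a_def b_def)+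
  have "inner (boost p z) (boost p w) =
      ((Re z - p) * (Re w - p) + (q * q) * (Im z * Im w)) / (a * b)"
    by (simp add: inner_complex_def boost_def q_def a_def b_def add_divide_distrib)
  then have "1 - inner (boost p z) (boost p w) =
      (a * b - ((Re z - p) * (Re w - p) + (1 - p * p) * (Im z * Im w))) / (a * b)"
    using ab by (simp add: q field_simps)
  also have "a * b - ((Re z - p) * (Re w - p) + (1 - p * p) * (Im z * Im w))
      = (1 - p\<^sup>2) * (1 - inner z w)"
    by (simp add: a_def b_def inner_complex_def power2_eq_square algebra_simps)
  finally show ?thesis by (simp add: a_def b_def)
qed

lemma boost_norm:
  assumes "\<bar>p\<bar> < 1" "z \<in> ball 0 1"
  shows "1 - (cmod (boost p z))\<^sup>2 = (1 - p\<^sup>2) * (1 - (cmod z)\<^sup>2) / (1 - p * Re z)\<^sup>2"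
  using boost_inner [OF assms assms(2)] unfolding power2_norm_eq_inner by (simp add: power2_eq_square)

lemma boost_in:
  assumes "\<bar>p\<bar> < 1" "z \<in> ball 0 1" shows "boost p z \<in> ball 0 1"
proof -
  have "0 < 1 - (cmod (boost p z))\<^sup>2"
    unfolding boost_norm [OF assms]
    using boost_denom [OF assms] disc_pos [OF assms(2)] assms(1) by (simp add: abs_square_less_1)
  then show ?thesis by (simp add: power_less_one_iff)
qed

lemma boost_boost:
  assumes "\<bar>p\<bar> < 1" "z \<in> ball 0 1" shows "boost (- p) (boost p z) = z"
proof -
  define a where "a = 1 - p * Re z"
  have a: "a \<noteq> 0" using boost_denom [OF assms] by (simp add: a_def)
  have p1: "1 - p\<^sup>2 > 0" using assms(1) by (simp add: abs_square_less_1)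
  have r: "Re (boost p z) = (Re z - p) / a" "Im (boost p z) = sqrt (1 - p\<^sup>2) * Im z / a"
    by (simp_all add: boost_def a_def)
  have d: "1 - - p * Re (boost p z) = (1 - p\<^sup>2) / a"
    using a by (simp add: r field_simps) (simp add: a_def power2_eq_square algebra_simps)
  have "Re (boost p z) - - p = Re z * (1 - p\<^sup>2) / a"
    using a by (simp add: r field_simps) (simp add: a_def power2_eq_square algebra_simps)
  then have "Re (boost (- p) (boost p z)) = Re z"
    unfolding boost_def [of "- p"] d using a p1 by simp
  moreover have "sqrt (1 - p\<^sup>2) * Im (boost p z) = (1 - p\<^sup>2) * Im z / a"
    using p1 by (simp add: r)
  then have "Im (boost (- p) (boost p z)) = Im z"
    unfolding boost_def [of "- p"] d using a p1 by simp
  ultimately show ?thesis by (simp add: complex_eq_iff)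
qed

lemma klein_boost:
  assumes p: "\<bar>p\<bar> < 1"
  shows "isom (ball 0 1) klein_dist (ball 0 1) klein_dist (boost p)"
proof (rule klein_isomI)
  have p': "\<bar>- p\<bar> < 1" using p by simp
  show "bij_betw (boost p) (ball 0 1) (ball 0 1)"
    by (rule bij_betw_byWitness [where f' = "boost (- p)"])
       (use boost_boost [OF p] boost_boost [OF p'] boost_in [OF p] boost_in [OF p'] in auto)
  fix z w :: complex assume zw: "z \<in> ball 0 1" "w \<in> ball 0 1"
  define a b where "a = 1 - p * Re z" and "b = 1 - p * Re w"
  have ab: "a > 0" "b > 0" using boost_denom p zw by (auto simp: a_def b_def)
  have p1: "1 - p\<^sup>2 > 0" using p by (simp add: abs_square_less_1)
  have s: "sqrt (1 - p\<^sup>2) * sqrt (1 - p\<^sup>2) = 1 - p\<^sup>2" using p1 by simp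
  have "sqrt (1 - (cmod (boost p z))\<^sup>2) = sqrt (1 - p\<^sup>2) * sqrt (1 - (cmod z)\<^sup>2) / a"
    "sqrt (1 - (cmod (boost p w))\<^sup>2) = sqrt (1 - p\<^sup>2) * sqrt (1 - (cmod w)\<^sup>2) / b"
    using ab by (simp_all add: boost_norm p zw real_sqrt_mult real_sqrt_divide a_def b_def del: mem_ball mem_ball_0)
  moreover have "sqrt (1 - (cmod (boost p z))\<^sup>2) * sqrt (1 - (cmod (boost p w))\<^sup>2) =
     (1 - p\<^sup>2) * (sqrt (1 - (cmod z)\<^sup>2) * sqrt (1 - (cmod w)\<^sup>2)) / (a * b)"
    using calculation p1 by simp
  then show "klein_cosh (boost p z) (boost p w) = klein_cosh z w"
    unfolding klein_cosh_def boost_inner [OF p zw] a_def [symmetric] b_def [symmetric]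
    using ab p1 by simp
qed

text \<open>A projective map whose denominator is positive on the disc maps segments to segments;
  only the weights change.\<close>

lemma boost_segment:
  assumes p: "\<bar>p\<bar> < 1" and ab: "a \<in> ball 0 1" "b \<in> ball 0 1" and x: "x \<in> closed_segment a b"
  shows "boost p x \<in> closed_segment (boost p a) (boost p b)"
proof -
  obtain t where t: "0 \<le> t" "t \<le> 1" "x = (1 - t) *\<^sub>R a + t *\<^sub>R b"
    using x by (auto simp: closed_segment_def)
  define A B where "A = 1 - p * Re a" and "B = 1 - p * Re b"
  have AB: "A > 0" "B > 0" using boost_denom p ab by (auto simp: A_def B_def)
  define D where "D = (1 - t) * A + t * B"
  have D: "D > 0"
  proof (cases "t = 0")
    case False
    then show ?thesis using t AB by (auto simp: D_def intro!: add_nonneg_pos)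
  qed (use AB in \<open>simp add: D_def\<close>)
  have Dx: "1 - p * Re x = D" by (simp add: t(3) D_def A_def B_def algebra_simps)
  \<comment> \<open>The weights of the endpoints are multiplied by their denominators
    \<open>A\<close> and \<open>B\<close>; \<open>D\<close>, the denominator at \<open>x\<close>,
    normalises them.\<close>
  define s where "s = t * B / D"
  have s1: "1 - s = (1 - t) * A / D" using D by (simp add: s_def D_def field_simps)
  have "boost p x = (1 - s) *\<^sub>R boost p a + s *\<^sub>R boost p b"
    unfolding s1 unfolding s_def
    using AB D by (simp add: complex_eq_iff boost_def Dx A_def [symmetric] B_def [symmetric])
      (simp add: t(3) field_simps)
  moreover have "0 \<le> s" using t AB D by (simp add: s_def)
  moreover have "0 \<le> 1 - s" using t AB D by (simp add: s1)
  ultimately show ?thesis by (auto simp: closed_segment_def)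
qed

text \<open>Rotate \<open>p\<close> to the nonnegative real axis, then boost. The clause on segments
  is carried along because metric betweenness is not yet known to be straight; it lets
  \<open>klein_seg\<close> place the point under test at the origin.\<close>

lemma klein_homogeneous:
  assumes "p \<in> ball 0 1"
  shows "\<exists>h. isom (ball 0 1) klein_dist (ball 0 1) klein_dist h \<and> h p = 0 \<and>
     (\<forall>a\<in>ball 0 1. \<forall>b\<in>ball 0 1. \<forall>x\<in>ball 0 1. x \<in> closed_segment a b \<longleftrightarrow> h x \<in> closed_segment (h a) (h b))"
proof -
  define u where "u = (if p = 0 then 1 else cnj (sgn p))"
  have u: "cmod u = 1" by (simp add: u_def norm_sgn)
  have up: "u * p = of_real (cmod p)"
  proof (cases "p = 0")
    case False
    then have "u * p = p * cnj p / of_real (cmod p)" by (simp add: u_def sgn_eq)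
    also have "\<dots> = of_real (cmod p)"
      unfolding complex_norm_square [symmetric] using False by (simp add: power2_eq_square)
    finally show ?thesis .
  qed simp
  define r where "r = cmod p"
  have r: "\<bar>r\<bar> < 1" "\<bar>- r\<bar> < 1" using assms by (auto simp: r_def)
  define h where "h = (\<lambda>z. boost r (u * z))"
  interpret A: isom "ball 0 1" klein_dist "ball 0 1" klein_dist "(*) u" by (rule klein_rotation [OF u])
  interpret B: isom "ball 0 1" klein_dist "ball 0 1" klein_dist "boost r" by (rule klein_boost [OF r(1)])
  have "isom (ball 0 1) klein_dist (ball 0 1) klein_dist h"
  proof
    show "bij_betw h (ball 0 1) (ball 0 1)"
      using bij_betw_trans [OF A.bij B.bij] by (simp add: h_def o_def)
  qed (simp add: h_def A.iso B.iso del: mem_ball mem_ball_0)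
  moreover have "h p = 0" using up by (simp add: h_def boost_def r_def complex_eq_iff)
  moreover have "x \<in> closed_segment a b \<longleftrightarrow> h x \<in> closed_segment (h a) (h b)"
    if abx: "a \<in> ball 0 1" "b \<in> ball 0 1" "x \<in> ball 0 1" for a b x
  proof -
    have u0: "u \<noteq> 0" using u by auto
    have l: "u * x \<in> closed_segment (u * a) (u * b) \<longleftrightarrow> x \<in> closed_segment a b"
    proof -
      have "u * x = (1 - t) *\<^sub>R (u * a) + t *\<^sub>R (u * b) \<longleftrightarrow> x = (1 - t) *\<^sub>R a + t *\<^sub>R b" for t
      proof -
        have "(1 - t) *\<^sub>R (u * a) + t *\<^sub>R (u * b) = u * ((1 - t) *\<^sub>R a + t *\<^sub>R b)"
          by (simp add: algebra_simps scaleR_conv_of_real)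
        then show ?thesis using u0 by simp
      qed
      then show ?thesis by (simp add: closed_segment_def)
    qed
    have in': "u * a \<in> ball 0 1" "u * b \<in> ball 0 1" "u * x \<in> ball 0 1"
      using abx A.in_target by blast+
    have "h x \<in> closed_segment (h a) (h b) \<longleftrightarrow> u * x \<in> closed_segment (u * a) (u * b)"
    proof
      assume "u * x \<in> closed_segment (u * a) (u * b)"
      then show "h x \<in> closed_segment (h a) (h b)"
        unfolding h_def using boost_segment [OF r(1)] in' by blast
    next
      assume "h x \<in> closed_segment (h a) (h b)"
      then have "boost (- r) (boost r (u * x)) \<in> closed_segment (boost (- r) (boost r (u * a))) (boost (- r) (boost r (u * b)))"
        unfolding h_def using in' by (intro boost_segment [OF r(2)] boost_in [OF r(1)])
      then show "u * x \<in> closed_segment (u * a) (u * b)"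
        using in' r(1) by (simp add: boost_boost del: mem_ball mem_ball_0)
    qed
    then show ?thesis using l by simp
  qed
  ultimately show ?thesis by blast
qed

text \<open>With the tested point at the origin, the hyperbolic cosine and sine of the distances to
  it are explicit, and the addition formula for \<open>cosh\<close> turns additivity of distances
  into \<open>inner a' b' = - |a'| |b'|\<close>. This is equality in the Euclidean triangle
  inequality.\<close>

lemma klein_seg:
  assumes ab: "a \<in> ball 0 1" "b \<in> ball 0 1"
  shows "seg (ball 0 1) klein_dist a b = closed_segment a b"
proof -
  have main: "klein_dist a x + klein_dist x b = klein_dist a b \<longleftrightarrow> x \<in> closed_segment a b" if x: "x \<in> ball 0 1" for x
  proof -
    obtain h where h: "isom (ball 0 1) klein_dist (ball 0 1) klein_dist h" "h x = 0"
      "\<forall>a\<in>ball 0 1. \<forall>b\<in>ball 0 1. \<forall>x\<in>ball 0 1. x \<in> closed_segment a b \<longleftrightarrow> h x \<in> closed_segment (h a) (h b)"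
      using klein_homogeneous [OF x] by blast
    interpret isom "ball 0 1" klein_dist "ball 0 1" klein_dist h by (rule h)
    define a' b' where "a' = h a" and "b' = h b"
    have ab': "a' \<in> ball 0 1" "b' \<in> ball 0 1" using ab in_target by (auto simp: a'_def b'_def simp del: mem_ball mem_ball_0)
    have z: "(0::complex) \<in> ball 0 1" by simp
    have c0: "cosh (klein_dist y 0) = 1 / sqrt (1 - (cmod y)\<^sup>2)"
      "sinh (klein_dist y 0) = cmod y / sqrt (1 - (cmod y)\<^sup>2)" if y: "y \<in> ball 0 1" for y
    proof -
      show c: "cosh (klein_dist y 0) = 1 / sqrt (1 - (cmod y)\<^sup>2)"
        by (simp add: cosh_klein_dist y z klein_cosh_def del: mem_ball mem_ball_0)
      have "(sinh (klein_dist y 0))\<^sup>2 = (cmod y / sqrt (1 - (cmod y)\<^sup>2))\<^sup>2"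
        unfolding sinh_square_eq c using disc_pos [OF y] by (simp add: power_divide field_simps)
      then show "sinh (klein_dist y 0) = cmod y / sqrt (1 - (cmod y)\<^sup>2)"
        using klein_dist_nonneg [OF y z] disc_sqrt_pos [OF y]
        by (simp add: power2_eq_iff_nonneg)
    qed
    have sym: "klein_dist 0 y = klein_dist y 0" for y by (simp add: klein_dist_def klein_cosh_def)
    have "klein_dist a x + klein_dist x b = klein_dist a b \<longleftrightarrow>
        klein_dist a' 0 + klein_dist b' 0 = klein_dist a' b'"
      using iso [of a x] iso [of x b] iso [of a b] ab x h(2) sym
      by (simp add: a'_def b'_def del: mem_ball mem_ball_0)
    also have "\<dots> \<longleftrightarrow> cosh (klein_dist a' 0 + klein_dist b' 0) = cosh (klein_dist a' b')"
      using klein_dist_nonneg ab' z by (metis add_nonneg_nonneg abs_of_nonneg cosh_real_eq_iff)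
    also have "\<dots> \<longleftrightarrow> 1 + cmod a' * cmod b' = 1 - inner a' b'"
      unfolding cosh_add c0 [OF ab'(1)] c0 [OF ab'(2)] cosh_klein_dist [OF ab'] klein_cosh_def
      using disc_sqrt_pos [OF ab'(1)] disc_sqrt_pos [OF ab'(2)]
      by (simp add: add_divide_distrib [symmetric])
    also have "\<dots> \<longleftrightarrow> dist a' b' = cmod a' + cmod b'"
    proof -
      have "dist a' b' = cmod a' + cmod b' \<longleftrightarrow> (dist a' b')\<^sup>2 = (cmod a' + cmod b')\<^sup>2"
        by (simp add: power2_eq_iff_nonneg)
      also have "(dist a' b')\<^sup>2 = (cmod a')\<^sup>2 + (cmod b')\<^sup>2 - 2 * inner a' b'"
        by (simp add: dist_norm power2_norm_eq_inner inner_diff_left inner_diff_right inner_commute)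
      finally show ?thesis by (auto simp: power2_sum)
    qed
    also have "\<dots> \<longleftrightarrow> 0 \<in> closed_segment a' b'"
      unfolding between_mem_segment [symmetric] between by (simp add: dist_norm)
    also have "\<dots> \<longleftrightarrow> x \<in> closed_segment a b"
      using h ab x by (auto simp: a'_def b'_def simp del: mem_ball mem_ball_0)
    finally show ?thesis .
  qed
  have "closed_segment a b \<subseteq> ball 0 1" using ab by (simp add: closed_segment_subset convex_ball del: mem_ball mem_ball_0)
  then show ?thesis using main unfolding seg_def by blast
qed

text \<open>
  The normalised sum \<open>c\<close> of the points of \<open>A\<close> on the hyperboloid: the sum of the hyperbolic cosines of
  the distances from \<open>x\<close> to the points of \<open>A\<close> is a constant times that of the distance from \<open>x\<close> to \<open>c\<close>.
\<close>

lemma klein_barycentre: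
  assumes A: "finite A" "A \<noteq> {}" "A \<subseteq> ball 0 1"
  shows "\<exists>c\<in>ball 0 1. \<forall>h. isom (ball 0 1) klein_dist (ball 0 1) klein_dist h \<longrightarrow> h ` A = A \<longrightarrow> h c = c"
proof -
  define g where "g = (\<lambda>z. 1 / sqrt (1 - (cmod z)\<^sup>2))"
  have g: "g z > 0" if "z \<in> ball 0 1" for z using disc_sqrt_pos [OF that] by (simp add: g_def)
  define W where "W = (\<Sum>a\<in>A. g a)"
  have W: "W > 0" unfolding W_def using A g by (intro sum_pos) auto
  define c where "c = (\<Sum>a\<in>A. (g a / W) *\<^sub>R a)"
  have c: "c \<in> ball 0 1"
    unfolding c_def
  proof (rule convex_sum)
    have "(\<Sum>a\<in>A. g a / W) = W / W" unfolding W_def by (rule sum_divide_distrib [symmetric])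
    then show "(\<Sum>a\<in>A. g a / W) = 1" using W by simp
    show "0 \<le> g a / W" if "a \<in> A" for a
      using g [of a] that A(3) W by (meson divide_nonneg_nonneg less_imp_le subsetD)
  qed (use A in auto)
  have kc: "klein_cosh x y = g x * g y * (1 - inner x y)" for x y by (simp add: klein_cosh_def g_def)
  have key: "(\<Sum>a\<in>A. klein_cosh x a) = W / g c * klein_cosh x c" for x
  proof -
    have "(\<Sum>a\<in>A. g a * inner x a) = W * inner x c"
      using W by (simp add: c_def inner_sum_right sum_distrib_left)
    then have "(\<Sum>a\<in>A. klein_cosh x a) = g x * (W - W * inner x c)"
      by (simp add: kc W_def right_diff_distrib sum_subtractf sum_distrib_left [symmetric] mult.assoc)
    then show ?thesis using g [OF c] by (simp add: kc algebra_simps)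
  qed
  have "h c = c" if h: "isom (ball 0 1) klein_dist (ball 0 1) klein_dist h" "h ` A = A" for h
  proof -
    interpret isom "ball 0 1" klein_dist "ball 0 1" klein_dist h by (rule h)
    have inj: "inj_on h A" using bij A by (auto simp: bij_betw_def intro: inj_on_subset)
    have hc: "h c \<in> ball 0 1" using c in_target by blast
    have "(\<Sum>a\<in>A. klein_cosh (h c) a) = (\<Sum>a\<in>h ` A. klein_cosh (h c) a)" using h by simp
    also have "\<dots> = (\<Sum>a\<in>A. klein_cosh (h c) (h a))" by (rule sum.reindex_cong [OF inj refl refl])
    also have "\<dots> = (\<Sum>a\<in>A. klein_cosh c a)"
    proof (rule sum.cong [OF refl])
      fix a assume "a \<in> A"
      then have a: "a \<in> ball 0 1" using A by blast
      then have "h a \<in> ball 0 1" using in_target by blast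
      then show "klein_cosh (h c) (h a) = klein_cosh c a"
        using iso [OF c a] klein_dist_eq_iff [OF hc _ c a] by simp
    qed
    finally have "klein_cosh (h c) c = klein_cosh c c"
      using key W g [OF c] by simp
    also have "\<dots> = 1" using klein_cosh_eq_1 [OF c c] by simp
    finally show ?thesis using klein_cosh_eq_1 [OF hc c] by simp
  qed
  then show ?thesis using c by blast
qed

lemma tanh_surj:
  assumes "\<bar>x\<bar> < 1" shows "\<exists>s. tanh s = (x::real)"
proof -
  define y where "y = sqrt ((1 + x) / (1 - x))"
  have q: "(1 + x) / (1 - x) > 0" using assms by (auto intro!: divide_pos_pos)
  then have y: "y > 0" "y\<^sup>2 = (1 + x) / (1 - x)" by (auto simp: y_def)
  have "tanh (ln y) = x"
    using assms tanh_ln_real [OF y(1)] unfolding y(2) by (simp add: divide_simps split: if_splits)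
  then show ?thesis by blast
qed

lemma klein_model: "model_plane (ball 0 1) klein_dist tanh"
proof (rule model_plane.intro)
  let ?D = "ball (0::complex) 1"
  show "seg ?D klein_dist a b = closed_segment a b" if "a \<in> ?D" "b \<in> ?D" for a b
    using that by (rule klein_seg)
  show "klein_dist a b = klein_dist b a" for a b
    by (simp add: klein_dist_def klein_cosh_def inner_commute mult.commute)
  show "0 \<le> klein_dist a b" if "a \<in> ?D" "b \<in> ?D" for a b
    using that by (rule klein_dist_nonneg)
  show "klein_dist a b = 0 \<longleftrightarrow> a = b" if "a \<in> ?D" "b \<in> ?D" for a b
    using klein_cosh_ge_1 [OF that] klein_cosh_eq_1 [OF that] by (simp add: klein_dist_def)
  show "\<exists>h. isom ?D klein_dist ?D klein_dist h \<and> h p = 0" if "p \<in> ?D" for p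
    using klein_homogeneous [OF that] by blast
  show "isom ?D klein_dist ?D klein_dist ((*) u)" if "cmod u = 1" for u
    using that by (rule klein_rotation)
  show "strict_mono (tanh :: real \<Rightarrow> real)" by (rule tanh_real_strict_mono)
  show "\<exists>s. tanh s = cmod z" if "z \<in> ?D" for z using that by (intro tanh_surj) simp
  have Tin: "complex_of_real (tanh s) * u \<in> ?D" if "cmod u = 1" for s u
    using that tanh_real_bounds [of s] by (auto simp: norm_mult abs_less_iff)
  then show "complex_of_real (tanh s) * u \<in> ?D" if "cmod u = 1" for s u using that .
  show "klein_dist (complex_of_real (tanh r) * u) (complex_of_real (tanh s) * u) = \<bar>r - s\<bar>"
    if u: "cmod u = 1" for r s u
  proof (rule klein_dist_eqI [OF Tin [OF u] Tin [OF u]])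
    have s: "sqrt (1 - (tanh x)\<^sup>2) = 1 / cosh x" for x :: real
    proof -
      have "1 - (tanh x)\<^sup>2 = (1 / cosh x)\<^sup>2"
      proof -
        have "1 - (tanh x)\<^sup>2 = ((cosh x)\<^sup>2 - (sinh x)\<^sup>2) / (cosh x)\<^sup>2"
          by (simp add: tanh_def power_divide diff_divide_distrib)
        then show ?thesis by (simp add: hyperbolic_pythagoras power_divide)
      qed
      then show ?thesis by (simp add: real_sqrt_divide)
    qed
    have "inner (complex_of_real (tanh r) * u) (complex_of_real (tanh s) * u) = tanh r * tanh s * (cmod u)\<^sup>2"
      by (simp add: power2_norm_eq_inner flip: scaleR_conv_of_real)
    then have "klein_cosh (complex_of_real (tanh r) * u) (complex_of_real (tanh s) * u) =
        (1 - tanh r * tanh s) * cosh r * cosh s"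
      using u by (simp add: klein_cosh_def norm_mult s)
    also have "\<dots> = cosh (r - s)" by (simp add: cosh_diff tanh_def field_simps)
    finally show "klein_cosh (complex_of_real (tanh r) * u) (complex_of_real (tanh s) * u) = cosh \<bar>r - s\<bar>"
      by simp
  qed simp
  \<comment> \<open>Equal moduli make the normalising square roots agree; both sides then say
    \<open>inner p x = inner p y\<close>.\<close>
  show "klein_dist p x = klein_dist p y \<longleftrightarrow> cmod (p - x) = cmod (p - y)"
    if "p \<in> ?D" "x \<in> ?D" "y \<in> ?D" "cmod x = cmod y" for p x y
  proof -
    have "cmod (p - x) = cmod (p - y) \<longleftrightarrow> (cmod (p - x))\<^sup>2 = (cmod (p - y))\<^sup>2" by simp
    also have "\<dots> \<longleftrightarrow> inner p x = inner p y"
    proof -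
      have "(cmod (p - z))\<^sup>2 = (cmod p)\<^sup>2 + (cmod z)\<^sup>2 - 2 * inner p z" for z
        by (simp add: power2_norm_eq_inner inner_diff_left inner_diff_right inner_commute)
      then show ?thesis using that(4) by simp
    qed
    finally show ?thesis
      using that disc_sqrt_pos [OF that(1)] disc_sqrt_pos [OF that(3)]
      by (simp add: klein_dist_eq_iff klein_cosh_def del: mem_ball mem_ball_0)
  qed
  show "klein_dist (complex_of_real r * u) (complex_of_real r * v) < klein_dist (complex_of_real s * u) (complex_of_real s * v)"
    if rs: "0 \<le> r" "r < s" and uv: "cmod u = 1" "cmod v = 1" "u \<noteq> v" and "complex_of_real s * u \<in> ?D" for r s u v
  proof -
    have s1: "s < 1" using that by (simp add: norm_mult)
    have inD: "complex_of_real t * w \<in> ?D" if "0 \<le> t" "t < 1" "cmod w = 1" for t w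
      using that by (simp add: norm_mult)
    have kc: "klein_cosh (complex_of_real t * u) (complex_of_real t * v) = (1 - t\<^sup>2 * inner u v) / (1 - t\<^sup>2)"
      if "0 \<le> t" "t < 1" for t
      using that uv
      by (simp add: klein_cosh_def norm_mult power2_eq_square power_less_one_iff mult_le_one flip: scaleR_conv_of_real)
    have iu: "inner u v < 1"
    proof -
      have "0 < (cmod (u - v))\<^sup>2" using uv by simp
      also have "\<dots> = (cmod u)\<^sup>2 + (cmod v)\<^sup>2 - 2 * inner u v"
        by (simp add: power2_norm_eq_inner inner_diff_left inner_diff_right inner_commute)
      finally show ?thesis using uv by simp
    qed
    have r2: "r\<^sup>2 < s\<^sup>2" "s\<^sup>2 < 1" using rs s1 by (auto simp: power_strict_mono power_less_one_iff)
    \<comment> \<open>Used with \<open>t\<close> the squared radius: in this form growth is visible,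
      since \<open>inner u v < 1\<close> and \<open>1 - t\<close> decreases.\<close>
    have "(1 - t * inner u v) / (1 - t) = inner u v + (1 - inner u v) / (1 - t)" if "t < 1" for t
      using that by (simp add: field_simps)
    moreover have "(1 - inner u v) / (1 - r\<^sup>2) < (1 - inner u v) / (1 - s\<^sup>2)"
      using r2 iu by (intro divide_strict_left_mono) (auto intro!: mult_pos_pos)
    ultimately have lt: "klein_cosh (complex_of_real r * u) (complex_of_real r * v) < klein_cosh (complex_of_real s * u) (complex_of_real s * v)"
      using rs s1 r2 by (simp add: kc)
    show ?thesis
      unfolding klein_dist_def
      by (rule arcosh_real_strict_mono [OF klein_cosh_ge_1 lt]) (use inD rs s1 uv in auto)
  qed
  show "\<exists>c\<in>?D. \<forall>h. isom ?D klein_dist ?D klein_dist h \<longrightarrow> h ` A = A \<longrightarrow> h c = c"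
    if "finite A" "A \<noteq> {}" "A \<subseteq> ?D" for A
    using that by (rule klein_barycentre)
  show "\<exists>e>0. \<forall>y\<in>?D. dist y p < e \<longrightarrow> klein_dist p y < r" if p: "p \<in> ?D" and r: "r > 0" for p r
  proof -
    have "continuous_on ?D (klein_cosh p)"
      unfolding klein_cosh_def
      by (intro continuous_intros) (use disc_sqrt_pos p in force)
    moreover have "0 < cosh r - 1" using r cosh_real_ge_1 [of r] cosh_real_one_iff [of r] by linarith
    ultimately obtain e where e: "e > 0" "\<And>y. y \<in> ?D \<Longrightarrow> dist y p < e \<Longrightarrow> dist (klein_cosh p y) (klein_cosh p p) < cosh r - 1"
      using p unfolding continuous_on_iff by meson
    have "klein_dist p y < r" if y: "y \<in> ?D" "dist y p < e" for y
    proof -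
      have "klein_cosh p y < cosh r"
        using e(2) [OF y] klein_cosh_eq_1 [OF p p] by (simp add: dist_real_def)
      then have "cosh (klein_dist p y) < cosh r" using cosh_klein_dist [OF p y(1)] by simp
      then show ?thesis using klein_dist_nonneg [OF p y(1)] r by (simp add: cosh_real_nonneg_less_iff)
    qed
    then show ?thesis using e(1) by blast
  qed
qed auto

text \<open>Both discs are projections of one hyperboloid, the Poincare disc from the point
  \<open>(-1, 0)\<close> and the Klein disc from the origin. Comparing the two along a ray gives the
  factor.\<close>

definition poincare_to_klein :: "complex \<Rightarrow> complex" where
  "poincare_to_klein z = (2 / (1 + (cmod z)\<^sup>2)) *\<^sub>R z"

lemma poincare_to_klein_norm:
  "1 - (cmod (poincare_to_klein z))\<^sup>2 = ((1 - (cmod z)\<^sup>2) / (1 + (cmod z)\<^sup>2))\<^sup>2"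
proof -
  have p: "1 + (cmod z)\<^sup>2 > 0" by (simp add: add_pos_nonneg)
  have "(cmod (poincare_to_klein z))\<^sup>2 = (2 * cmod z / (1 + (cmod z)\<^sup>2))\<^sup>2"
    by (simp add: poincare_to_klein_def)
  then show ?thesis
    using p by (simp add: power_divide divide_simps) (simp add: power2_eq_square algebra_simps)
qed

text \<open>After clearing the factors \<open>1 + |z|^2\<close>, the Lorentz product of the images
  is the argument of \<open>arcosh\<close> in \<open>hyp_dist\<close>. The inverse \<open>?g\<close>
  solves \<open>w = 2 z / (1 + |z|^2)\<close> for the root inside the disc.\<close>

lemma poincare_klein_isom: "isom (ball 0 1) hyp_dist (ball 0 1) klein_dist poincare_to_klein"
proof
  let ?D = "ball (0::complex) 1" and ?g = "\<lambda>w. (1 / (1 + sqrt (1 - (cmod w)\<^sup>2))) *\<^sub>R w"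
  have inD: "poincare_to_klein z \<in> ?D" if z: "z \<in> ?D" for z
  proof -
    have "0 < 1 - (cmod (poincare_to_klein z))\<^sup>2"
      unfolding poincare_to_klein_norm using disc_pos [OF z] by (simp add: add_pos_nonneg pos_add_strict less_imp_neq add_nonneg_eq_0_iff)
    then show ?thesis by (simp add: power_less_one_iff)
  qed
  have sq: "sqrt (1 - (cmod (poincare_to_klein z))\<^sup>2) = (1 - (cmod z)\<^sup>2) / (1 + (cmod z)\<^sup>2)" if "z \<in> ?D" for z
    unfolding poincare_to_klein_norm using disc_pos [OF that] by (simp add: add_nonneg_nonneg)
  show "bij_betw poincare_to_klein ?D ?D"
  proof (rule bij_betw_byWitness [where f' = ?g])
    show "\<forall>z\<in>?D. ?g (poincare_to_klein z) = z"
    proof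
      fix z assume z: "z \<in> ?D"
      have p: "1 + (cmod z)\<^sup>2 > 0" by (simp add: add_pos_nonneg)
      have "1 + (1 - (cmod z)\<^sup>2) / (1 + (cmod z)\<^sup>2) = 2 / (1 + (cmod z)\<^sup>2)" using p by (simp add: field_simps)
      then have "?g (poincare_to_klein z) = (1 / (2 / (1 + (cmod z)\<^sup>2))) *\<^sub>R poincare_to_klein z" by (simp add: sq [OF z])
      also have "\<dots> = z"
      proof -
        define k where "k = 2 / (1 + (cmod z)\<^sup>2)"
        have "k \<noteq> 0" using p by (simp add: k_def)
        then show ?thesis unfolding poincare_to_klein_def k_def [symmetric] by simp
      qed
      finally show "?g (poincare_to_klein z) = z" .
    qed
    show "\<forall>w\<in>?D. poincare_to_klein (?g w) = w"
    proof
      fix w assume w: "w \<in> ?D"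
      define q where "q = sqrt (1 - (cmod w)\<^sup>2)"
      have q: "q > 0" "(cmod w)\<^sup>2 = 1 - q\<^sup>2" using disc_sqrt_pos [OF w] disc_pos [OF w] by (auto simp: q_def)
      have "(cmod (?g w))\<^sup>2 = (1 - q\<^sup>2) / (1 + q)\<^sup>2"
        using q by (simp add: q_def [symmetric] power_divide power_mult_distrib)
      also have "\<dots> = (1 - q) / (1 + q)" using q by (simp add: divide_simps power2_eq_square) (simp add: algebra_simps)
      finally have c: "(cmod (?g w))\<^sup>2 = (1 - q) / (1 + q)" .
      have "1 + (cmod (?g w))\<^sup>2 = 2 / (1 + q)" unfolding c using q by (simp add: field_simps)
      then have "poincare_to_klein (?g w) = (2 / (2 / (1 + q))) *\<^sub>R ?g w" by (simp only: poincare_to_klein_def)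
      then show "poincare_to_klein (?g w) = w" using q by (simp add: q_def [symmetric])
    qed
    show "poincare_to_klein ` ?D \<subseteq> ?D" using inD by blast
    have "?g w \<in> ?D" if w: "w \<in> ?D" for w
    proof -
      define q where "q = sqrt (1 - (cmod w)\<^sup>2)"
      have "q > 0" using disc_sqrt_pos [OF w] by (simp add: q_def)
      then have "cmod (?g w) \<le> cmod w"
        by (simp add: q_def [symmetric] divide_le_eq mult_left_le algebra_simps)
      then show ?thesis using w by simp
    qed
    then show "?g ` ?D \<subseteq> ?D" by blast
  qed
  fix z w :: complex assume zw: "z \<in> ?D" "w \<in> ?D"
  define a b where "a = (cmod z)\<^sup>2" and "b = (cmod w)\<^sup>2"
  have ab: "0 \<le> a" "a < 1" "0 \<le> b" "b < 1" using disc_pos zw by (auto simp: a_def b_def simp del: mem_ball mem_ball_0)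
  have "klein_cosh (poincare_to_klein z) (poincare_to_klein w) =
      (1 - 4 * inner z w / ((1 + a) * (1 + b))) / ((1 - a) / (1 + a) * ((1 - b) / (1 + b)))"
    unfolding klein_cosh_def sq [OF zw(1)] sq [OF zw(2)] by (simp add: poincare_to_klein_def a_def b_def)
  also have "\<dots> = ((1 + a) * (1 + b) - 4 * inner z w) / ((1 - a) * (1 - b))"
    using ab by (simp add: divide_simps)
  also have "(1 + a) * (1 + b) - 4 * inner z w = (1 - a) * (1 - b) + 2 * (cmod (z - w))\<^sup>2"
  proof -
    have "(cmod (z - w))\<^sup>2 = a + b - 2 * inner z w"
      by (simp add: a_def b_def power2_norm_eq_inner inner_diff_left inner_diff_right inner_commute)
    then show ?thesis by (simp add: algebra_simps)
  qed
  also have "((1 - a) * (1 - b) + 2 * (cmod (z - w))\<^sup>2) / ((1 - a) * (1 - b)) =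
      1 + 2 * (cmod (z - w))\<^sup>2 / ((1 - a) * (1 - b))"
    using ab by (simp add: add_divide_distrib)
  finally show "klein_dist (poincare_to_klein z) (poincare_to_klein w) = hyp_dist z w"
    by (simp add: klein_dist_def hyp_dist_def a_def b_def)
qed

subsection \<open>Convex polygons\<close>

text \<open>Twice the signed area of the triangle \<open>a b x\<close>. It is affine in
  \<open>x\<close> and, for distinct \<open>a\<close> and \<open>b\<close>, vanishes exactly on
  their line, so half-planes become sign conditions.\<close>

definition orient :: "complex \<Rightarrow> complex \<Rightarrow> complex \<Rightarrow> real" where
  "orient a b x = Im (cnj (b - a) * (x - a))"

lemma orient_left [simp]: "orient a b a = 0" and orient_right [simp]: "orient a b b = 0"
  by (simp_all add: orient_def algebra_simps)

lemma orient_swap: "orient b a x = - orient a b x"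
  by (simp add: orient_def algebra_simps)

lemma orient_swap_last: "orient a x b = - orient a b x"
  by (simp add: orient_def algebra_simps)

lemma orient_sum:
  assumes "finite S" "sum u S = 1"
  shows "orient a b (\<Sum>x\<in>S. u x *\<^sub>R x) = (\<Sum>x\<in>S. u x * orient a b x)"
proof -
  have "(\<Sum>x\<in>S. u x *\<^sub>R x) - a = (\<Sum>x\<in>S. u x *\<^sub>R (x - a))"
    using assms by (simp add: scaleR_diff_right sum_subtractf flip: scaleR_left.sum)
  then have "cnj (b - a) * ((\<Sum>x\<in>S. u x *\<^sub>R x) - a) = (\<Sum>x\<in>S. u x *\<^sub>R (cnj (b - a) * (x - a)))"
    by (simp add: sum_distrib_left)
  then show ?thesis by (simp add: orient_def)
qed

lemma orient_affine: "orient a b ((1 - t) *\<^sub>R x + t *\<^sub>R y) = (1 - t) * orient a b x + t * orient a b y"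
  by (simp add: orient_def algebra_simps)

lemma orient_zeroD:
  assumes "orient a b x = 0" "a \<noteq> b"
  obtains t where "x = (1 - t) *\<^sub>R a + t *\<^sub>R b"
proof -
  define q where "q = (x - a) / (b - a)"
  have "y / z = cnj z * y / (of_real ((cmod z)\<^sup>2))" if "z \<noteq> 0" for y z
    unfolding complex_norm_square using that by simp
  then have "q = cnj (b - a) * (x - a) / (of_real ((cmod (b - a))\<^sup>2))"
    using assms(2) by (simp only: q_def right_minus_eq simp_thms)
  then have "Im q = 0" using assms(1) by (simp add: orient_def Im_divide_of_real)
  then have "q = of_real (Re q)" by (simp add: complex_eq_iff)
  then have "x - a = of_real (Re q) * (b - a)" using assms(2) by (metis q_def nonzero_divide_eq_eq right_minus_eq)
  then have "x = (1 - Re q) *\<^sub>R a + Re q *\<^sub>R b" by (simp add: scaleR_conv_of_real algebra_simps)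
  then show ?thesis by (rule that)
qed

lemma orient_on_segment: "x \<in> closed_segment a b \<Longrightarrow> orient a b x = 0"
  by (auto simp: closed_segment_def orient_affine)

lemma orient_zero_line:
  assumes "a \<noteq> b"
  shows "orient a b x = 0 \<longleftrightarrow> x \<in> closed_segment a b \<or> b \<in> closed_segment a x \<or> a \<in> closed_segment x b"
proof
  assume "orient a b x = 0"
  then obtain t where t: "x = (1 - t) *\<^sub>R a + t *\<^sub>R b" using assms by (rule orient_zeroD)
  consider "0 \<le> t" "t \<le> 1" | "t > 1" | "t < 0" by linarith
  then show "x \<in> closed_segment a b \<or> b \<in> closed_segment a x \<or> a \<in> closed_segment x b"
  proof cases
    case 1 then show ?thesis using t by (auto simp: closed_segment_def)
  next
    case 2
    have "b = (1 - 1 / t) *\<^sub>R a + (1 / t) *\<^sub>R x" using 2 by (simp add: t complex_eq_iff field_simps)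
    then show ?thesis using 2 unfolding closed_segment_def by (smt (verit) divide_le_eq_1 divide_nonneg_nonneg mem_Collect_eq)
  next
    case 3
    define u where "u = - t / (1 - t)"
    have u: "0 \<le> u" "u \<le> 1" "1 - u = 1 / (1 - t)" using 3 by (auto simp: u_def field_simps)
    have "(1 / (1 - t)) *\<^sub>R x = a + (t / (1 - t)) *\<^sub>R b"
      using 3 by (simp add: t scaleR_add_right)
    then have "a = (1 - u) *\<^sub>R x + u *\<^sub>R b" by (simp add: u(3)) (simp add: u_def)
    then show ?thesis using u unfolding closed_segment_def by blast
  qed
next
  assume "x \<in> closed_segment a b \<or> b \<in> closed_segment a x \<or> a \<in> closed_segment x b"
  then show "orient a b x = 0"
  proof (elim disjE)
    assume "b \<in> closed_segment a x"
    then have "orient a x b = 0" by (rule orient_on_segment)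
    then show ?thesis using orient_swap_last [of a x b] by simp
  next
    assume "a \<in> closed_segment x b"
    then have "orient b x a = 0" using orient_on_segment [of a b x] by (simp add: closed_segment_commute)
    then show ?thesis by (simp add: orient_def algebra_simps)
  qed (rule orient_on_segment)
qed

text \<open>A convex combination of nonnegative numbers vanishes only if all weight sits on zeros;
  hence a supporting line meets the hull in the hull of the points of \<open>S\<close> on it. The
  factor \<open>s\<close> stands for the unknown side on which \<open>S\<close> lies.\<close>

lemma orient_hull:
  assumes "finite S" "\<And>p. p \<in> S \<Longrightarrow> 0 \<le> s * orient a b p" "x \<in> convex hull S"
  shows "0 \<le> s * orient a b x"
    and "orient a b x = 0 \<Longrightarrow> s \<noteq> 0 \<Longrightarrow> x \<in> convex hull {p \<in> S. orient a b p = 0}"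
proof -
  obtain u where u: "\<And>p. p \<in> S \<Longrightarrow> 0 \<le> u p" "sum u S = 1" "x = (\<Sum>p\<in>S. u p *\<^sub>R p)"
    using assms(3) convex_hull_finite [OF assms(1)] by auto
  have e: "s * orient a b x = (\<Sum>p\<in>S. u p * (s * orient a b p))"
    unfolding u(3) orient_sum [OF assms(1) u(2)] by (simp add: sum_distrib_left mult.left_commute)
  show "0 \<le> s * orient a b x" unfolding e using u(1) assms(2) by (intro sum_nonneg) simp
  assume z: "orient a b x = 0" "s \<noteq> 0"
  have "\<forall>p\<in>S. u p * (s * orient a b p) = 0"
    using e z u(1) assms(2) sum_nonneg_eq_0_iff [OF assms(1), of "\<lambda>p. u p * (s * orient a b p)"] by simp
  then have z': "u p = 0" if "p \<in> S" "orient a b p \<noteq> 0" for p using that z by auto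
  let ?Z = "{p \<in> S. orient a b p = 0}"
  have "sum u ?Z = sum u S" by (rule sum.mono_neutral_left) (use assms(1) z' in auto)
  moreover have "(\<Sum>p\<in>?Z. u p *\<^sub>R p) = (\<Sum>p\<in>S. u p *\<^sub>R p)"
    by (rule sum.mono_neutral_left) (use assms(1) z' in auto)
  moreover have "finite ?Z" using assms(1) by simp
  ultimately show "x \<in> convex hull ?Z"
    using u by (subst convex_hull_finite) (auto intro!: exI [of _ u])
qed

text \<open>Unordered, because the corner list of a face may run either way round.\<close>

definition edge :: "'a list \<Rightarrow> 'a \<Rightarrow> 'a \<Rightarrow> bool" where
  "edge vs a b \<longleftrightarrow> (\<exists>i. corner vs i = a \<and> corner vs (i + 1) = b \<or> corner vs i = b \<and> corner vs (i + 1) = a)"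

text \<open>The interior angle of the polygon at \<open>y\<close>, given by both neighbours of
  \<open>y\<close> and again without orientation.\<close>

definition wedge :: "'a list \<Rightarrow> 'a \<Rightarrow> 'a \<Rightarrow> 'a \<Rightarrow> bool" where
  "wedge vs a y b \<longleftrightarrow> (\<exists>i. corner vs (i + 1) = y \<and>
     (corner vs i = a \<and> corner vs (i + 2) = b \<or> corner vs i = b \<and> corner vs (i + 2) = a))"

lemma edge_corner: "edge vs (corner vs i) (corner vs (i + 1))"
  by (auto simp: edge_def)

lemma edge_sym: "edge vs a b \<longleftrightarrow> edge vs b a" by (auto simp: edge_def)

lemma wedge_sym: "wedge vs a y b \<longleftrightarrow> wedge vs b y a" by (auto simp: wedge_def)

lemma corner_shift: "corner vs (i + length vs) = corner vs i"
  by (simp add: corner_def)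

lemma corner_in_set: "vs \<noteq> [] \<Longrightarrow> corner vs i \<in> set vs"
  by (simp add: corner_def)

lemma in_set_corner: "x \<in> set vs \<Longrightarrow> \<exists>i. x = corner vs i"
  by (auto simp: in_set_conv_nth corner_def) (metis mod_less)

lemma corner_mod: "corner vs (i mod length vs) = corner vs i"
  by (simp add: corner_def)

lemma wedge_edge: "wedge vs a y b \<Longrightarrow> edge vs y a" "wedge vs a y b \<Longrightarrow> edge vs y b"
  unfolding wedge_def edge_def by (metis add_Suc_right add_2_eq_Suc' Suc_eq_plus1)+

text \<open>Indices are natural numbers, so the predecessor of a corner is reached by first going
  once round the cycle.\<close>

lemma corner_pred:
  assumes "vs \<noteq> []" obtains j where "corner vs i = corner vs (j + 1)" "corner vs (i + 1) = corner vs (j + 2)"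
proof -
  have l: "length vs \<ge> 1" using assms by (cases vs) auto
  have "i + length vs = (i + length vs - 1) + 1" using l by simp
  moreover have "i + 1 + length vs = (i + length vs - 1) + 2" using l by simp
  ultimately show ?thesis using that [of "i + length vs - 1"] corner_shift by metis
qed

lemma edge_wedge:
  assumes "vs \<noteq> []" "edge vs y b" shows "\<exists>a. wedge vs a y b"
proof -
  obtain i where i: "corner vs i = y \<and> corner vs (i + 1) = b \<or> corner vs i = b \<and> corner vs (i + 1) = y"
    using assms(2) by (auto simp: edge_def)
  then show ?thesis
  proof
    assume c: "corner vs i = y \<and> corner vs (i + 1) = b"
    obtain j where "corner vs i = corner vs (j + 1)" "corner vs (i + 1) = corner vs (j + 2)"
      using corner_pred [OF assms(1)] .
    then show ?thesis using c unfolding wedge_def by metis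
  next
    assume c: "corner vs i = b \<and> corner vs (i + 1) = y"
    then show ?thesis unfolding wedge_def by metis
  qed
qed

lemma in_set_wedge: "x \<in> set vs \<Longrightarrow> \<exists>a b. wedge vs a x b"
proof -
  assume x: "x \<in> set vs"
  then have ne: "vs \<noteq> []" by auto
  obtain i where "x = corner vs i" using in_set_corner [OF x] by blast
  then have "edge vs x (corner vs (i + 1))" by (auto simp: edge_def)
  then show ?thesis using edge_wedge [OF ne] by blast
qed

lemma edge_map: "vs \<noteq> [] \<Longrightarrow> edge vs a b \<Longrightarrow> edge (map h vs) (h a) (h b)"
  unfolding edge_def by (simp add: corner_map) blast

lemma consecutive_mod_neq:
  assumes "3 \<le> (m::nat)"
  shows "(i + 2) mod m \<noteq> i mod m" "(i + 2) mod m \<noteq> (i + 1) mod m" "(i + 1) mod m \<noteq> i mod m"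
  using assms by (auto simp: mod_eq_dvd_iff_nat dest: dvd_imp_le)

section \<open>Lines, half-planes and regions in a chart\<close>

context model_plane
begin

lemma seg_in: "a \<in> U \<Longrightarrow> b \<in> U \<Longrightarrow> closed_segment a b \<subseteq> U"
  by (simp add: closed_segment_subset convex_U)

lemma line_eq:
  assumes "a \<in> U" "b \<in> U" "a \<noteq> b"
  shows "line_through U d a b = {x \<in> U. orient a b x = 0}"
  unfolding line_through_def orient_zero_line [OF assms(3)]
  using assms by (auto simp: seg_eq)

text \<open>An affine function \<open>f\<close> with opposite signs at \<open>x\<close> and
  \<open>y\<close> vanishes between them, at parameter \<open>f x / (f x - f y)\<close>; with equal
  signs it keeps its sign along the segment.\<close>

lemma same_side_eq:
  assumes "a \<in> U" "b \<in> U" "a \<noteq> b" "x \<in> U" "y \<in> U"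
  shows "same_side U d (line_through U d a b) x y \<longleftrightarrow> 0 < orient a b x * orient a b y"
proof -
  let ?f = "orient a b"
  have "closed_segment x y \<inter> {x \<in> U. ?f x = 0} = {} \<longleftrightarrow> 0 < ?f x * ?f y" if nz: "?f x \<noteq> 0" "?f y \<noteq> 0"
  proof
    assume e: "closed_segment x y \<inter> {x \<in> U. ?f x = 0} = {}"
    show "0 < ?f x * ?f y"
    proof (rule ccontr)
      assume "\<not> 0 < ?f x * ?f y"
      then have neg: "?f x < 0 \<and> 0 < ?f y \<or> 0 < ?f x \<and> ?f y < 0" using nz
        by (metis linorder_neqE_linordered_idom mult_neg_neg mult_pos_pos)
      define t where "t = ?f x / (?f x - ?f y)"
      have t: "0 \<le> t" "t \<le> 1" using neg by (auto simp: t_def field_simps)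
      have "?f ((1 - t) *\<^sub>R x + t *\<^sub>R y) = 0"
        unfolding orient_affine t_def using neg by (auto simp: field_simps)
      moreover have "(1 - t) *\<^sub>R x + t *\<^sub>R y \<in> closed_segment x y" using t by (auto simp: closed_segment_def)
      ultimately show False using e seg_in [OF assms(4,5)] by blast
    qed
  next
    assume p: "0 < ?f x * ?f y"
    have "?f z \<noteq> 0" if "z \<in> closed_segment x y" for z
    proof -
      obtain t where t: "0 \<le> t" "t \<le> 1" "z = (1 - t) *\<^sub>R x + t *\<^sub>R y" using \<open>z \<in> closed_segment x y\<close> by (auto simp: closed_segment_def)
      have "0 < ?f x * ?f z"
      proof (cases "t = 1")
        case True then show ?thesis using p t by simp
      next
        case False
        have "?f x * ?f z = (1 - t) * (?f x * ?f x) + t * (?f x * ?f y)"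
          unfolding t(3) orient_affine by (simp add: algebra_simps)
        also have "\<dots> > 0"
        proof -
          have "0 < ?f x * ?f x" using nz by (auto simp: zero_less_mult_iff linorder_neq_iff)
          then show ?thesis using False t p by (intro add_pos_nonneg) (auto simp: less_imp_le)
        qed
        finally show ?thesis .
      qed
      then show ?thesis by auto
    qed
    then show "closed_segment x y \<inter> {x \<in> U. ?f x = 0} = {}" by blast
  qed
  note main = this
  show ?thesis
  proof (cases "?f x = 0 \<or> ?f y = 0")
    case True
    then show ?thesis using assms by (auto simp: same_side_def line_eq)
  next
    case False
    then show ?thesis
      unfolding same_side_def line_eq [OF assms(1-3)] seg_eq [OF assms(4,5)]
      using main assms(4,5) by simp
  qed
qed

lemma region_eq:
  assumes "set vs \<subseteq> U" shows "region U d vs = convex hull (set vs)"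
proof -
  have "geod_convex U d S \<longleftrightarrow> convex S" if "S \<subseteq> U" for S
  proof -
    have "seg U d x y = closed_segment x y" if "x \<in> S" "y \<in> S" for x y
      using that \<open>S \<subseteq> U\<close> by (intro seg_eq) auto
    then show ?thesis using that by (simp add: geod_convex_def convex_contains_segment)
  qed
  note gc = this
  have hU: "convex hull (set vs) \<subseteq> U" using assms convex_U by (simp add: hull_minimal)
  show ?thesis
    unfolding region_def
  proof (rule hull_unique)
    show "set vs \<subseteq> convex hull (set vs)" by (rule hull_subset)
    show "geod_convex U d (convex hull (set vs))" using gc [OF hU] convex_convex_hull by blast
    show "convex hull (set vs) \<subseteq> S" if "set vs \<subseteq> S" "geod_convex U d S" for S
      using that gc [of S] by (auto simp: geod_convex_def hull_minimal intro!: hull_minimal)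
  qed
qed

section \<open>One convex polygon: supporting lines, corners and sides\<close>

context
  fixes vs :: "complex list"
  assumes cp: "convex_polygon U d vs"
begin

lemma cp_len: "3 \<le> length vs" and cp_ne: "vs \<noteq> []" and cp_sub: "set vs \<subseteq> U"
  using cp by (auto simp: convex_polygon_def)

lemma cp_corner_in: "corner vs i \<in> U"
  using cp_ne cp_sub corner_in_set by blast

lemma cp_consecutive: "corner vs i \<noteq> corner vs (i + 1)"
proof -
  have "i mod length vs < length vs" using cp_ne by simp
  then have "corner vs (i mod length vs) \<noteq> corner vs (i mod length vs + 1)"
    using cp unfolding convex_polygon_def by blast
  then show ?thesis by (simp add: corner_def mod_Suc_eq)
qed

text \<open>Convexity compares pairs of corners only. With corner \<open>i + 2\<close> fixed as
  reference, its own value of \<open>orient\<close> serves as \<open>s\<close>; the sign depends on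
  the direction of the list.\<close>

lemma cp_support:
  "\<exists>s. \<forall>j. j mod length vs \<noteq> i mod length vs \<longrightarrow> j mod length vs \<noteq> (i + 1) mod length vs \<longrightarrow>
      s * orient (corner vs i) (corner vs (i + 1)) (corner vs j) > 0"
proof -
  let ?m = "length vs"
  define i' where "i' = i mod ?m"
  have i': "i' < ?m" "corner vs i' = corner vs i" "corner vs (i' + 1) = corner vs (i + 1)"
      "(i' + 1) mod ?m = (i + 1) mod ?m"
    using cp_ne by (auto simp: i'_def corner_def mod_Suc_eq)
  define k where "k = (i + 2) mod ?m"
  have k: "k < ?m" "k \<notin> {i', (i' + 1) mod ?m}"
    using cp_ne consecutive_mod_neq [OF cp_len, of i] by (auto simp: k_def i'_def mod_Suc_eq)
  have "orient (corner vs i) (corner vs (i + 1)) (corner vs k) * orient (corner vs i) (corner vs (i + 1)) (corner vs j) > 0"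
    if j: "j mod ?m \<noteq> i mod ?m" "j mod ?m \<noteq> (i + 1) mod ?m" for j
  proof -
    have "j mod ?m < ?m" "j mod ?m \<notin> {i', (i' + 1) mod ?m}" using j cp_ne i'(4) by (auto simp: i'_def)
    then have "same_side U d (line_through U d (corner vs i') (corner vs (i' + 1))) (corner vs k) (corner vs (j mod ?m))"
      using cp i'(1) k unfolding convex_polygon_def by blast
    then show ?thesis
      unfolding i' corner_mod using same_side_eq cp_corner_in cp_consecutive by blast
  qed
  then show ?thesis by blast
qed

text \<open>A repeated corner would lie strictly on one side of a line that starts at it, where
  \<open>orient\<close> is 0. The case of a repetition one place on is excluded by distinctness of
  consecutive corners.\<close>

lemma corner_eq_iff: "corner vs i = corner vs j \<longleftrightarrow> i mod length vs = j mod length vs"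
proof
  assume e: "corner vs i = corner vs j"
  show "i mod length vs = j mod length vs"
  proof (rule ccontr)
    assume ne: "i mod length vs \<noteq> j mod length vs"
    obtain s where s: "\<And>j. j mod length vs \<noteq> i mod length vs \<Longrightarrow> j mod length vs \<noteq> (i + 1) mod length vs \<Longrightarrow>
      s * orient (corner vs i) (corner vs (i + 1)) (corner vs j) > 0" using cp_support [of i] by metis
    show False
    proof (cases "j mod length vs = (i + 1) mod length vs")
      case True
      then have "corner vs j = corner vs (i + 1)" by (simp add: corner_def)
      then show False using e cp_consecutive by metis
    next
      case False
      then have "s * orient (corner vs i) (corner vs (i + 1)) (corner vs i) > 0" using s [of j] ne e by simp
      then show False by simp
    qed
  qed
qed (simp add: corner_def)

lemma edge_in: "edge vs a b \<Longrightarrow> a \<in> set vs \<and> b \<in> set vs \<and> a \<noteq> b"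
  unfolding edge_def using corner_in_set [OF cp_ne] cp_consecutive by metis

text \<open>The form in which convexity is used from here on: the line of a side supports the
  polygon and contains no further corner. A third corner exists, which makes \<open>s\<close>
  nonzero.\<close>

lemma edge_support:
  assumes "edge vs a b"
  obtains s where "s \<noteq> 0" "\<And>x. x \<in> set vs \<Longrightarrow> x \<noteq> a \<Longrightarrow> x \<noteq> b \<Longrightarrow> s * orient a b x > 0"
proof -
  obtain i where i: "corner vs i = a \<and> corner vs (i + 1) = b \<or> corner vs i = b \<and> corner vs (i + 1) = a"
    using assms by (auto simp: edge_def)
  obtain s where s: "\<And>j. j mod length vs \<noteq> i mod length vs \<Longrightarrow> j mod length vs \<noteq> (i + 1) mod length vs \<Longrightarrow>
      s * orient (corner vs i) (corner vs (i + 1)) (corner vs j) > 0" using cp_support [of i] by metis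
  have s': "s * orient (corner vs i) (corner vs (i + 1)) x > 0"
    if x: "x \<in> set vs" "x \<noteq> corner vs i" "x \<noteq> corner vs (i + 1)" for x
  proof -
    obtain j where "x = corner vs j" using in_set_corner [OF x(1)] by blast
    then show ?thesis using s x(2,3) corner_eq_iff by metis
  qed
  have "s \<noteq> 0" using s [of "i + 2"] consecutive_mod_neq [OF cp_len, of i] by force
  then show ?thesis
    using that [of s] that [of "- s"] s' i orient_swap [of a b] by auto
qed

lemma wedge_neq: "wedge vs a y b \<Longrightarrow> a \<noteq> b \<and> a \<noteq> y \<and> b \<noteq> y"
  unfolding wedge_def using cp_consecutive corner_eq_iff consecutive_mod_neq(1) [OF cp_len]
  by (metis add_Suc_right add_2_eq_Suc' Suc_eq_plus1)

lemma edge_hull: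
  assumes e: "edge vs a b" and s: "\<And>x. x \<in> set vs \<Longrightarrow> x \<noteq> a \<Longrightarrow> x \<noteq> b \<Longrightarrow> s * orient a b x > 0" "s \<noteq> 0"
    and x: "x \<in> region U d vs"
  shows "0 \<le> s * orient a b x" and "orient a b x = 0 \<Longrightarrow> x \<in> closed_segment a b"
proof -
  have nn: "0 \<le> s * orient a b p" if "p \<in> set vs" for p
    using s(1) [OF that] by (cases "p = a \<or> p = b") auto
  have xh: "x \<in> convex hull (set vs)" using x region_eq [OF cp_sub] by simp
  show "0 \<le> s * orient a b x" using orient_hull(1) [OF _ nn xh] by simp
  assume "orient a b x = 0"
  then have "x \<in> convex hull {p \<in> set vs. orient a b p = 0}" using orient_hull(2) [OF _ nn xh] s(2) by simp
  moreover have "{p \<in> set vs. orient a b p = 0} \<subseteq> {a, b}" using s(1) by force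
  ultimately have "x \<in> convex hull {a, b}" using hull_mono by blast
  then show "x \<in> closed_segment a b" by (simp add: segment_convex_hull)
qed

lemma corner_in_region: "x \<in> set vs \<Longrightarrow> x \<in> region U d vs"
  unfolding region_eq [OF cp_sub] by (rule hull_inc)

lemma convex_region: "convex (region U d vs)"
  unfolding region_eq [OF cp_sub] by simp

lemma edge_in_region: "edge vs a b \<Longrightarrow> closed_segment a b \<subseteq> region U d vs"
  using edge_in corner_in_region convex_region by (simp add: closed_segment_subset)

text \<open>The sum \<open>f\<close> of the supporting functions of the two sides at
  \<open>x\<close> is affine, nonnegative on the polygon and zero only at \<open>x\<close>; so
  \<open>x\<close> strictly between \<open>p\<close> and \<open>q\<close> would give
  \<open>p = x = q\<close>.\<close>

lemma corner_extreme:
  assumes x: "x \<in> set vs" "x \<in> closed_segment p q" and pq: "p \<in> region U d vs" "q \<in> region U d vs"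
  shows "x = p \<or> x = q"
proof -
  obtain a b where w: "wedge vs a x b" using in_set_wedge [OF x(1)] by blast
  have ea: "edge vs x a" and eb: "edge vs x b" using wedge_edge [OF w] by auto
  have ab: "a \<noteq> b" "a \<noteq> x" "b \<noteq> x" using wedge_neq [OF w] by auto
  obtain s where s: "s \<noteq> 0" "\<And>y. y \<in> set vs \<Longrightarrow> y \<noteq> x \<Longrightarrow> y \<noteq> a \<Longrightarrow> s * orient x a y > 0" using edge_support [OF ea] by metis
  obtain s' where s': "s' \<noteq> 0" "\<And>y. y \<in> set vs \<Longrightarrow> y \<noteq> x \<Longrightarrow> y \<noteq> b \<Longrightarrow> s' * orient x b y > 0" using edge_support [OF eb] by metis
  define f where "f = (\<lambda>y. s * orient x a y + s' * orient x b y)"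
  have f0: "0 \<le> f y" if "y \<in> region U d vs" for y
    unfolding f_def using edge_hull(1) [OF ea s(2,1) that] edge_hull(1) [OF eb s'(2,1) that] by simp
  have fz: "y = x" if y: "y \<in> region U d vs" "f y = 0" for y
  proof -
    have z: "s * orient x a y = 0" "s' * orient x b y = 0"
      using edge_hull(1) [OF ea s(2,1) y(1)] edge_hull(1) [OF eb s'(2,1) y(1)] y(2) unfolding f_def by linarith+
    then have "y \<in> closed_segment x a" using edge_hull(2) [OF ea s(2,1) y(1)] s by simp
    then obtain t where t: "y = (1 - t) *\<^sub>R x + t *\<^sub>R a" by (auto simp: closed_segment_def)
    have "s' * orient x b a > 0" using s'(2) [of a] ab edge_in [OF ea] by auto
    moreover have "t * (s' * orient x b a) = 0" using z(2) by (auto simp: t orient_affine)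
    ultimately have "t = 0" by auto
    then show ?thesis by (simp add: t)
  qed
  obtain t where t: "0 \<le> t" "t \<le> 1" "x = (1 - t) *\<^sub>R p + t *\<^sub>R q" using x(2) by (auto simp: closed_segment_def)
  have "f x = 0" by (simp add: f_def)
  moreover have "f x = (1 - t) * f p + t * f q" unfolding f_def by (subst (2 4) t(3)) (simp only: orient_affine, simp add: algebra_simps)
  ultimately have "(1 - t) * f p + t * f q = 0" by simp
  moreover have "0 \<le> (1 - t) * f p" "0 \<le> t * f q" using t f0 pq by auto
  ultimately have "(1 - t) * f p = 0" "t * f q = 0" by linarith+
  then have "t = 1 \<or> f p = 0" "t = 0 \<or> f q = 0" by auto
  then have "t = 1 \<or> p = x" "t = 0 \<or> q = x" using fz pq by blast+
  then show ?thesis by auto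
qed

text \<open>Corners are extreme, so \<open>p\<close> is strictly inside both sides. The supporting
  function of \<open>a b\<close> vanishes there, hence at both ends of \<open>a' b'\<close>, and no
  corners but \<open>a\<close> and \<open>b\<close> lie on that line.\<close>

lemma edges_meet:
  assumes e: "edge vs a b" "edge vs a' b'" and p: "p \<in> open_segment a b" "p \<in> closed_segment a' b'"
  shows "{a', b'} = {a, b}"
proof -
  obtain s where s: "s \<noteq> 0" "\<And>x. x \<in> set vs \<Longrightarrow> x \<noteq> a \<Longrightarrow> x \<noteq> b \<Longrightarrow> s * orient a b x > 0"
    using edge_support [OF e(1)] by metis
  have V: "a \<in> set vs" "b \<in> set vs" "a' \<in> set vs" "b' \<in> set vs" "a' \<noteq> b'" using e edge_in by auto
  have pc: "p \<in> closed_segment a b" "p \<noteq> a" "p \<noteq> b" using p(1) by (auto simp: open_segment_def)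
  then have "p \<noteq> a'" "p \<noteq> b'" using corner_extreme V corner_in_region by metis+
  obtain t where t: "0 \<le> t" "t \<le> 1" "p = (1 - t) *\<^sub>R a' + t *\<^sub>R b'" using p(2) by (auto simp: closed_segment_def)
  have t01: "0 < t" "t < 1" using t \<open>p \<noteq> a'\<close> \<open>p \<noteq> b'\<close> by (auto simp: less_le)
  have nn: "0 \<le> s * orient a b a'" "0 \<le> s * orient a b b'"
    using edge_hull(1) [OF e(1) s(2,1)] V corner_in_region by auto
  have "0 = s * orient a b p" using orient_on_segment [OF pc(1)] by simp
  also have "\<dots> = (1 - t) * (s * orient a b a') + t * (s * orient a b b')"
    unfolding t(3) orient_affine by (simp add: algebra_simps)
  finally have "(1 - t) * (s * orient a b a') + t * (s * orient a b b') = 0" by simp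
  moreover have "0 \<le> (1 - t) * (s * orient a b a')" "0 \<le> t * (s * orient a b b')" using nn t by auto
  ultimately have "(1 - t) * (s * orient a b a') = 0" "t * (s * orient a b b') = 0" by linarith+
  then have "s * orient a b a' = 0" "s * orient a b b' = 0" using t01 by auto
  then have "a' = a \<or> a' = b" "b' = a \<or> b' = b" using s(2) V by fastforce+
  then show ?thesis using V(5) by auto
qed

lemma sides_eq: "sides U d vs = {closed_segment a b | a b. edge vs a b}"
proof
  show "sides U d vs \<subseteq> {closed_segment a b | a b. edge vs a b}"
    using cp_corner_in by (auto simp: sides_def edge_def seg_eq)
  have "closed_segment a b \<in> sides U d vs" if "edge vs a b" for a b
  proof -
    obtain i where i: "closed_segment a b = closed_segment (corner vs i) (corner vs (i + 1))"
      using \<open>edge vs a b\<close> by (auto simp: edge_def closed_segment_commute)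
    have c: "corner vs i = corner vs (i mod length vs)" "corner vs (i + 1) = corner vs (i mod length vs + 1)"
      by (simp_all add: corner_def mod_Suc_eq)
    have "closed_segment a b = seg U d (corner vs (i mod length vs)) (corner vs (i mod length vs + 1))"
      unfolding i seg_eq [OF cp_corner_in cp_corner_in] c [symmetric] ..
    moreover have "i mod length vs < length vs" using cp_ne by simp
    ultimately show ?thesis unfolding sides_def by blast
  qed
  then show "{closed_segment a b | a b. edge vs a b} \<subseteq> sides U d vs" by blast
qed

lemma set_eq_extreme: "set vs = {x. x extreme_point_of (region U d vs)}"
proof
  show "set vs \<subseteq> {x. x extreme_point_of (region U d vs)}"
    using corner_in_region corner_extreme
    by (auto simp: extreme_point_of_def open_segment_def)
  show "{x. x extreme_point_of (region U d vs)} \<subseteq> set vs"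
    unfolding region_eq [OF cp_sub] using extreme_point_of_convex_hull by blast
qed

text \<open>A side lies on a supporting line, which carries just two corners; positive weight on a
  third moves the combination off it.\<close>

lemma interior_combination:
  assumes abc: "a \<in> set vs" "b \<in> set vs" "c \<in> set vs" "a \<noteq> b" "a \<noteq> c" "b \<noteq> c"
    and l: "l > 0" "m > 0" "n > 0" "l + m + n = 1"
    and e: "edge vs p q"
  shows "l *\<^sub>R a + m *\<^sub>R b + n *\<^sub>R c \<notin> closed_segment p q"
proof
  assume "l *\<^sub>R a + m *\<^sub>R b + n *\<^sub>R c \<in> closed_segment p q"
  then have z: "orient p q (l *\<^sub>R a + m *\<^sub>R b + n *\<^sub>R c) = 0" by (rule orient_on_segment)
  obtain s where s: "s \<noteq> 0" "\<And>x. x \<in> set vs \<Longrightarrow> x \<noteq> p \<Longrightarrow> x \<noteq> q \<Longrightarrow> s * orient p q x > 0"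
    using edge_support [OF e] by metis
  have n: "n = 1 - l - m" using l by simp
  have "s * orient p q (l *\<^sub>R a + m *\<^sub>R b + n *\<^sub>R c) =
      l * (s * orient p q a) + m * (s * orient p q b) + n * (s * orient p q c)"
    unfolding n by (simp add: orient_def algebra_simps)
  moreover have nn: "0 \<le> s * orient p q x" if "x \<in> set vs" for x
    using s(2) [OF that] by (cases "x = p \<or> x = q") auto
  ultimately have "l * (s * orient p q a) + m * (s * orient p q b) + n * (s * orient p q c) = 0"
    using z by simp
  moreover have "0 \<le> l * (s * orient p q a)" "0 \<le> m * (s * orient p q b)" "0 \<le> n * (s * orient p q c)"
    using nn abc l by (auto intro!: mult_nonneg_nonneg)
  ultimately have "l * (s * orient p q a) = 0" "m * (s * orient p q b) = 0" "n * (s * orient p q c) = 0"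
    by linarith+
  then have "s * orient p q a = 0" "s * orient p q b = 0" "s * orient p q c = 0" using l by auto
  then have "a \<in> {p, q}" "b \<in> {p, q}" "c \<in> {p, q}" using s(2) abc by fastforce+
  then show False using abc by auto
qed

end

text \<open>Otherwise \<open>b\<close>, as a corner of \<open>vs\<close>, would lie strictly inside
  the angle \<open>p a q\<close>, so that the line \<open>a b\<close> separates \<open>p\<close>
  from \<open>q\<close>; but as a side of \<open>us\<close> it has both on the same side.\<close>

lemma wedge_unique:
  assumes us: "convex_polygon U d us" and vs: "convex_polygon U d vs" and V: "set us = set vs"
    and w: "wedge vs p a q" and e: "edge us a b"
  shows "b = p \<or> b = q"
proof (rule ccontr)
  assume ne: "\<not> (b = p \<or> b = q)"
  have ep: "edge vs a p" and eq: "edge vs a q" using wedge_edge [OF w] by auto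
  have pq: "p \<noteq> q" "p \<noteq> a" "q \<noteq> a" using wedge_neq [OF vs w] by auto
  have in': "p \<in> set vs" "q \<in> set vs" "b \<in> set vs" "b \<noteq> a"
    using edge_in [OF vs ep] edge_in [OF vs eq] edge_in [OF us e] V by auto
  obtain s where s: "\<And>x. x \<in> set us \<Longrightarrow> x \<noteq> a \<Longrightarrow> x \<noteq> b \<Longrightarrow> s * orient a b x > 0" using edge_support [OF us e] by metis
  obtain s1 where s1: "\<And>x. x \<in> set vs \<Longrightarrow> x \<noteq> a \<Longrightarrow> x \<noteq> p \<Longrightarrow> s1 * orient a p x > 0" using edge_support [OF vs ep] by metis
  obtain s2 where s2: "\<And>x. x \<in> set vs \<Longrightarrow> x \<noteq> a \<Longrightarrow> x \<noteq> q \<Longrightarrow> s2 * orient a q x > 0" using edge_support [OF vs eq] by metis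
  have 1: "s * orient a b p > 0" "s * orient a b q > 0" using s V in' ne pq by auto
  have 2: "s1 * orient a p q > 0" "s1 * - orient a b p > 0" using s1 [of q] s1 [of b] in' ne pq orient_swap_last [of a p b] by auto
  have 3: "s2 * - orient a p q > 0" "s2 * - orient a b q > 0" using s2 [of p] s2 [of b] in' ne pq orient_swap_last [of a q b] orient_swap_last [of a q p] by auto
  show False using 1 2 3 by (auto simp: zero_less_mult_iff mult_less_0_iff)
qed

lemma edge_set_eq:
  assumes "convex_polygon U d us" "convex_polygon U d vs" "set us = set vs" "edge us a b"
  shows "edge vs a b"
proof -
  have "a \<in> set vs" using edge_in assms by blast
  then obtain p q where w: "wedge vs p a q" using in_set_wedge [of a vs] by auto
  then have "b = p \<or> b = q" using wedge_unique [OF assms(1,2,3) w assms(4)] by blast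
  then show ?thesis using wedge_edge [OF w] by auto
qed

text \<open>Corners are the extreme points of the region. A face given as a point set thus fixes its
  corners, and by \<open>edge_set_eq\<close> its sides, though not the list.\<close>

lemma region_determines:
  assumes "convex_polygon U d us" "convex_polygon U d vs" "region U d us = region U d vs"
  shows "set us = set vs"
  using set_eq_extreme [OF assms(1)] set_eq_extreme [OF assms(2)] assms(3) by simp

end

subsection \<open>Regular polygons\<close>

text \<open>With \<open>w = cis \<theta>\<close> the left side is
  \<open>Im ((cnj w - 1) * (cis \<phi> - 1))\<close>, the orientation of \<open>cis \<phi>\<close>
  against the chord from 1 to \<open>w\<close>: the open arc lies beyond the chord.\<close>

lemma arc_negative:
  assumes "0 < \<phi>" "\<phi> < \<theta>" "\<theta> < pi"
  shows "sin (\<phi> - \<theta>) + sin \<theta> - sin \<phi> < 0"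
proof -
  define t where "t = \<theta> - \<phi>"
  have th: "\<theta> = \<phi> + t" "\<phi> - \<theta> = - t" by (simp_all add: t_def)
  have s: "sin \<phi> > 0" "sin t > 0" using assms by (auto simp: t_def intro!: sin_gt_zero)
  have c: "cos \<phi> < 1" "cos t < 1"
    using assms cos_monotone_0_pi [of 0 \<phi>] cos_monotone_0_pi [of 0 t] by (auto simp: t_def)
  have "sin (\<phi> - \<theta>) + sin \<theta> - sin \<phi> = sin \<phi> * (cos t - 1) + sin t * (cos \<phi> - 1)"
    unfolding th(2) unfolding th(1) by (simp add: sin_add algebra_simps)
  also have "\<dots> < 0" using s c by (intro add_neg_neg mult_pos_neg) auto
  finally show ?thesis .
qed

text \<open>With \<open>N\<close> the ceiling of \<open>2 * pi / \<theta>\<close>, the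
  \<open>N\<close>-th power overshoots a full turn by less than \<open>\<theta>\<close>, and a
  positive overshoot would land on the forbidden open arc. So the turn closes exactly;
  \<open>\<theta> < pi\<close> gives \<open>N\<close> at least 3.\<close>

lemma arc_closing:
  assumes "0 < \<theta>" "\<theta> < pi" and "\<And>k \<phi>. 0 < \<phi> \<Longrightarrow> \<phi> < \<theta> \<Longrightarrow> cis \<theta> ^ k \<noteq> cis \<phi>"
  shows "\<exists>N::nat. 3 \<le> N \<and> real N * \<theta> = 2 * pi"
proof -
  define N where "N = nat \<lceil>2 * pi / \<theta>\<rceil>"
  have "0 < 2 * pi / \<theta>" using assms(1) by simp
  then have N: "real N = of_int \<lceil>2 * pi / \<theta>\<rceil>" by (simp add: N_def)
  have "2 * pi / \<theta> \<le> real N" "real N < 2 * pi / \<theta> + 1" unfolding N by linarith+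
  then have b: "2 * pi \<le> real N * \<theta>" "real N * \<theta> < 2 * pi + \<theta>"
    using assms(1) by (auto simp: field_simps)
  have "real N * \<theta> = 2 * pi"
  proof (rule ccontr)
    assume "real N * \<theta> \<noteq> 2 * pi"
    then have "0 < real N * \<theta> - 2 * pi" "real N * \<theta> - 2 * pi < \<theta>" using b by auto
    moreover have "cis \<theta> ^ N = cis (real N * \<theta> - 2 * pi)"
      using Complex.DeMoivre [of \<theta> N] cis_divide [of "real N * \<theta>" "2 * pi"] by simp
    ultimately show False using assms(3) by blast
  qed
  moreover have "3 \<le> N"
  proof (rule ccontr)
    assume "\<not> 3 \<le> N"
    then have "real N \<le> 2" by simp
    then have "real N * \<theta> \<le> 2 * \<theta>" using assms(1) by (intro mult_right_mono) auto
    then show False using b assms(2) by linarith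
  qed
  ultimately show ?thesis by blast
qed

text \<open>
  Convexity of the polygon with corners \<open>w ^ k\<close> forbids corners on the open arc between \<open>1\<close> and \<open>w\<close>,
  which rules out the star polygons.
\<close>

lemma cycle_root:
  assumes w: "cmod w = 1" "Im w > 0" and m: "3 \<le> m" and per: "\<And>k. w ^ k = 1 \<longleftrightarrow> m dvd k"
    and s: "\<And>k. w ^ k \<noteq> 1 \<Longrightarrow> w ^ k \<noteq> w \<Longrightarrow> s * Im ((cnj w - 1) * (w ^ k - 1)) > 0"
  shows "w = cis (2 * pi / m)"
proof -
  define \<theta> where "\<theta> = Arg w"
  have w\<theta>: "w = cis \<theta>" using w cis_Arg [of w] by (cases "w = 0") (auto simp: \<theta>_def sgn_eq)
  have \<theta>: "0 < \<theta>" "\<theta> < pi" using Arg_lt_pi [of w] w(2) by (auto simp: \<theta>_def)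
  have im: "Im ((cnj w - 1) * (cis \<phi> - 1)) = sin (\<phi> - \<theta>) + sin \<theta> - sin \<phi>" for \<phi>
    by (simp add: w\<theta> sin_diff algebra_simps)
  \<comment> \<open>The corner \<open>w ^ 2\<close> has positive orientation against the chord from
    1 to \<open>w\<close>, which fixes \<open>s > 0\<close>.\<close>
  have "\<not> m dvd 2" "\<not> m dvd 1" using m by (auto dest: dvd_imp_le)
  then have "w ^ 2 \<noteq> 1" "w \<noteq> 1" using per [of 2] per [of 1] by auto
  moreover have "w ^ 2 \<noteq> w" using \<open>w \<noteq> 1\<close> w by (auto simp: power2_eq_square)
  ultimately have "s * Im ((cnj w - 1) * (w ^ 2 - 1)) > 0" by (intro s)
  moreover have "w ^ 2 = cis (2 * \<theta>)" by (simp add: w\<theta> Complex.DeMoivre)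
  moreover have "sin (2 * \<theta> - \<theta>) + sin \<theta> - sin (2 * \<theta>) = 2 * (sin \<theta> * (1 - cos \<theta>))"
    unfolding sin_double by (simp add: algebra_simps)
  ultimately have "s * (2 * (sin \<theta> * (1 - cos \<theta>))) > 0"
    using im [of "2 * \<theta>"] by metis
  moreover have "sin \<theta> * (1 - cos \<theta>) > 0"
    using \<theta> cos_monotone_0_pi [of 0 \<theta>] by (intro mult_pos_pos sin_gt_zero) auto
  ultimately have s0: "s > 0" by (simp add: zero_less_mult_iff)
  have "cis \<theta> ^ k \<noteq> cis \<phi>" if \<phi>: "0 < \<phi>" "\<phi> < \<theta>" for k \<phi>
  proof
    assume e: "cis \<theta> ^ k = cis \<phi>"
    have "cis \<phi> \<noteq> 1" using sin_gt_zero [of \<phi>] \<phi> \<theta> by (auto simp: complex_eq_iff)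
    moreover have "cis \<phi> \<noteq> cis \<theta>" using cos_monotone_0_pi [of \<phi> \<theta>] \<phi> \<theta> by (auto simp: complex_eq_iff)
    ultimately have "s * Im ((cnj w - 1) * (cis \<phi> - 1)) > 0" using s [of k] e w\<theta> by simp
    then show False using im [of \<phi>] arc_negative [OF \<phi> \<theta>(2)] s0 by (simp add: zero_less_mult_iff)
  qed
  then obtain N :: nat where N: "3 \<le> N" "real N * \<theta> = 2 * pi" using arc_closing [OF \<theta>] by blast
  \<comment> \<open>The order \<open>m\<close> of \<open>w\<close> divides \<open>N\<close>, so
    \<open>m * \<theta>\<close> is a positive multiple of \<open>2 * pi\<close> that does not exceed
    \<open>N * \<theta> = 2 * pi\<close>.\<close>
  have "w ^ N = 1" by (simp add: w\<theta> Complex.DeMoivre N(2))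
  then have mN: "m \<le> N" using per N(1) by (simp add: dvd_imp_le)
  have "w ^ m = 1" using per by simp
  then have "cos (real m * \<theta>) = 1" by (simp add: w\<theta> Complex.DeMoivre complex_eq_iff)
  then obtain j :: int where j: "real m * \<theta> = of_int j * (2 * pi)" by (auto simp: cos_one_2pi_int)
  have "0 < real m * \<theta>" using m \<theta> by simp
  then have "0 < j" unfolding j by (simp add: zero_less_mult_iff)
  moreover have "real m * \<theta> \<le> 2 * pi" using mN \<theta> N(2) mult_right_mono [of "real m" "real N" \<theta>] by simp
  then have "j \<le> 1" unfolding j by simp
  ultimately have "real m * \<theta> = 2 * pi" using j by simp
  then have "\<theta> = 2 * pi / real m" using m by (simp add: field_simps)
  then show ?thesis using w\<theta> by simp
qed

text \<open>Used for each further turn around a centre or a vertex: an equal chord leaves only the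
  same turn or its reverse, and the reverse would lead back to the preceding point.\<close>

lemma unit_chord:
  assumes "cmod u = 1" "cmod v = 1" "cmod (u - 1) = cmod (v - 1)"
  shows "v = u \<or> v = cnj u"
proof -
  have n: "(Re z)\<^sup>2 + (Im z)\<^sup>2 = 1" if "cmod z = 1" for z using that cmod_power2 [of z] by simp
  have "(cmod (u - 1))\<^sup>2 = (cmod (v - 1))\<^sup>2" using assms by simp
  then have "(Re u - 1)\<^sup>2 + (Im u)\<^sup>2 = (Re v - 1)\<^sup>2 + (Im v)\<^sup>2" by (simp add: cmod_power2)
  then have r: "Re u = Re v" using n [OF assms(1)] n [OF assms(2)] by (simp add: power2_diff)
  then have "(Im u)\<^sup>2 = (Im v)\<^sup>2" using n [OF assms(1)] n [OF assms(2)] by simp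
  then show ?thesis using r by (auto simp: complex_eq_iff power2_eq_iff)
qed

section \<open>Congruence in a chart, and the shape of regular polygons\<close>

context model_plane
begin

lemma T_zero: "T 0 = 0"
  using T_minus [of 0] by simp

lemma norm_dist:
  assumes "a \<in> U" "b \<in> U" shows "d 0 a = d 0 b \<longleftrightarrow> cmod a = cmod b"
proof -
  have "\<exists>r\<ge>0. T r = cmod a \<and> d 0 a = r" if a: "a \<in> U" for a
  proof -
    obtain r where r: "T r = cmod a" using T_surj [OF a] by blast
    have "T 0 \<le> T r" by (simp add: T_zero r)
    then have "0 \<le> r" using T_mono by (simp add: strict_mono_less_eq)
    define u where "u = (if a = 0 then 1 else sgn a)"
    have u: "cmod u = 1" "a = of_real (T r) * u" by (auto simp: u_def r sgn_eq norm_divide)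
    have "d (of_real (T 0) * u) (of_real (T r) * u) = \<bar>0 - r\<bar>" by (rule T_dist [OF u(1)])
    then have "d 0 a = r" using u(2) T_zero \<open>0 \<le> r\<close> by simp
    then show ?thesis using r \<open>0 \<le> r\<close> by blast
  qed
  then show ?thesis using assms T_mono by (metis strict_mono_eq)
qed

text \<open>Rotate \<open>x\<close> onto \<open>x'\<close> and compare the other ends by
  \<open>equidistant\<close> as seen from \<open>x'\<close>. On a circle about the origin, equality
  of distances is thus equality of Euclidean chords.\<close>

lemma chord_dist:
  assumes "x \<in> U" "y \<in> U" "x' \<in> U" "y' \<in> U" "cmod x = cmod y" "cmod x' = cmod y'" "cmod x = cmod x'"
  shows "d x y = d x' y' \<longleftrightarrow> cmod (x - y) = cmod (x' - y')"
proof (cases "x = 0")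
  case True
  then have "y = 0" "x' = 0" "y' = 0" using assms by auto
  then show ?thesis using True by simp
next
  case False
  define u where "u = x' / x"
  have u: "cmod u = 1" "u * x = x'" using False assms by (auto simp: u_def norm_divide)
  interpret isom U d U d "(*) u" by (rule rotation [OF u(1)])
  have "d x y = d x' (u * y)" using iso [OF assms(1,2)] u by simp
  moreover have "u * y \<in> U" using assms by simp
  moreover have "cmod (x - y) = cmod (x' - u * y)"
    using u by (simp add: u(2) [symmetric] norm_mult flip: right_diff_distrib)
  ultimately show ?thesis
    using equidistant [of x' "u * y" y'] assms u by (simp add: norm_mult)
qed

text \<open>The isometry behind the congruence matches rays only; on a ray a point is determined by
  its distance from the apex, so equal arms match the end points too.\<close>

lemma angle_isometry:
  assumes U: "a \<in> U" "b \<in> U" "c \<in> U" "a' \<in> U" "b' \<in> U" "c' \<in> U"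
    and ac: "angle_cong U d a b c a' b' c'" and da: "d b a = d b' a'" and dc: "d b c = d b' c'"
  shows "\<exists>h. isom U d U d h \<and> h a = a' \<and> h b = b' \<and> h c = c'"
proof -
  obtain h where h: "isom U d U d h" "h b = b'" "h ` ray U d b a = ray U d b' a'" "h ` ray U d b c = ray U d b' c'"
    using ac unfolding angle_cong_def is_isometry_iff by blast
  interpret isom U d U d h by (rule h)
  have key: "h x = x'" if x: "x \<in> U" "x' \<in> U" and r: "h ` ray U d b x = ray U d b' x'" and dx: "d b x = d b' x'" for x x'
  proof -
    have "x \<in> ray U d b x" using U x by (simp add: ray_def seg_def d_zero)
    then have hx: "h x \<in> ray U d b' x'" using r by blast
    have dhx: "d b' (h x) = d b' x'" using iso [of b x] U x h(2) dx by simp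
    have "d (h x) x' = 0"
      using hx dhx d_sym [of x' "h x"] by (auto simp: ray_def seg_def)
    then show ?thesis using d_zero x by simp
  qed
  show ?thesis using key [OF U(1,4) h(3) da] key [OF U(3,6) h(4) dc] h by blast
qed

text \<open>With \<open>a\<close> at the origin, the first distance fixes the modulus of the moved
  point and the second the real part of its product with \<open>cnj b'\<close>. The imaginary part
  is then known up to sign, and the half-plane decides the sign.\<close>

lemma sss:
  assumes U: "a \<in> U" "b \<in> U" "x \<in> U" "y \<in> U" and ab: "a \<noteq> b"
    and dx: "d a x = d a y" "d b x = d b y"
    and side: "same_side U d (line_through U d a b) x y"
  shows "x = y"
proof -
  obtain h where h: "isom U d U d h" "h a = 0" using homogeneous [OF U(1)] by blast
  interpret isom U d U d h by (rule h)
  define b' x' y' where "b' = h b" and "x' = h x" and "y' = h y"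
  have U': "b' \<in> U" "x' \<in> U" "y' \<in> U" using U by (auto simp: b'_def x'_def y'_def)
  have b0: "b' \<noteq> 0" using ab U h(2) eq_iff [of b a] by (auto simp: b'_def)
  have n: "cmod x' = cmod y'" using norm_dist [OF U'(2,3)] iso [of a x] iso [of a y] U dx h(2) by (simp add: x'_def y'_def)
  have "d b' x' = d b' y'" using iso [of b x] iso [of b y] U dx by (simp add: b'_def x'_def y'_def)
  then have e: "cmod (b' - x') = cmod (b' - y')" using equidistant [OF U' n] by simp
  have nn: "(cmod (b' - z))\<^sup>2 = (cmod b')\<^sup>2 + (cmod z)\<^sup>2 - 2 * Re (cnj b' * z)" for z
    unfolding cmod_power2 by (simp add: power2_eq_square algebra_simps)
  have re: "Re (cnj b' * x') = Re (cnj b' * y')" using e n nn [of x'] nn [of y'] by simp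
  have "cmod (cnj b' * x') = cmod (cnj b' * y')" using n by (simp add: norm_mult)
  then have "(cmod (cnj b' * x'))\<^sup>2 = (cmod (cnj b' * y'))\<^sup>2" by simp
  then have "(Im (cnj b' * x'))\<^sup>2 = (Im (cnj b' * y'))\<^sup>2" using re unfolding cmod_power2 by simp
  moreover have "same_side U d (line_through U d 0 b') x' y'"
    using side same_side_iff [OF line_sub U(3,4), of a b] line_image [OF U(1,2)] h(2)
    by (simp add: b'_def x'_def y'_def)
  then have "0 < orient 0 b' x' * orient 0 b' y'" using same_side_eq U' zero_in b0 by auto
  then have "0 < Im (cnj b' * x') * Im (cnj b' * y')" by (simp add: orient_def)
  ultimately have "Im (cnj b' * x') = Im (cnj b' * y')"
    by (auto simp: power2_eq_iff zero_less_mult_iff)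
  then have "cnj b' * x' = cnj b' * y'" using re by (simp add: complex_eq_iff)
  then have "x' = y'" using b0 by simp
  then show ?thesis using U by (simp add: x'_def y'_def)
qed

lemma regular_cp: "regular_polygon U d vs \<Longrightarrow> convex_polygon U d vs"
  by (simp add: regular_polygon_def)

lemma regular_side: "regular_polygon U d vs \<Longrightarrow>
    d (corner vs i) (corner vs (i + 1)) = d (corner vs j) (corner vs (j + 1))"
  unfolding regular_polygon_def by blast

text \<open>
  The isometries carrying three consecutive corners to the next three agree, since two consecutive ones
  coincide on a side and preserve the half-plane of the polygon.
\<close>

lemma regular_rotation:
  assumes r: "regular_polygon U d vs"
  shows "\<exists>h. isom U d U d h \<and> (\<forall>i. h (corner vs i) = corner vs (i + 1))"
proof -
  let ?c = "corner vs" and ?m = "length vs"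
  note cp = regular_cp [OF r]
  have cU: "?c i \<in> U" for i by (rule cp_corner_in [OF cp])
  have side: "d (?c i) (?c (i + 1)) = d (?c j) (?c (j + 1))" for i j by (rule regular_side [OF r])
  have ex: "\<exists>h. isom U d U d h \<and> h (?c i) = ?c (i + 1) \<and> h (?c (i + 1)) = ?c (i + 2) \<and> h (?c (i + 2)) = ?c (i + 3)" for i
  proof (rule angle_isometry [OF cU cU cU cU cU cU])
    have "angle_cong U d (?c i) (?c (i + 1)) (?c (i + 2)) (?c (i + 1)) (?c (i + 1 + 1)) (?c (i + 1 + 2))"
      using r unfolding regular_polygon_def by blast
    then show "angle_cong U d (?c i) (?c (i + 1)) (?c (i + 2)) (?c (i + 1)) (?c (i + 2)) (?c (i + 3))"
      by (simp add: numeral_eq_Suc)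
    show "d (?c (i + 1)) (?c i) = d (?c (i + 2)) (?c (i + 1))"
      using side [of i "i + 1"] d_sym by simp
    show "d (?c (i + 1)) (?c (i + 2)) = d (?c (i + 2)) (?c (i + 3))"
      using side [of "i + 1" "i + 2"] by (simp add: numeral_eq_Suc)
  qed
  then obtain h where h: "isom U d U d h" "h (?c 0) = ?c 1" "h (?c 1) = ?c 2" "h (?c 2) = ?c 3"
    using ex [of 0] unfolding add_0 by metis
  interpret H: isom U d U d h by (rule h)
  have step: "h (?c (i + 3)) = ?c (i + 4)"
    if IH: "h (?c i) = ?c (i + 1)" "h (?c (i + 1)) = ?c (i + 2)" "h (?c (i + 2)) = ?c (i + 3)" for i
  proof (cases "?m = 3")
    case True
    then have "?c (i + 3) = ?c i" "?c (i + 4) = ?c (i + 1)"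
      using corner_shift [of vs i] corner_shift [of vs "i + 1"] by (simp_all add: add.commute)
    then show ?thesis using IH by simp
  next
    case False
    then have m4: "4 \<le> ?m" using cp_len [OF cp] by simp
    obtain g where g: "isom U d U d g" "g (?c (i + 1)) = ?c (i + 2)" "g (?c (i + 2)) = ?c (i + 3)" "g (?c (i + 3)) = ?c (i + 4)"
      using ex [of "i + 1"] by (auto simp: numeral_eq_Suc)
    interpret G: isom U d U d g by (rule g)
    \<comment> \<open>\<open>g\<close> shows that corner \<open>i + 4\<close> has the same distances
      from corners \<open>i + 2\<close> and \<open>i + 3\<close> as \<open>y\<close>; as both lie on
      the polygon's side of that line, \<open>sss\<close> gives equality.\<close>
    define y where "y = h (?c (i + 3))"
    have yU: "y \<in> U" using cU by (simp add: y_def)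
    have nd: "?c j = ?c k \<longleftrightarrow> j mod ?m = k mod ?m" for j k by (rule corner_eq_iff [OF cp])
    have ne: "?c (j + k) \<noteq> ?c j" if "0 < k" "k < ?m" for j k
      using that unfolding nd by (auto simp: mod_eq_dvd_iff_nat dest: dvd_imp_le)
    have line_h: "line_through U d (?c (i + 2)) (?c (i + 3)) = h ` line_through U d (?c (i + 1)) (?c (i + 2))"
      using H.line_image [OF cU cU, of "i + 1" "i + 2"] IH by simp
    have e12: "edge vs (?c (i + 1)) (?c (i + 2))" "edge vs (?c (i + 2)) (?c (i + 3))"
      using edge_corner [of vs "i + 1"] edge_corner [of vs "i + 2"] by (simp_all add: numeral_eq_Suc)
    obtain s where s: "\<And>x. x \<in> set vs \<Longrightarrow> x \<noteq> ?c (i + 1) \<Longrightarrow> x \<noteq> ?c (i + 2) \<Longrightarrow> s * orient (?c (i + 1)) (?c (i + 2)) x > 0"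
      using edge_support [OF cp e12(1)] by metis
    obtain s' where s': "\<And>x. x \<in> set vs \<Longrightarrow> x \<noteq> ?c (i + 2) \<Longrightarrow> x \<noteq> ?c (i + 3) \<Longrightarrow> s' * orient (?c (i + 2)) (?c (i + 3)) x > 0"
      using edge_support [OF cp e12(2)] by metis
    have inV: "?c j \<in> set vs" for j by (rule corner_in_set [OF cp_ne [OF cp]])
    have d1: "?c i \<noteq> ?c (i + 1)" "?c i \<noteq> ?c (i + 2)" "?c (i + 3) \<noteq> ?c (i + 1)" "?c (i + 3) \<noteq> ?c (i + 2)"
      "?c (i + 1) \<noteq> ?c (i + 2)" "?c (i + 1) \<noteq> ?c (i + 3)" "?c (i + 4) \<noteq> ?c (i + 2)" "?c (i + 4) \<noteq> ?c (i + 3)"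
      using ne [of 1 i] ne [of 2 i] ne [of 2 "i + 1"] ne [of 1 "i + 2"] ne [of 1 "i + 1"] ne [of 2 "i + 2"] ne [of 1 "i + 3"] m4
      by (auto simp: numeral_eq_Suc)
    have "s * orient (?c (i + 1)) (?c (i + 2)) (?c i) > 0" "s * orient (?c (i + 1)) (?c (i + 2)) (?c (i + 3)) > 0"
      using s inV d1 by auto
    then have "same_side U d (line_through U d (?c (i + 1)) (?c (i + 2))) (?c i) (?c (i + 3))"
      unfolding same_side_eq [OF cU cU d1(5) cU cU] by (auto simp: zero_less_mult_iff)
    then have "same_side U d (line_through U d (?c (i + 2)) (?c (i + 3))) (?c (i + 1)) y"
      unfolding line_h y_def IH(1) [symmetric] by (subst H.same_side_iff [OF H.line_sub cU cU])
    then have p1: "0 < orient (?c (i + 2)) (?c (i + 3)) (?c (i + 1)) * orient (?c (i + 2)) (?c (i + 3)) y"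
      using same_side_eq cU d1(4) yU by metis
    have p2: "s' * orient (?c (i + 2)) (?c (i + 3)) (?c (i + 1)) > 0" "s' * orient (?c (i + 2)) (?c (i + 3)) (?c (i + 4)) > 0"
      using s' inV d1 by auto
    have "same_side U d (line_through U d (?c (i + 2)) (?c (i + 3))) y (?c (i + 4))"
      unfolding same_side_eq [OF cU cU d1(4) [symmetric] yU cU] using p1 p2 by (auto simp: zero_less_mult_iff)
    moreover have "d (?c (i + 2)) y = d (?c (i + 2)) (?c (i + 4))"
      using H.iso [OF cU cU, of "i + 1" "i + 3"] G.iso [OF cU cU, of "i + 1" "i + 3"] IH g by (simp add: y_def)
    moreover have "d (?c (i + 3)) y = d (?c (i + 3)) (?c (i + 4))"
      using H.iso [OF cU cU, of "i + 2" "i + 3"] G.iso [OF cU cU, of "i + 2" "i + 3"] IH g by (simp add: y_def)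
    ultimately have "y = ?c (i + 4)" using sss [OF cU cU yU cU d1(4) [symmetric]] by blast
    then show ?thesis by (simp add: y_def)
  qed
  have "h (?c i) = ?c (i + 1) \<and> h (?c (i + 1)) = ?c (i + 2) \<and> h (?c (i + 2)) = ?c (i + 3)" for i
  proof (induction i)
    case 0 then show ?case using h by (simp add: numeral_eq_Suc)
  next
    case (Suc i) then show ?case using step [of i] by (simp add: numeral_eq_Suc)
  qed
  then show ?thesis using h(1) by blast
qed

text \<open>The cyclic rotation permutes the corners and so fixes their barycentre, whose distances
  to consecutive corners therefore agree.\<close>

lemma centre_exists:
  assumes r: "regular_polygon U d vs" shows "\<exists>c. is_centre U d vs c"
proof -
  note cp = regular_cp [OF r]
  obtain h where h: "isom U d U d h" "\<And>i. h (corner vs i) = corner vs (i + 1)" using regular_rotation [OF r] by blast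
  interpret isom U d U d h by (rule h)
  have "h ` set vs = set vs"
  proof (rule card_subset_eq)
    show "h ` set vs \<subseteq> set vs"
      using h(2) in_set_corner corner_in_set [OF cp_ne [OF cp]] by (metis image_subsetI)
    have "inj_on h (set vs)" using cp_sub [OF cp] by (auto simp: inj_on_def subset_iff)
    then show "card (h ` set vs) = card (set vs)" by (rule card_image)
  qed simp
  moreover have "set vs \<noteq> {}" using cp_ne [OF cp] by simp
  ultimately obtain c where c: "c \<in> U" "h c = c"
    using barycentre [of "set vs"] cp_sub [OF cp] h(1) by blast
  have "d c (corner vs (i + 1)) = d c (corner vs i)" for i
    using iso [OF c(1) cp_corner_in [OF cp]] c(2) h(2) by metis
  then have "d c (corner vs i) = d c (corner vs 0)" for i by (induction i) auto
  then have "is_centre U d vs c" unfolding is_centre_def using c(1) in_set_corner by metis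
  then show ?thesis by blast
qed

text \<open>Equal sides between corners of equal modulus are equal chords, so each quotient of
  consecutive corners is \<open>w\<close> or \<open>cnj w\<close>; the latter would give back the
  corner two places earlier. That \<open>w\<close> makes a single turn per round is
  \<open>cycle_root\<close>, applied to \<open>w\<close> or to \<open>cnj w\<close>.\<close>

lemma normal_form:
  assumes r: "regular_polygon U d vs" and c0: "is_centre U d vs 0"
  shows "\<exists>w. (w = cis (2 * pi / length vs) \<or> w = cis (- (2 * pi / length vs))) \<and> corner vs 0 \<noteq> 0 \<and>
      (\<forall>i. corner vs i = corner vs 0 * w ^ i)"
proof -
  let ?c = "corner vs" and ?m = "length vs"
  note cp = regular_cp [OF r]
  have cU: "?c i \<in> U" for i by (rule cp_corner_in [OF cp])
  have inV: "?c j \<in> set vs" for j by (rule corner_in_set [OF cp_ne [OF cp]])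
  have nrm: "cmod (?c i) = cmod (?c 0)" for i
    using c0 inV norm_dist [OF cU cU] unfolding is_centre_def by blast
  have nz: "?c i \<noteq> 0" for i
    using cp_consecutive [OF cp, of 0] nrm [of 1] nrm [of i] by auto
  have ch: "cmod (?c i - ?c (i + 1)) = cmod (?c 0 - ?c 1)" for i
  proof -
    have n: "cmod (?c i) = cmod (?c (i + 1))" "cmod (?c 0) = cmod (?c 1)" "cmod (?c i) = cmod (?c 0)"
      by (simp_all only: nrm [of i] nrm [of "i + 1"] nrm [of 1])
    have "d (?c i) (?c (i + 1)) = d (?c 0) (?c (0 + 1))" by (rule regular_side [OF r])
    then show ?thesis using chord_dist [OF cU cU cU cU n] by simp
  qed
  define w where "w = ?c 1 / ?c 0"
  have w1: "cmod w = 1" using nrm [of 1] nz [of 0] by (simp add: w_def norm_divide)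
  have step: "?c (i + 1) = ?c i * w" for i
  proof (induction i)
    case 0 then show ?case using nz by (simp add: w_def)
  next
    case (Suc i)
    define v where "v = ?c (i + 2) / ?c (i + 1)"
    have v1: "cmod v = 1" using nrm [of "i + 1"] nrm [of "i + 2"] nz [of 0] by (simp add: v_def norm_divide)
    have "cmod (w - 1) = cmod (?c 0 - ?c 1) / cmod (?c 0)"
      using nz [of 0] by (simp add: w_def norm_minus_commute flip: norm_divide) (simp add: diff_divide_distrib)
    moreover have "cmod (v - 1) = cmod (?c (i + 1) - ?c (i + 2)) / cmod (?c (i + 1))"
      using nz [of "i + 1"] by (simp add: v_def norm_minus_commute flip: norm_divide) (simp add: diff_divide_distrib)
    ultimately have "cmod (w - 1) = cmod (v - 1)" using ch [of "i + 1"] nrm [of "i + 1"] by simp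
    then have "v = w \<or> v = cnj w" by (rule unit_chord [OF w1 v1])
    moreover have "v \<noteq> cnj w"
    proof
      assume "v = cnj w"
      then have "v * w = 1" using w1 complex_norm_square [of w] by (simp add: mult.commute)
      then have "?c (i + 2) = ?c i" using Suc nz [of "i + 1"] by (simp add: v_def field_simps)
      then show False using corner_eq_iff [OF cp] consecutive_mod_neq(1) [OF cp_len [OF cp]] by metis
    qed
    ultimately have "v = w" by blast
    then show ?case using nz [of "i + 1"] by (simp add: v_def field_simps)
  qed
  have cw: "?c i = ?c 0 * w ^ i" for i
  proof (induction i)
    case (Suc i) then show ?case using step [of i] by simp
  qed simp
  have per: "w ^ k = 1 \<longleftrightarrow> ?m dvd k" for k
  proof -
    have "w ^ k = 1 \<longleftrightarrow> ?c k = ?c 0" using cw [of k] nz [of 0] by simp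
    also have "\<dots> \<longleftrightarrow> ?m dvd k" unfolding corner_eq_iff [OF cp] by (simp add: mod_0_imp_dvd dvd_imp_mod_0) (metis dvd_eq_mod_eq_0)
    finally show ?thesis .
  qed
  have "edge vs (?c 0) (?c 1)" using edge_corner [of vs 0] by simp
  then obtain s where s: "\<And>x. x \<in> set vs \<Longrightarrow> x \<noteq> ?c 0 \<Longrightarrow> x \<noteq> ?c 1 \<Longrightarrow> s * orient (?c 0) (?c 1) x > 0"
    using edge_support [OF cp] by metis
  have ori: "s * Im ((cnj w - 1) * (w ^ k - 1)) > 0" if k: "w ^ k \<noteq> 1" "w ^ k \<noteq> w" for k
  proof -
    have "?c k \<noteq> ?c 0" "?c k \<noteq> ?c 1" using cw [of k] cw [of 1] nz [of 0] k by auto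
    then have "s * orient (?c 0) (?c 1) (?c k) > 0" using s inV by blast
    moreover have "orient (?c 0) (?c 1) (?c k) = (cmod (?c 0))\<^sup>2 * Im ((cnj w - 1) * (w ^ k - 1))"
    proof -
      have "cnj (?c 1 - ?c 0) * (?c k - ?c 0) = of_real ((cmod (?c 0))\<^sup>2) * ((cnj w - 1) * (w ^ k - 1))"
        unfolding complex_norm_square using cw [of k] cw [of 1] by (simp add: algebra_simps)
      then show ?thesis by (simp only: orient_def) simp
    qed
    moreover have "0 < s * I" if "0 < s * (q * I)" "0 < q" for q I :: real
      using that by (auto simp: zero_less_mult_iff mult_less_0_iff)
    moreover have "0 < (cmod (?c 0))\<^sup>2" using nz [of 0] by simp
    ultimately show ?thesis by metis
  qed
  have m3: "3 \<le> ?m" by (rule cp_len [OF cp])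
  have "\<not> ?m dvd 2" using m3 by (auto dest: dvd_imp_le)
  then have "Im w \<noteq> 0"
    using per [of 2] w1 cmod_power2 [of w] by (auto simp: complex_eq_iff power2_eq_square)
  then consider "Im w > 0" | "Im w < 0" by linarith
  then have "w = cis (2 * pi / ?m) \<or> w = cis (- (2 * pi / ?m))"
  proof cases
    case 1
    then show ?thesis using cycle_root [OF w1 1 m3 per ori] by simp
  next
    case 2
    have "cnj w = cis (2 * pi / ?m)"
    proof (rule cycle_root [of _ _ "- s"])
      show "cmod (cnj w) = 1" "Im (cnj w) > 0" "3 \<le> ?m" using w1 2 m3 by auto
      show "cnj w ^ k = 1 \<longleftrightarrow> ?m dvd k" for k
        unfolding per [symmetric] by (metis complex_cnj_one complex_cnj_power complex_cnj_cnj)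
      show "- s * Im ((cnj (cnj w) - 1) * (cnj w ^ k - 1)) > 0" if "cnj w ^ k \<noteq> 1" "cnj w ^ k \<noteq> cnj w" for k
      proof -
        have "(cnj (cnj w) - 1) * (cnj w ^ k - 1) = cnj ((cnj w - 1) * (w ^ k - 1))" by simp
        moreover have "Im (cnj z) = - Im z" for z by simp
        ultimately have I: "Im ((cnj (cnj w) - 1) * (cnj w ^ k - 1)) = - Im ((cnj w - 1) * (w ^ k - 1))" by (simp only:)
        have "w ^ k \<noteq> 1" "w ^ k \<noteq> w" using that by (auto simp flip: complex_cnj_power)
        then show ?thesis unfolding I minus_mult_minus by (rule ori)
      qed
    qed
    then have "w = cnj (cis (2 * pi / ?m))" by (metis complex_cnj_cnj)
    then show ?thesis by (simp add: cis_cnj)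
  qed
  then show ?thesis using cw nz by blast
qed

text \<open>The powers of \<open>w\<close> sum to 0, so the origin is the mean of the corners. Its
  value under a supporting function is the mean of nonnegative values, one of them positive.\<close>

lemma centre_inside0:
  assumes r: "regular_polygon U d vs" and c0: "is_centre U d vs 0"
  shows "0 \<in> region U d vs"
    and "edge vs a b \<Longrightarrow> x \<in> set vs \<Longrightarrow> x \<noteq> a \<Longrightarrow> x \<noteq> b \<Longrightarrow> 0 < orient a b 0 * orient a b x"
proof -
  let ?c = "corner vs" and ?m = "length vs"
  note cp = regular_cp [OF r]
  obtain w where w: "w = cis (2 * pi / ?m) \<or> w = cis (- (2 * pi / ?m))" "?c 0 \<noteq> 0" "\<And>i. ?c i = ?c 0 * w ^ i"
    using normal_form [OF r c0] by blast
  have "?c ?m = ?c 0" using corner_shift [of vs 0] by simp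
  then have wm: "w ^ ?m = 1" using w(2) w(3) [of ?m] by simp
  have w1: "w \<noteq> 1" using cp_consecutive [OF cp, of 0] w(3) [of 1] by auto
  have s0: "(\<Sum>i<?m. ?c i) = 0"
  proof -
    have "(\<Sum>i<?m. ?c i) = ?c 0 * (\<Sum>i<?m. w ^ i)" by (simp only: sum_distrib_left w(3) [symmetric])
    also have "(\<Sum>i<?m. w ^ i) = 0" using geometric_sum [OF w1, of ?m] wm by simp
    finally show ?thesis by simp
  qed
  have bij: "bij_betw ?c {..<?m} (set vs)"
  proof (rule bij_betwI')
    show "?c i = ?c j \<longleftrightarrow> i = j" if "i \<in> {..<?m}" "j \<in> {..<?m}" for i j
      using that corner_eq_iff [OF cp, of i j] by simp
    show "?c i \<in> set vs" for i by (rule corner_in_set [OF cp_ne [OF cp]])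
    fix y assume y: "y \<in> set vs"
    obtain i where i: "y = ?c i" using in_set_corner [OF y] by blast
    then have "y = ?c (i mod ?m)" by (simp only: corner_mod)
    moreover have "i mod ?m < ?m" using cp_ne [OF cp] by simp
    ultimately show "\<exists>i\<in>{..<?m}. y = ?c i" by blast
  qed
  have card: "card (set vs) = ?m" using bij_betw_same_card [OF bij] by simp
  have m: "real ?m > 0" using cp_ne [OF cp] by simp
  have S0: "(\<Sum>y\<in>set vs. y) = 0" using sum.reindex_bij_betw [OF bij, of "\<lambda>y. y"] s0 by simp
  have u1: "(\<Sum>y\<in>set vs. 1 / real ?m) = 1" using card m by simp
  have z: "(\<Sum>y\<in>set vs. (1 / real ?m) *\<^sub>R y) = 0" using S0 by (simp flip: scaleR_sum_right)
  have "(\<Sum>y\<in>set vs. (1 / real ?m) *\<^sub>R y) \<in> convex hull (set vs)"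
    by (rule convex_sum [OF _ convex_convex_hull u1]) (auto intro: hull_inc)
  then show "0 \<in> region U d vs" unfolding region_eq [OF cp_sub [OF cp]] z .
  assume e: "edge vs a b" and x: "x \<in> set vs" "x \<noteq> a" "x \<noteq> b"
  obtain s where s: "\<And>y. y \<in> set vs \<Longrightarrow> y \<noteq> a \<Longrightarrow> y \<noteq> b \<Longrightarrow> s * orient a b y > 0" using edge_support [OF cp e] by metis
  have "s * orient a b 0 = (\<Sum>y\<in>set vs. 1 / real ?m * (s * orient a b y))"
    using orient_sum [OF _ u1, of a b] unfolding z by (simp add: sum_distrib_left algebra_simps)
  also have "\<dots> > 0"
  proof (rule sum_pos2 [OF _ x(1)])
    show "0 < 1 / real ?m * (s * orient a b x)" using s [OF x] m by simp
    show "0 \<le> 1 / real ?m * (s * orient a b y)" if "y \<in> set vs" for y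
      using s [OF that] m by (cases "y = a \<or> y = b") auto
  qed simp
  finally show "0 < orient a b 0 * orient a b x" using s [OF x] by (auto simp: zero_less_mult_iff)
qed

lemma centred_copy:
  assumes r: "regular_polygon U d vs" and c: "is_centre U d vs c"
  obtains h where "isom U d U d h" "h c = 0" "regular_polygon U d (map h vs)" "is_centre U d (map h vs) 0"
proof -
  have cU: "c \<in> U" using c by (simp add: is_centre_def)
  obtain h where h: "isom U d U d h" "h c = 0" using homogeneous [OF cU] by blast
  interpret isom U d U d h by (rule h)
  have "is_centre U d (map h vs) (h c)" using is_centre_iff [OF cp_sub [OF regular_cp [OF r]] cU] c by simp
  then show ?thesis using that [OF h(1)] h regular_polygon_image [OF r] by simp
qed

lemma centre_inside:
  assumes r: "regular_polygon U d vs" and c: "is_centre U d vs c"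
  shows "c \<in> region U d vs"
    and "edge vs a b \<Longrightarrow> x \<in> set vs \<Longrightarrow> x \<noteq> a \<Longrightarrow> x \<noteq> b \<Longrightarrow> 0 < orient a b c * orient a b x"
proof -
  note cp = regular_cp [OF r]
  have cU: "c \<in> U" using c by (simp add: is_centre_def)
  obtain h where h: "isom U d U d h" "h c = 0" "regular_polygon U d (map h vs)" "is_centre U d (map h vs) 0"
    using centred_copy [OF r c] by metis
  interpret isom U d U d h by (rule h)
  have "h c \<in> h ` region U d vs"
    using centre_inside0(1) [OF h(3,4)] region_image [OF cp_sub [OF cp]] h(2) by simp
  then show "c \<in> region U d vs" using mem_image_iff [OF cU region_sub [OF cp_sub [OF cp]]] by simp
  assume e: "edge vs a b" and x: "x \<in> set vs" "x \<noteq> a" "x \<noteq> b"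
  have abU: "a \<in> U" "b \<in> U" "a \<noteq> b" "x \<in> U" using edge_in [OF cp e] cp_sub [OF cp] x by auto
  have "edge (map h vs) (h a) (h b)" by (rule edge_map [OF cp_ne [OF cp] e])
  moreover have "h x \<in> set (map h vs)" "h x \<noteq> h a" "h x \<noteq> h b" using x abU by auto
  ultimately have "0 < orient (h a) (h b) (h c) * orient (h a) (h b) (h x)"
    using centre_inside0(2) [OF h(3,4)] h(2) by simp
  \<comment> \<open>\<open>orient\<close> depends on the chart, half-planes are metric: the way back
    goes through \<open>same_side\<close>.\<close>
  then have "same_side U d (line_through U d (h a) (h b)) (h c) (h x)"
    using same_side_eq [of "h a" "h b" "h c" "h x"] abU cU by simp
  then have "same_side U d (line_through U d a b) c x"
    using same_side_iff [OF line_sub cU abU(4), of a b] line_image [OF abU(1,2)] by simp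
  then show "0 < orient a b c * orient a b x" using same_side_eq [OF abU(1-3) cU abU(4)] by simp
qed

text \<open>With one centre at the origin all corners have equal modulus, and
  \<open>equidistant\<close> makes the inner product with the other centre \<open>p\<close> constant
  on them. So \<open>p\<close> is orthogonal to two independent differences of corners, and Cramer's
  rule gives \<open>p = 0\<close>.\<close>

lemma centre_unique:
  assumes r: "regular_polygon U d vs" and c: "is_centre U d vs c" "is_centre U d vs c'"
  shows "c' = c"
proof -
  note cp = regular_cp [OF r]
  have cU: "c \<in> U" "c' \<in> U" using c by (auto simp: is_centre_def)
  obtain h where h: "isom U d U d h" "h c = 0" "regular_polygon U d (map h vs)" "is_centre U d (map h vs) 0"
    using centred_copy [OF r c(1)] by metis
  interpret isom U d U d h by (rule h)
  define us p where "us = map h vs" and "p = h c'"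
  have p: "is_centre U d us p" "p \<in> U"
    using is_centre_iff [OF cp_sub [OF cp] cU(2)] c(2) cU by (auto simp: us_def p_def)
  note cpu = regular_cp [OF h(3), folded us_def]
  have inner_eq: "inner p x = inner p y" if xy: "x \<in> set us" "y \<in> set us" for x y
  proof -
    have xyU: "x \<in> U" "y \<in> U" using xy cp_sub [OF cpu] by auto
    have n: "cmod x = cmod y" using h(4) [folded us_def] xy norm_dist [OF xyU] unfolding is_centre_def by blast
    have "d p x = d p y" using p(1) xy unfolding is_centre_def by blast
    then have "cmod (p - x) = cmod (p - y)" using equidistant [OF p(2) xyU n] by simp
    then have "(cmod (p - x))\<^sup>2 = (cmod (p - y))\<^sup>2" by simp
    moreover have "(cmod (p - z))\<^sup>2 = (cmod p)\<^sup>2 + (cmod z)\<^sup>2 - 2 * inner p z" for z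
      by (simp add: power2_norm_eq_inner inner_diff_left inner_diff_right inner_commute)
    ultimately show ?thesis using n by simp
  qed
  have "p = 0"
  proof (rule ccontr)
    assume p0: "p \<noteq> 0"
    define f where "f = corner us"
    have fin: "f i \<in> set us" for i unfolding f_def by (rule corner_in_set [OF cp_ne [OF cpu]])
    have ne: "f 2 \<noteq> f 0" "f 2 \<noteq> f 1"
      using consecutive_mod_neq [OF cp_len [OF cpu], of 0] corner_eq_iff [OF cpu] by (auto simp: f_def numeral_eq_Suc)
    have "edge us (f 0) (f 1)" using edge_corner [of us 0] by (simp add: f_def)
    then have o: "orient (f 0) (f 1) (f 2) \<noteq> 0"
      using edge_support [OF cpu] fin ne by (metis less_irrefl mult_zero_right)
    define A B where "A = f 1 - f 0" and "B = f 2 - f 0"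
    have "inner p A = 0" "inner p B = 0" using inner_eq fin by (simp_all add: A_def B_def inner_diff_right)
    then have ab: "Re p * Re A + Im p * Im A = 0" "Re p * Re B + Im p * Im B = 0" by (simp_all add: inner_complex_def)
    have "Re p * (Re A * Im B - Im A * Re B) = (Re p * Re A + Im p * Im A) * Im B - (Re p * Re B + Im p * Im B) * Im A"
      "Im p * (Re A * Im B - Im A * Re B) = (Re p * Re B + Im p * Im B) * Re A - (Re p * Re A + Im p * Im A) * Re B"
      by (simp_all add: algebra_simps)
    then have "Re p * (Re A * Im B - Im A * Re B) = 0" "Im p * (Re A * Im B - Im A * Re B) = 0" using ab by simp_all
    then have "Re A * Im B - Im A * Re B = 0" using p0 by (auto simp: complex_eq_iff)
    moreover have "orient (f 0) (f 1) (f 2) = Re A * Im B - Im A * Re B"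
      unfolding orient_def A_def [symmetric] B_def [symmetric] by simp
    ultimately show False using o by simp
  qed
  then show ?thesis using h(2) cU by (simp add: p_def) (metis eq_iff)
qed

lemma root_pair_norms:
  assumes "w = cis \<theta> \<or> w = cis (- \<theta>)" "w' = cis \<theta> \<or> w' = cis (- \<theta>)"
  shows "cmod (1 - w) = cmod (1 - w')" "cmod (1 - w\<^sup>2) = cmod (1 - w'\<^sup>2)"
proof -
  have "w' = w \<or> w' = cnj w" using assms by (auto simp: cis_cnj)
  then show "cmod (1 - w) = cmod (1 - w')" "cmod (1 - w\<^sup>2) = cmod (1 - w'\<^sup>2)"
    using complex_mod_cnj [of "1 - w"] complex_mod_cnj [of "1 - w\<^sup>2"] by auto
qed

text \<open>For a fixed angle at the centre the chord grows strictly with the radius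
  (\<open>scale_mono\<close>), so equal numbers of corners and equal sides force equal radii, and
  then equal short diagonals. This is how faces sharing a side are seen to have equal
  angles.\<close>

lemma regular_diagonal0:
  assumes r: "regular_polygon U d us" "regular_polygon U d vs" "length us = length vs"
    and c: "is_centre U d us 0" "is_centre U d vs 0"
    and side: "d (corner us 0) (corner us 1) = d (corner vs 0) (corner vs 1)"
  shows "d (corner us i) (corner us (i + 2)) = d (corner vs j) (corner vs (j + 2))"
proof -
  obtain w where w: "w = cis (2 * pi / length vs) \<or> w = cis (- (2 * pi / length vs))" "corner us 0 \<noteq> 0"
      "\<And>i. corner us i = corner us 0 * w ^ i"
    using normal_form [OF r(1) c(1)] unfolding r(3) by blast
  obtain w' where w': "w' = cis (2 * pi / length vs) \<or> w' = cis (- (2 * pi / length vs))" "corner vs 0 \<noteq> 0"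
      "\<And>i. corner vs i = corner vs 0 * w' ^ i"
    using normal_form [OF r(2) c(2)] by blast
  define a b where "a = corner us 0" and "b = corner vs 0"
  have uU: "corner us i \<in> U" and vU: "corner vs i \<in> U" for i
    using cp_corner_in regular_cp r by blast+
  have n1: "cmod w = 1" "cmod w' = 1" using w(1) w'(1) by auto
  have w_ne: "w \<noteq> 1" using cp_consecutive [OF regular_cp [OF r(1)], of 0] w(3) [of 1] by auto
  have w_ne': "w' \<noteq> 1" using cp_consecutive [OF regular_cp [OF r(2)], of 0] w'(3) [of 1] by auto
  have nu: "cmod (corner us i) = cmod a" for i using w(3) [of i] n1 by (simp add: a_def norm_mult norm_power)
  have nv: "cmod (corner vs i) = cmod b" for i using w'(3) [of i] n1 by (simp add: b_def norm_mult norm_power)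
  have eqn: "cmod (1 - w) = cmod (1 - w')" "cmod (1 - w\<^sup>2) = cmod (1 - w'\<^sup>2)"
    using root_pair_norms [OF w(1) w'(1)] by auto
  \<comment> \<open>If the radius of \<open>x\<close> is smaller, blow its chord up to the radius of
    \<open>y\<close> along the same rays, then compare with the chord at \<open>y\<close> by
    \<open>chord_dist\<close>.\<close>
  have less: False
    if *: "cmod x < cmod y" "x \<noteq> 0" "x \<in> U" "y \<in> U" "x * z \<in> U" "y * z' \<in> U"
      "cmod z = 1" "cmod z' = 1" "z \<noteq> 1" "z' \<noteq> 1" "cmod (1 - z) = cmod (1 - z')" "d x (x * z) = d y (y * z')" for x y z z'
  proof -
    define u where "u = sgn x"
    have u: "cmod u = 1" "x = of_real (cmod x) * u" using *(2) by (auto simp: u_def norm_divide sgn_eq)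
    obtain s where s: "T s = cmod y" using T_surj [OF *(4)] by blast
    have yu: "of_real (cmod y) * u \<in> U" "of_real (cmod y) * (u * z) \<in> U"
      using T_in [of u s] T_in [of "u * z" s] u *(7) s by (auto simp: norm_mult)
    have ne: "u \<noteq> u * z" using u(1) *(9) by auto
    have "d (of_real (cmod x) * u) (of_real (cmod x) * (u * z)) < d (of_real (cmod y) * u) (of_real (cmod y) * (u * z))"
      by (rule scale_mono) (use * u ne yu in \<open>auto simp: norm_mult\<close>)
    also have "\<dots> = d y (y * z')"
    proof (subst chord_dist [OF yu *(4,6)])
      have "of_real (cmod y) * u - of_real (cmod y) * (u * z) = of_real (cmod y) * u * (1 - z)" "y - y * z' = y * (1 - z')"
        by (simp_all add: algebra_simps)
      then show "cmod (of_real (cmod y) * u - of_real (cmod y) * (u * z)) = cmod (y - y * z')"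
        using u *(11) by (simp add: norm_mult)
    qed (use u *(7,8) in \<open>auto simp: norm_mult\<close>)
    also have "\<dots> = d x (x * z)" using *(12) by simp
    also have "d x (x * z) = d (of_real (cmod x) * u) (of_real (cmod x) * (u * z))"
      unfolding mult.assoc [symmetric] u(2) [symmetric] ..
    finally show False by simp
  qed
  have s': "d a (a * w) = d b (b * w')" using side w(3) [of 1] w'(3) [of 1] by (simp add: a_def b_def)
  have aU: "a \<in> U" "b \<in> U" "a * w \<in> U" "b * w' \<in> U"
    using uU [of 0] vU [of 0] uU [of 1] vU [of 1] w(3) [of 1] w'(3) [of 1] by (simp_all add: a_def b_def)
  have nab: "cmod a = cmod b"
  proof (rule linorder_cases [of "cmod a" "cmod b"])
    assume "cmod a < cmod b"
    then show ?thesis using less [of a b w w'] aU n1 w_ne w_ne' eqn s' w(2) by (simp add: a_def)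
  next
    assume "cmod b < cmod a"
    then show ?thesis using less [of b a w' w] aU n1 w_ne w_ne' eqn s' w'(2) by (simp add: b_def)
  qed
  show ?thesis
  proof (subst chord_dist [OF uU uU vU vU])
    have "corner us i - corner us (i + 2) = corner us i * (1 - w\<^sup>2)"
      using w(3) [of i] w(3) [of "i + 2"] by (simp add: power_add power2_eq_square algebra_simps)
    moreover have "corner vs j - corner vs (j + 2) = corner vs j * (1 - w'\<^sup>2)"
      using w'(3) [of j] w'(3) [of "j + 2"] by (simp add: power_add power2_eq_square algebra_simps)
    ultimately show "cmod (corner us i - corner us (i + 2)) = cmod (corner vs j - corner vs (j + 2))"
      using eqn nab by (simp only: norm_mult nu nv)
  qed (simp_all only: nu nv nab)
qed

lemma regular_diagonal:
  assumes r: "regular_polygon U d us" "regular_polygon U d vs" "length us = length vs"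
    and side: "d (corner us 0) (corner us 1) = d (corner vs 0) (corner vs 1)"
  shows "d (corner us i) (corner us (i + 2)) = d (corner vs j) (corner vs (j + 2))"
proof -
  obtain c c' where c: "is_centre U d us c" "is_centre U d vs c'" using centre_exists r by blast
  obtain h where h: "isom U d U d h" "regular_polygon U d (map h us)" "is_centre U d (map h us) 0"
    using centred_copy [OF r(1) c(1)] by metis
  obtain g where g: "isom U d U d g" "regular_polygon U d (map g vs)" "is_centre U d (map g vs) 0"
    using centred_copy [OF r(2) c(2)] by metis
  interpret H: isom U d U d h by (rule h)
  interpret G: isom U d U d g by (rule g)
  note ne = cp_ne [OF regular_cp [OF r(1)]] cp_ne [OF regular_cp [OF r(2)]]
  have hu: "d (corner (map h us) k) (corner (map h us) l) = d (corner us k) (corner us l)" for k l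
    unfolding corner_map [OF ne(1)] by (rule H.iso) (use cp_corner_in regular_cp r in blast)+
  have gv: "d (corner (map g vs) k) (corner (map g vs) l) = d (corner vs k) (corner vs l)" for k l
    unfolding corner_map [OF ne(2)] by (rule G.iso) (use cp_corner_in regular_cp r in blast)+
  show ?thesis
    using regular_diagonal0 [OF h(2) g(2) _ h(3) g(3), of i j] r(3) side unfolding hu gv by simp
qed

lemma edge_length:
  assumes "regular_polygon U d vs" "edge vs a b" "edge vs a' b'" shows "d a b = d a' b'"
proof -
  have "d a b = d (corner vs 0) (corner vs 1)" if "edge vs a b" for a b
    using that regular_side [OF assms(1), of _ 0] d_sym unfolding edge_def by auto
  then show ?thesis using assms by metis
qed

text \<open>Equality of interior angles, expressed by the distance between the two neighbours of a
  corner.\<close>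

lemma wedge_congruent:
  assumes r: "regular_polygon U d us" "regular_polygon U d vs" "length us = length vs"
    and w: "wedge us a y b" "wedge vs a' y' b'" and s: "d y a = d y' a'"
  shows "d a b = d a' b'"
proof -
  have "d (corner us 0) (corner us 1) = d y a"
    by (rule edge_length [OF r(1) _ wedge_edge(1) [OF w(1)]]) (use edge_corner [of us 0] in simp)
  moreover have "d (corner vs 0) (corner vs 1) = d y' a'"
    by (rule edge_length [OF r(2) _ wedge_edge(1) [OF w(2)]]) (use edge_corner [of vs 0] in simp)
  ultimately have "d (corner us 0) (corner us 1) = d (corner vs 0) (corner vs 1)" using s by simp
  then have "d (corner us i) (corner us (i + 2)) = d (corner vs j) (corner vs (j + 2))" for i j
    by (rule regular_diagonal [OF r])
  then show ?thesis using w d_sym unfolding wedge_def by metis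
qed

end

subsection \<open>Faces of the tessellation\<close>

text \<open>Start at the midpoint \<open>p\<close> of the base and move slightly towards
  \<open>x\<close>. Since \<open>x - p\<close> is a positive multiple of \<open>y - p\<close> plus a
  multiple of \<open>b - a\<close>, a short step stays in both triangles.\<close>

lemma triangles_overlap:
  assumes "0 < orient a b x * orient a b y"
  shows "\<exists>z. z \<in> convex hull {a, b, x} \<and> z \<in> convex hull {a, b, y} \<and> orient a b z \<noteq> 0"
proof -
  define p where "p = (1/2) *\<^sub>R a + (1/2) *\<^sub>R b"
  define Q where "Q = orient a b x / orient a b y"
  have nz: "orient a b x \<noteq> 0" "orient a b y \<noteq> 0" and Q: "Q > 0"
    using assms by (auto simp: Q_def zero_less_mult_iff zero_less_divide_iff)
  have ab: "a \<noteq> b" using nz by (auto simp: orient_def)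
  define v where "v = (x - p) - Q *\<^sub>R (y - p)"
  have op: "orient a b p = 0" using orient_affine [of a b "1/2" a b] by (simp add: p_def)
  have lin: "Im (cnj (b - a) * (q - p)) = orient a b q" for q
    using op by (simp add: orient_def algebra_simps)
  have "orient a b (a + v) = Im (cnj (b - a) * (x - p)) - Q * Im (cnj (b - a) * (y - p))"
    by (simp add: orient_def v_def algebra_simps)
  also have "\<dots> = 0" using nz by (simp only: lin) (simp add: Q_def)
  finally obtain t where "a + v = (1 - t) *\<^sub>R a + t *\<^sub>R b" using ab orient_zeroD by metis
  then have t: "v = t *\<^sub>R (b - a)" by (simp add: algebra_simps)
  \<comment> \<open>Small enough that the weights \<open>(1 - e * Q) / 2 - e * t\<close> and
    \<open>(1 - e * Q) / 2 + e * t\<close> over \<open>a\<close> and \<open>b\<close> in the second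
    triangle stay nonnegative for either sign of \<open>t\<close>.\<close>
  define e where "e = 1 / (2 * (1 + Q + 2 * \<bar>t\<bar>))"
  have D: "1 + Q + 2 * \<bar>t\<bar> > 0" using Q by linarith
  have e: "0 < e" using D by (simp add: e_def)
  have bound: "e * (1 + Q + 2 * \<bar>t\<bar>) = 1 / 2" using D by (simp add: e_def)
  have e1: "e \<le> 1 / 2" "e * Q \<le> 1 / 2" "e * (2 * \<bar>t\<bar>) \<le> 1 / 2 - e - e * Q"
  proof -
    have "e + e * Q + 2 * (e * \<bar>t\<bar>) = 1 / 2" using bound by (simp only: distrib_left mult_1_right mult.left_commute)
    moreover have "0 \<le> e * Q" "0 \<le> e * \<bar>t\<bar>" using e Q by auto
    moreover have "e * (2 * \<bar>t\<bar>) = 2 * (e * \<bar>t\<bar>)" by simp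
    ultimately show "e \<le> 1 / 2" "e * Q \<le> 1 / 2" "e * (2 * \<bar>t\<bar>) \<le> 1 / 2 - e - e * Q" using e by linarith+
  qed
  have et: "\<bar>e * t\<bar> \<le> (1 - e * Q) / 2"
    using e1 e by (simp add: abs_mult)
  define z where "z = p + e *\<^sub>R (x - p)"
  have hull3: "l *\<^sub>R a + k *\<^sub>R b + c *\<^sub>R q \<in> convex hull {a, b, q}" if "0 \<le> l" "0 \<le> k" "0 \<le> c" "l + k + c = 1" for l k c q
    unfolding convex_hull_3 using that by blast
  have zx: "z = ((1 - e) / 2) *\<^sub>R a + ((1 - e) / 2) *\<^sub>R b + e *\<^sub>R x"
    by (simp add: z_def p_def complex_eq_iff field_simps)
  have "x - p = t *\<^sub>R (b - a) + Q *\<^sub>R (y - p)" using t by (simp add: v_def algebra_simps)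
  then have "z = p + e *\<^sub>R (t *\<^sub>R (b - a) + Q *\<^sub>R (y - p))" by (simp add: z_def)
  then have zy: "z = ((1 - e * Q) / 2 - e * t) *\<^sub>R a + ((1 - e * Q) / 2 + e * t) *\<^sub>R b + (e * Q) *\<^sub>R y"
    by (simp add: p_def complex_eq_iff field_simps)
  have "z \<in> convex hull {a, b, x}" unfolding zx using e e1 by (intro hull3) (auto simp: field_simps)
  moreover have "z \<in> convex hull {a, b, y}" unfolding zy using e e1 et Q by (intro hull3) (auto simp: field_simps abs_le_iff)
  moreover have "orient a b z = e * orient a b x"
  proof -
    have "z = (1 - e) *\<^sub>R p + e *\<^sub>R x" by (simp add: z_def algebra_simps)
    then show ?thesis using orient_affine [of a b e p x] op by simp
  qed
  ultimately show ?thesis using e nz by auto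
qed

section \<open>Directions around a vertex or centre as roots of unity\<close>

lemma arc_combination:
  assumes "0 < \<theta>" "\<theta> < pi"
  shows "cis \<phi> = of_real (sin (\<theta> - \<phi>) / sin \<theta>) + of_real (sin \<phi> / sin \<theta>) * cis \<theta>"
proof -
  have "sin \<theta> > 0" using assms by (rule sin_gt_zero)
  then show ?thesis by (simp add: complex_eq_iff sin_diff field_simps)
qed

text \<open>A point on the open arc from 1 to \<open>w\<close> is a positive combination of the two
  (\<open>arc_combination\<close>), so \<open>nc\<close> keeps all powers off that arc and
  \<open>arc_closing\<close> applies. \<open>N\<close> is identified with the vertex degree only
  later, by counting faces.\<close>

lemma fan_root:
  assumes w: "cmod w = 1" "Im w \<noteq> 0"
    and nc: "\<And>k l m. 0 < l \<Longrightarrow> 0 < m \<Longrightarrow> w ^ k \<noteq> of_real l + of_real m * w"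
  shows "\<exists>N::nat. (3::nat) \<le> N \<and> (w = cis (2 * pi / N) \<or> w = cis (- (2 * pi / N)))"
proof -
  have main: "\<exists>N::nat. (3::nat) \<le> N \<and> w = cis (2 * pi / N)"
    if w: "cmod w = 1" "Im w > 0" and nc: "\<And>k l m. 0 < l \<Longrightarrow> 0 < m \<Longrightarrow> w ^ k \<noteq> of_real l + of_real m * w" for w
  proof -
    define \<theta> where "\<theta> = Arg w"
    have w\<theta>: "w = cis \<theta>" using w cis_Arg [of w] by (cases "w = 0") (auto simp: \<theta>_def sgn_eq)
    have \<theta>: "0 < \<theta>" "\<theta> < pi" using Arg_lt_pi [of w] w(2) by (auto simp: \<theta>_def)
    have "cis \<theta> ^ k \<noteq> cis \<phi>" if \<phi>: "0 < \<phi>" "\<phi> < \<theta>" for k \<phi>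
    proof -
      have "0 < sin (\<theta> - \<phi>) / sin \<theta>" "0 < sin \<phi> / sin \<theta>"
        using \<phi> \<theta> by (auto intro!: divide_pos_pos sin_gt_zero)
      then show ?thesis using nc [of _ _ k] arc_combination [OF \<theta>, of \<phi>] w\<theta> by metis
    qed
    then obtain N :: nat where N: "3 \<le> N" "real N * \<theta> = 2 * pi" using arc_closing [OF \<theta>] by blast
    then have "\<theta> = 2 * pi / N" by (simp add: field_simps)
    then show ?thesis using N w\<theta> by blast
  qed
  show ?thesis
  proof (cases "Im w > 0")
    case True then show ?thesis using main [of w] w nc by blast
  next
    case False
    have "\<exists>N::nat. (3::nat) \<le> N \<and> cnj w = cis (2 * pi / N)"
    proof (rule main)
      show "cmod (cnj w) = 1" "Im (cnj w) > 0" using w False by auto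
      show "cnj w ^ k \<noteq> of_real l + of_real m * cnj w" if "0 < l" "0 < m" for k l m
      proof
        assume "cnj w ^ k = of_real l + of_real m * cnj w"
        then have "cnj (cnj w ^ k) = cnj (of_real l + of_real m * cnj w)" by simp
        then show False using nc [OF that, of k] by simp
      qed
    qed
    then obtain N :: nat where N: "3 \<le> N" "cnj w = cis (2 * pi / N)" by blast
    have "w = cnj (cis (2 * pi / N))" using N(2) by (metis complex_cnj_cnj)
    then show ?thesis using N(1) by (auto simp: cis_cnj)
  qed
qed

text \<open>The sign of the turn is left open because neither corner lists nor fans of edges come
  with a direction.\<close>

definition root_pair :: "nat \<Rightarrow> complex \<Rightarrow> bool" where
  "root_pair N w \<longleftrightarrow> 3 \<le> N \<and> (w = cis (2 * pi / N) \<or> w = cis (- (2 * pi / N)))"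

text \<open>The sectors between consecutive powers cover the plane; for positive turn
  \<open>k\<close> is the integer part of the argument of \<open>z\<close> over
  \<open>2 * pi / N\<close>. In \<open>fan\<close> this matches an arbitrary face at the vertex with
  one already known.\<close>

lemma root_pair_sector:
  assumes "root_pair N w"
  shows "\<exists>k<N. \<exists>l m. 0 \<le> l \<and> 0 \<le> m \<and> z = (of_real l + of_real m * w) * w ^ k"
proof -
  have N: "3 \<le> N" using assms by (simp add: root_pair_def)
  define \<theta> where "\<theta> = 2 * pi / N"
  have \<theta>: "0 < \<theta>" "\<theta> < pi" using N by (auto simp: \<theta>_def field_simps)
  have main: "\<exists>k<N. \<exists>l m. 0 \<le> l \<and> 0 \<le> m \<and> z = (of_real l + of_real m * cis \<theta>) * cis \<theta> ^ k" for z
  proof -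
    define \<phi> where "\<phi> = Arg2pi z"
    have \<phi>: "0 \<le> \<phi>" "\<phi> < 2 * pi" using Arg2pi [of z] by (auto simp: \<phi>_def)
    have z: "z = of_real (cmod z) * cis \<phi>" using Arg2pi [of z] by (simp add: \<phi>_def cis_conv_exp is_Arg_def)
    define k where "k = nat \<lfloor>\<phi> / \<theta>\<rfloor>"
    have "0 \<le> \<phi> / \<theta>" using \<phi> \<theta> by simp
    then have rk: "real k = of_int \<lfloor>\<phi> / \<theta>\<rfloor>" by (simp add: k_def)
    have "real k \<le> \<phi> / \<theta>" "\<phi> / \<theta> < real k + 1" unfolding rk by linarith+
    then have b: "real k * \<theta> \<le> \<phi>" "\<phi> < real k * \<theta> + \<theta>" using \<theta> by (auto simp: field_simps)
    have "real k * \<theta> < real N * \<theta>" using b \<phi> N by (simp add: \<theta>_def)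
    then have kN: "k < N" using \<theta> by simp
    define \<psi> where "\<psi> = \<phi> - real k * \<theta>"
    have \<psi>: "0 \<le> \<psi>" "\<psi> < \<theta>" using b by (auto simp: \<psi>_def)
    define l m where "l = sin (\<theta> - \<psi>) / sin \<theta>" and "m = sin \<psi> / sin \<theta>"
    have lm: "0 \<le> l" "0 \<le> m" using \<psi> \<theta> by (auto simp: l_def m_def intro!: divide_nonneg_nonneg sin_ge_zero)
    have "cis \<phi> = cis \<psi> * cis \<theta> ^ k" by (simp add: \<psi>_def Complex.DeMoivre cis_mult)
    also have "cis \<psi> = of_real l + of_real m * cis \<theta>" unfolding l_def m_def by (rule arc_combination [OF \<theta>])
    finally have "z = (of_real (cmod z * l) + of_real (cmod z * m) * cis \<theta>) * cis \<theta> ^ k"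
      using z by (simp add: algebra_simps)
    then show ?thesis using kN lm by (meson mult_nonneg_nonneg norm_ge_zero)
  qed
  show ?thesis
  proof (cases "w = cis \<theta>")
    case True then show ?thesis using main [of z] by simp
  next
    case False
    then have w: "w = cnj (cis \<theta>)" using assms by (auto simp: root_pair_def \<theta>_def cis_cnj)
    obtain k l m where k: "k < N" "0 \<le> l" "0 \<le> m" "cnj z = (of_real l + of_real m * cis \<theta>) * cis \<theta> ^ k"
      using main [of "cnj z"] by blast
    have "z = cnj ((of_real l + of_real m * cis \<theta>) * cis \<theta> ^ k)" using k(4) by (metis complex_cnj_cnj)
    then have "z = (of_real l + of_real m * w) * w ^ k" by (simp add: w)
    then show ?thesis using k by blast
  qed
qed

lemma root_pair_inj:
  assumes r: "root_pair N w" and jk: "j < N" "k < N" "w ^ j = w ^ k" shows "j = k"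
proof -
  have main: False if "j < k" "k < N" "w ^ j = w ^ k" for j k
  proof -
    have w0: "w \<noteq> 0" using r by (auto simp: root_pair_def)
    have "w ^ k = w ^ j * w ^ (k - j)" using power_add [of w j "k - j"] that(1) by simp
    then have one: "w ^ (k - j) = 1" using that w0 by simp
    have "cos (real (k - j) * (2 * pi / N)) = 1"
    proof -
      have "Re (w ^ (k - j)) = cos (real (k - j) * (2 * pi / N))"
        using r unfolding root_pair_def by (auto simp: Complex.DeMoivre)
      then show ?thesis using one by simp
    qed
    then obtain i :: int where i: "real (k - j) * (2 * pi / N) = of_int i * (2 * pi)" by (auto simp: cos_one_2pi_int)
    have N: "real N > 0" using r by (simp add: root_pair_def)
    have "real (k - j) = of_int i * real N" using i N by (simp add: field_simps)
    moreover have "0 < real (k - j)" "real (k - j) < real N" using that by auto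
    ultimately have "0 < of_int i * real N" "of_int i * real N < 1 * real N" by auto
    then have "0 < real_of_int i" "real_of_int i < 1" using N by (auto simp: zero_less_mult_iff)
    then have "0 < i" "i < 1" by simp_all
    then show False by linarith
  qed
  show ?thesis using main [of j k] main [of k j] jk by (metis linorder_neqE_nat)
qed

lemma root_pair_power:
  assumes "root_pair N w"
  obtains "w ^ k = cis (real k * (2 * pi / N))" | "w ^ k = cnj (cis (real k * (2 * pi / N)))"
proof -
  have "w = cis (2 * pi / N) \<or> w = cnj (cis (2 * pi / N))" using assms by (auto simp: root_pair_def cis_cnj)
  then have "w ^ k = cis (2 * pi / N) ^ k \<or> w ^ k = cnj (cis (2 * pi / N) ^ k)" by auto
  then show ?thesis using that unfolding Complex.DeMoivre by blast
qed

lemma root_pair_one: assumes "root_pair N w" shows "w ^ N = 1"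
proof -
  have "real N * (2 * pi / N) = 2 * pi" using assms by (simp add: root_pair_def)
  then show ?thesis by (metis root_pair_power [OF assms] cis_2pi complex_cnj_one)
qed

lemma root_pair_even: assumes "root_pair N w" "even N" shows "w ^ (N div 2) = - 1"
proof -
  have "real (N div 2) * (2 * pi / N) = pi" using assms by (auto simp: root_pair_def elim!: evenE)
  then show ?thesis by (metis root_pair_power [OF assms(1)] cis_pi complex_cnj_one complex_cnj_minus)
qed

text \<open>For odd \<open>N\<close> the ray opposite to 1 bisects the sector between the powers
  \<open>N div 2\<close> and \<open>N div 2 + 1\<close>; \<open>1 + w\<close> is the bisecting
  direction of the first sector. Here \<open>r = 2 * cos (pi / N)\<close>.\<close>

lemma root_pair_odd:
  assumes "root_pair N w" "odd N"
  obtains r where "r > 0" "w ^ (N div 2) * (1 + w) = - of_real r"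
proof -
  define h where "h = N div 2"
  have N: "N = 2 * h + 1" "3 \<le> N" using assms by (auto simp: h_def root_pair_def)
  define \<theta> where "\<theta> = 2 * pi / N"
  have "real h * \<theta> = pi - \<theta> / 2" by (simp add: \<theta>_def N(1) field_simps)
  then have h: "real h * \<theta> = pi - \<theta> / 2" "real h * \<theta> + \<theta> = pi + \<theta> / 2" by simp_all
  have sum: "cis \<theta> ^ h * (1 + cis \<theta>) = - of_real (2 * cos (\<theta> / 2))"
  proof -
    have "cis \<theta> ^ h * (1 + cis \<theta>) = cis (real h * \<theta>) + cis (real h * \<theta> + \<theta>)"
      by (simp add: Complex.DeMoivre algebra_simps cis_mult)
    then show ?thesis unfolding h by (simp add: complex_eq_iff cos_add sin_add cos_diff sin_diff)
  qed
  have "0 < \<theta>" "\<theta> < pi" using N(2) by (auto simp: \<theta>_def field_simps)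
  then have pos: "2 * cos (\<theta> / 2) > 0" by (simp add: cos_gt_zero_pi)
  have "w = cis \<theta> \<or> w = cnj (cis \<theta>)" using assms by (auto simp: root_pair_def \<theta>_def cis_cnj)
  then have "w ^ h * (1 + w) = - of_real (2 * cos (\<theta> / 2))"
  proof
    assume "w = cis \<theta>" then show ?thesis using sum by simp
  next
    assume "w = cnj (cis \<theta>)"
    then have "w ^ h * (1 + w) = cnj (cis \<theta> ^ h * (1 + cis \<theta>))" by simp
    also have "\<dots> = - of_real (2 * cos (\<theta> / 2))" unfolding sum by simp
    finally show ?thesis .
  qed
  then show ?thesis using that [OF pos] by (simp add: h_def)
qed

text \<open>Conversely, behind the bisector of the first sector lies a power of \<open>w\<close>.
  The exponents \<open>N div 2\<close> and \<open>N div 2 + 1\<close> add up to \<open>N\<close>, so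
  this is \<open>root_pair_odd\<close> multiplied through.\<close>

lemma root_pair_odd_shift:
  assumes "root_pair N w" "odd N"
  obtains r where "r > 0" "1 + w = - of_real r * w ^ (N div 2 + 1)"
proof -
  obtain r where r: "r > 0" "w ^ (N div 2) * (1 + w) = - of_real r" using root_pair_odd [OF assms] by metis
  have "N = N div 2 + (N div 2 + 1)" using assms(2) by presburger
  then have "w ^ (N div 2) * w ^ (N div 2 + 1) = 1" using root_pair_one [OF assms(1)] by (metis power_add)
  then have "1 + w = (w ^ (N div 2) * (1 + w)) * w ^ (N div 2 + 1)" by (metis mult.assoc mult.commute mult_1)
  then show ?thesis using that r by metis
qed

lemma zero_in_segment:
  fixes x y z :: complex
  assumes "x = of_real s * z" "y = of_real t * z" "s * t < 0"
  shows "0 \<in> closed_segment x y"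
proof -
  have st: "s \<noteq> t" and pm: "0 < s \<and> t < 0 \<or> s < 0 \<and> 0 < t" using assms(3) by (auto simp: mult_less_0_iff)
  define u where "u = s / (s - t)"
  have u: "0 \<le> u" "u \<le> 1" using pm by (auto simp: u_def divide_le_eq le_divide_eq zero_le_divide_iff)
  have "(1 - u) * s + u * t = 0" using st by (simp add: u_def field_simps)
  moreover have "(1 - u) *\<^sub>R x + u *\<^sub>R y = of_real ((1 - u) * s + u * t) * z"
    unfolding assms(1,2) by (simp add: scaleR_conv_of_real algebra_simps)
  ultimately have "0 = (1 - u) *\<^sub>R x + u *\<^sub>R y" by simp
  then show ?thesis using u unfolding closed_segment_def by blast
qed

text \<open>
  The label of the geometric point following one labelled \<open>l\<close> that was reached from one labelled \<open>k\<close>.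
\<close>

definition next_label :: "nat \<Rightarrow> nat \<Rightarrow> nat \<Rightarrow> nat \<Rightarrow> nat" where
  "next_label m n k l = (if l = 1 \<or> l = 0 \<and> even n \<or> l = 2 \<and> even m then k else 3 - k - l)"

lemma strict_mono_int_step:
  fixes t :: "int \<Rightarrow> real"
  assumes "\<And>i. t i < t (i + 1)" shows "strict_mono t"
proof (rule strict_monoI)
  fix i j :: int assume "i < j"
  have "t i < t (i + 1 + int k)" for k
  proof (induction k)
    case (Suc k)
    have "t (i + 1 + int k) < t (i + 1 + int k + 1)" by (rule assms)
    then show ?case using Suc by (simp add: add.assoc add.commute add.left_commute)
  qed (use assms in simp)
  from this [of "nat (j - i - 1)"] show "t i < t j" using \<open>i < j\<close> by simp
qed

lemma int_bracket:
  fixes t :: "int \<Rightarrow> real"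
  assumes "t i1 \<le> s" "s < t i2" "strict_mono t"
  shows "\<exists>i. t i \<le> s \<and> s < t (i + 1)"
proof (rule ccontr)
  assume n: "\<not> ?thesis"
  have "t (i1 + int k) \<le> s" for k
  proof (induction k)
    case (Suc k)
    then have "t (i1 + int k + 1) \<le> s" using n by (meson not_le)
    then show ?case by (simp add: add.assoc add.commute add.left_commute)
  qed (use assms in simp)
  moreover have "i1 \<le> i2" using assms by (meson le_less_trans not_le order_less_imp_le strict_mono_less_eq less_imp_le)
  ultimately have "t i2 \<le> s" by (metis add_diff_cancel_left' zle_iff_zadd)
  then show False using assms by simp
qed

section \<open>Midpoints, centres and the geometric points of a single face\<close>

context model_plane
begin

lemma midpoint_sym: "is_midpoint U d a b x \<longleftrightarrow> is_midpoint U d b a x"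
  unfolding is_midpoint_def using d_sym [of a x] d_sym [of x b] d_sym [of a b] by auto

lemma midpoint_open_segment:
  assumes "a \<in> U" "b \<in> U" "a \<noteq> b" "is_midpoint U d a b x"
  shows "x \<in> open_segment a b"
proof -
  have x: "x \<in> U" "d a x = d a b / 2" "d x b = d a b / 2" using assms(4) by (auto simp: is_midpoint_def)
  have "d a b > 0" using d_nonneg [OF assms(1,2)] d_zero [OF assms(1,2)] assms(3) by linarith
  then have "x \<noteq> a" "x \<noteq> b" using x d_zero [OF assms(1) x(1)] d_zero [OF x(1) assms(2)] by auto
  moreover have "x \<in> seg U d a b" using x by (simp add: seg_def)
  ultimately show ?thesis using seg_eq [OF assms(1,2)] by (simp add: open_segment_def)
qed

text \<open>Both points are on the segment at the same distance from \<open>a\<close>. The one with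
  smaller parameter lies between \<open>a\<close> and the other, and additivity of \<open>d\<close>
  leaves distance 0 between them.\<close>

lemma midpoint_unique:
  assumes ab: "a \<in> U" "b \<in> U" and x: "is_midpoint U d a b x" and y: "is_midpoint U d a b y"
  shows "x = y"
proof -
  have xy: "x \<in> U" "y \<in> U" "d a x = d a y" using x y by (auto simp: is_midpoint_def)
  have "x \<in> seg U d a b" "y \<in> seg U d a b"
    using x y by (auto simp: is_midpoint_def seg_def)
  then obtain t s where t: "0 \<le> t" "t \<le> 1" "x = (1 - t) *\<^sub>R a + t *\<^sub>R b" and s: "0 \<le> s" "s \<le> 1" "y = (1 - s) *\<^sub>R a + s *\<^sub>R b"
    unfolding seg_eq [OF ab] by (auto simp: closed_segment_def)
  have mem: "(1 - t) *\<^sub>R a + t *\<^sub>R b \<in> closed_segment a ((1 - s) *\<^sub>R a + s *\<^sub>R b)" if "0 \<le> t" "t \<le> s" for s t :: real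
  proof (cases "s = 0")
    case False
    have "(1 - t) *\<^sub>R a + t *\<^sub>R b = (1 - t / s) *\<^sub>R a + (t / s) *\<^sub>R ((1 - s) *\<^sub>R a + s *\<^sub>R b)"
      using False by (simp add: complex_eq_iff field_simps)
    moreover have "0 \<le> t / s" "t / s \<le> 1" using that False by (auto simp: divide_le_eq)
    ultimately show ?thesis unfolding closed_segment_def by blast
  qed (use that in auto)
  have "x \<in> closed_segment a y \<or> y \<in> closed_segment a x"
    using mem [of t s] mem [of s t] t s by (cases "t \<le> s") auto
  then have "x \<in> seg U d a y \<or> y \<in> seg U d a x" using seg_eq ab xy by blast
  then have "d x y = 0" using xy(3) d_sym [of x y] by (auto simp: seg_def)
  then show ?thesis using d_zero xy by simp
qed

text \<open>With \<open>a\<close> at the origin, halve the polar coordinate: the midpoint has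
  modulus \<open>T (r / 2)\<close> up to sign, which in the Klein disc is not half the modulus of
  the far end unless both are 0.\<close>

lemma midpoint_exists:
  assumes ab: "a \<in> U" "b \<in> U" shows "\<exists>x. is_midpoint U d a b x"
proof -
  obtain h where h: "isom U d U d h" "h a = 0" using homogeneous [OF ab(1)] by blast
  interpret isom U d U d h by (rule h)
  define z where "z = h b"
  have zU: "z \<in> U" using ab by (simp add: z_def)
  obtain r where r: "T r = cmod z" using T_surj [OF zU] by blast
  define u where "u = (if z = 0 then 1 else sgn z)"
  have u: "cmod u = 1" "z = of_real (T r) * u" by (auto simp: u_def r sgn_eq norm_divide)
  define y where "y = of_real (T (r / 2)) * u"
  have yU: "y \<in> U" unfolding y_def by (rule T_in [OF u(1)])
  have z0: "0 = of_real (T 0) * u" using T_zero by simp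
  have "d 0 y = \<bar>r\<bar> / 2" "d y z = \<bar>r\<bar> / 2" "d 0 z = \<bar>r\<bar>"
    unfolding y_def u(2) using T_dist [OF u(1), of 0 "r/2"] T_dist [OF u(1), of "r/2" r] T_dist [OF u(1), of 0 r] z0 by (auto simp: abs_if)
  then have "is_midpoint U d 0 z y" using yU by (simp add: is_midpoint_def)
  then have "is_midpoint U d (h a) (h b) (h (inv_into U h y))" using h(2) yU by (simp add: z_def)
  then show ?thesis using midpoint_iff [OF ab inv_in [OF yU]] by auto
qed

text \<open>Labels are compared face by face; \<open>own_transfer\<close> shows that the face
  through which a point is viewed does not matter.\<close>

definition own_point :: "complex list \<Rightarrow> nat \<Rightarrow> complex \<Rightarrow> bool" where
  "own_point vs k x \<longleftrightarrow> k = 0 \<and> x \<in> set vs \<or> k = 1 \<and> (\<exists>a b. edge vs a b \<and> is_midpoint U d a b x) \<or>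
     k = 2 \<and> is_centre U d vs x"

lemma third_corner:
  assumes "convex_polygon U d vs" "edge vs a b" obtains x where "x \<in> set vs" "x \<noteq> a" "x \<noteq> b"
proof -
  obtain p where w: "wedge vs p a b" using edge_wedge [OF cp_ne [OF assms(1)] assms(2)] by blast
  have "p \<in> set vs" using edge_in [OF assms(1) wedge_edge(1) [OF w]] by simp
  then show ?thesis using that [of p] wedge_neq [OF assms(1) w] by simp
qed

lemma centre_not_on_side:
  assumes r: "regular_polygon U d vs" and c: "is_centre U d vs c" and e: "edge vs a b"
  shows "c \<notin> closed_segment a b"
proof
  assume "c \<in> closed_segment a b"
  then have "orient a b c = 0" by (rule orient_on_segment)
  moreover obtain x where "x \<in> set vs" "x \<noteq> a" "x \<noteq> b" using third_corner [OF regular_cp [OF r] e] .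
  ultimately show False using centre_inside(2) [OF r c e, of x] by simp
qed

text \<open>Corners are extreme, midpoints lie strictly inside a side, and the centre lies on no
  side.\<close>

lemma own_disjoint:
  assumes r: "regular_polygon U d vs" and k: "own_point vs k x" and l: "own_point vs l x"
  shows "k = l"
proof -
  note cp = regular_cp [OF r]
  have A: False if "x \<in> set vs" "edge vs a b" "is_midpoint U d a b x" for a b
  proof -
    have ab: "a \<in> set vs" "b \<in> set vs" "a \<noteq> b" using edge_in [OF cp that(2)] by auto
    then have "x \<in> open_segment a b" using midpoint_open_segment that(3) cp_sub [OF cp] by blast
    then have "x \<in> closed_segment a b" "x \<noteq> a" "x \<noteq> b" by (auto simp: open_segment_def)
    then show False using corner_extreme [OF cp that(1)] corner_in_region [OF cp] ab by blast
  qed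
  have B: False if xv: "x \<in> set vs" "is_centre U d vs x"
  proof -
    obtain a b where "wedge vs a x b" using in_set_wedge [OF xv(1)] by blast
    then have "edge vs x a" by (rule wedge_edge)
    then show False using centre_not_on_side [OF r xv(2)] by fastforce
  qed
  have C: False if "is_centre U d vs x" "edge vs a b" "is_midpoint U d a b x" for a b
  proof -
    have ab: "a \<in> set vs" "b \<in> set vs" "a \<noteq> b" using edge_in [OF cp that(2)] by auto
    then have "x \<in> open_segment a b" using midpoint_open_segment that(3) cp_sub [OF cp] by blast
    then show False using centre_not_on_side [OF r that(1,2)] by (auto simp: open_segment_def)
  qed
  show ?thesis using k l A B C unfolding own_point_def by metis
qed

lemma own_in_region:
  assumes r: "regular_polygon U d vs" and k: "own_point vs k x" shows "x \<in> region U d vs"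
proof -
  note cp = regular_cp [OF r]
  have "x \<in> region U d vs" if "edge vs a b" "is_midpoint U d a b x" for a b
  proof -
    have ab: "a \<in> set vs" "b \<in> set vs" "a \<noteq> b" using edge_in [OF cp that(1)] by auto
    then have "x \<in> open_segment a b" using midpoint_open_segment that(2) cp_sub [OF cp] by blast
    then show ?thesis using edge_in_region [OF cp that(1)] by (auto simp: open_segment_def)
  qed
  then show ?thesis using k corner_in_region [OF cp] centre_inside(1) [OF r] unfolding own_point_def by metis
qed

lemma card_corners: assumes cp: "convex_polygon U d vs" shows "card (set vs) = length vs"
proof (rule distinct_card)
  show "distinct vs"
    unfolding distinct_conv_nth
  proof (intro allI impI)
    fix i j assume "i < length vs" "j < length vs" "i \<noteq> j"
    then show "vs ! i \<noteq> vs ! j" using corner_eq_iff [OF cp, of i j] by (simp add: corner_def)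
  qed
qed

text \<open>The triangle is a function of the label, so that its six directed sides share one
  definition; the order of \<open>k\<close> and \<open>l\<close> is the direction of travel.\<close>

definition flag_side :: "complex set set \<Rightarrow> nat \<Rightarrow> nat \<Rightarrow> complex \<Rightarrow> complex \<Rightarrow> bool" where
  "flag_side F k l x y \<longleftrightarrow> k < 3 \<and> l < 3 \<and> k \<noteq> l \<and>
     (\<exists>v :: nat \<Rightarrow> complex. barycentric_triangle U d F (v 0) (v 1) (v 2) \<and> x = v k \<and> y = v l)"

lemma flag_side_sym: "flag_side F k l x y \<longleftrightarrow> flag_side F l k y x"
  by (auto simp: flag_side_def)

text \<open>The Euclidean midpoint is equally far from both ends in the Euclidean sense, hence by
  \<open>equidistant\<close> also for \<open>d\<close>, and it lies on the segment.\<close>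

lemma midpoint_equal_norm:
  assumes "a \<in> U" "b \<in> U" "cmod a = cmod b"
  shows "is_midpoint U d a b ((1/2) *\<^sub>R (a + b))"
proof -
  let ?p = "(1/2) *\<^sub>R (a + b)"
  have pc: "?p \<in> closed_segment a b"
    unfolding closed_segment_def by (auto intro!: exI [of _ "1/2"] simp: scaleR_add_right)
  then have pU: "?p \<in> U" using seg_in assms by blast
  have "?p - a = - (?p - b)" by (simp add: complex_eq_iff field_simps)
  then have "cmod (?p - a) = cmod (?p - b)" by (metis norm_minus_cancel)
  then have e: "d ?p a = d ?p b" using equidistant [OF pU assms] by simp
  have "?p \<in> seg U d a b" using pc seg_eq assms by simp
  then have "d a ?p + d ?p b = d a b" by (simp add: seg_def)
  then show ?thesis using pU e d_sym [of a ?p] by (simp add: is_midpoint_def)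
qed

lemma midpoint_from_zero:
  assumes "a \<in> U" "a \<noteq> 0" "is_midpoint U d 0 a x"
  obtains t where "t > 0" "x = of_real t * a"
proof -
  have "x \<in> open_segment 0 a" using midpoint_open_segment [OF zero_in assms(1) _ assms(3)] assms(2) by simp
  then obtain t where "0 < t" "x = t *\<^sub>R a" using assms(2) by (auto simp: in_segment)
  then show ?thesis using that by (simp add: scaleR_conv_of_real)
qed

text \<open>Being equidistant from \<open>a\<close> and \<open>a * w\<close>, the centre lies on the
  line through 0 bisecting their angle; being on the same side of \<open>0 a\<close> as the corner
  \<open>a * w\<close>, it is on the ray of \<open>a * (1 + w)\<close> and not on the opposite
  one.\<close>

lemma centre_direction:
  assumes r: "regular_polygon U d vs" and w: "wedge vs a 0 (a * w)" and w1: "cmod w = 1" and c: "is_centre U d vs c"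
  obtains t where "t > 0" "c = of_real t * (a * (1 + w))"
proof -
  note cp = regular_cp [OF r]
  have ea: "edge vs 0 a" and eb: "edge vs 0 (a * w)" using wedge_edge [OF w] by auto
  have ne: "a \<noteq> a * w" "a \<noteq> 0" "a * w \<noteq> 0" using wedge_neq [OF cp w] by auto
  have inV: "a \<in> set vs" "a * w \<in> set vs" using edge_in [OF cp ea] edge_in [OF cp eb] by auto
  then have aU: "a \<in> U" "a * w \<in> U" using cp_sub [OF cp] by auto
  have cU: "c \<in> U" using c by (simp add: is_centre_def)
  define z where "z = c / a"
  have cz: "c = a * z" using ne by (simp add: z_def)
  have "d c a = d c (a * w)" using c inV unfolding is_centre_def by blast
  then have "cmod (c - a) = cmod (c - a * w)" using equidistant [OF cU aU] w1 by (simp add: norm_mult)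
  moreover have "c - a = a * (z - 1)" "c - a * w = a * (z - w)" by (simp_all add: cz algebra_simps)
  ultimately have "cmod (z - 1) = cmod (z - w)" using ne by (simp add: norm_mult)
  then have "(cmod (z - 1))\<^sup>2 = (cmod (z - w))\<^sup>2" by simp
  moreover have w2: "(Re w)\<^sup>2 + (Im w)\<^sup>2 = 1" using w1 cmod_power2 [of w] by simp
  ultimately have e1: "Re z = Re z * Re w + Im z * Im w"
    unfolding cmod_power2 by (simp add: power2_diff)
  have "0 < orient 0 a c * orient 0 a (a * w)"
    using centre_inside(2) [OF r c ea inV(2)] ne by simp
  moreover have "orient 0 a c = (cmod a)\<^sup>2 * Im z" "orient 0 a (a * w) = (cmod a)\<^sup>2 * Im w"
  proof -
    have "cnj a * (a * q) = of_real ((cmod a)\<^sup>2) * q" for q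
      unfolding complex_norm_square by simp
    then have "Im (cnj a * (a * q)) = (cmod a)\<^sup>2 * Im q" for q by (metis Im_complex_of_real Re_complex_of_real times_complex.sel(2) add_0_right mult_zero_left)
    then show "orient 0 a c = (cmod a)\<^sup>2 * Im z" "orient 0 a (a * w) = (cmod a)\<^sup>2 * Im w" by (simp_all add: orient_def cz)
  qed
  ultimately have "0 < ((cmod a)\<^sup>2 * Im z) * ((cmod a)\<^sup>2 * Im w)" by simp
  then have "0 < ((cmod a)\<^sup>2 * (cmod a)\<^sup>2) * (Im z * Im w)" by (simp only: mult_ac)
  moreover have "0 < (cmod a)\<^sup>2 * (cmod a)\<^sup>2" using ne by simp
  ultimately have zw: "0 < Im z * Im w" using zero_less_mult_pos by blast
  then have iw: "Im w \<noteq> 0" by auto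
  define t where "t = Im z / Im w"
  have t: "t > 0" using zw by (auto simp: t_def zero_less_divide_iff zero_less_mult_iff)
  have rw: "1 - Re w \<noteq> 0" using w2 iw by auto
  have "(1 - Re w) * Re z = (1 - Re w) * (t * (1 + Re w))"
  proof -
    have "(1 - Re w) * (t * (1 + Re w)) = t * (1 - (Re w)\<^sup>2)" by (simp add: power2_eq_square algebra_simps)
    also have "\<dots> = t * (Im w)\<^sup>2" using w2 by (simp add: eq_diff_eq [symmetric])
    also have "\<dots> = Im z * Im w" using iw by (simp add: t_def power2_eq_square)
    finally show ?thesis using e1 by (simp add: algebra_simps)
  qed
  then have "Re z = t * (1 + Re w)" using rw by simp
  moreover have "Im z = t * Im w" using iw by (simp add: t_def)
  ultimately have "z = of_real t * (1 + w)" by (simp add: complex_eq_iff)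
  then have "c = of_real t * (a * (1 + w))" by (simp add: cz)
  then show ?thesis using that t by blast
qed

text \<open>With \<open>x\<close> at the origin the curve \<open>T s * u\<close> has unit speed by
  \<open>T_dist\<close>, and since \<open>T\<close> is odd, negative \<open>s\<close> give the other
  half of the line.\<close>

lemma geodesic_line:
  assumes xy: "x \<in> U" "y \<in> U" "x \<noteq> y"
  obtains \<gamma> :: "real \<Rightarrow> complex" and s where "\<And>a b. d (\<gamma> a) (\<gamma> b) = \<bar>a - b\<bar>"
    "range \<gamma> = line_through U d x y" "\<gamma> 0 = x" "\<gamma> s = y" "0 < s"
proof -
  obtain h where h: "isom U d U d h" "h x = 0" using homogeneous [OF xy(1)] by blast
  interpret H: isom U d U d h by (rule h)
  interpret I: isom U d U d "inv_into U h" by (rule H.inverse)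
  define z where "z = h y"
  have zU: "z \<in> U" using xy by (simp add: z_def)
  have z0: "z \<noteq> 0" using xy h(2) H.eq_iff [of y x] by (auto simp: z_def)
  define u where "u = sgn z"
  have u: "cmod u = 1" "z = of_real (cmod z) * u" using z0 by (auto simp: u_def sgn_eq norm_divide)
  define g where "g = (\<lambda>s. of_real (T s) * u)"
  have gU: "g s \<in> U" for s unfolding g_def by (rule T_in [OF u(1)])
  have rg: "range g = line_through U d 0 z"
    unfolding line_eq [OF zero_in zU z0 [symmetric]]
  proof
    show "range g \<subseteq> {x \<in> U. orient 0 z x = 0}"
    proof
      fix q assume "q \<in> range g"
      then obtain s where s: "q = g s" by blast
      have "cnj z * q = of_real (cmod z * T s) * (u * cnj u)" by (subst u(2)) (simp add: s g_def)
      then have "cnj z * q = of_real (cmod z * T s * (cmod u)\<^sup>2)" unfolding complex_norm_square [symmetric] by simp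
      then have "orient 0 z q = 0" by (simp only: orient_def diff_0_right Im_complex_of_real)
      then show "q \<in> {x \<in> U. orient 0 z x = 0}" using gU s by simp
    qed
    show "{x \<in> U. orient 0 z x = 0} \<subseteq> range g"
    proof
      fix q assume "q \<in> {x \<in> U. orient 0 z x = 0}"
      then have q: "q \<in> U" "orient 0 z q = 0" by auto
      obtain t where t: "q = t *\<^sub>R z" using orient_zeroD [OF q(2) z0 [symmetric]] by auto
      obtain r where r: "T r = cmod q" using T_surj [OF q(1)] by blast
      have "q = of_real (t * cmod z) * u" by (subst t, subst u(2)) (simp add: scaleR_conv_of_real)
      moreover have "t * cmod z = T r \<or> t * cmod z = T (- r)"
        using r t by (cases "t \<ge> 0") (auto simp: T_minus)
      ultimately have "q = g r \<or> q = g (- r)" unfolding g_def by metis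
      then show "q \<in> range g" by blast
    qed
  qed
  define \<gamma> where "\<gamma> = (\<lambda>s. inv_into U h (g s))"
  have "d (\<gamma> a) (\<gamma> b) = \<bar>a - b\<bar>" for a b
    unfolding \<gamma>_def I.iso [OF gU gU] unfolding g_def by (rule T_dist [OF u(1)])
  moreover have "range \<gamma> = line_through U d x y"
  proof -
    have "range \<gamma> = inv_into U h ` range g" unfolding \<gamma>_def by (simp add: image_image)
    also have "\<dots> = line_through U d (inv_into U h 0) (inv_into U h z)"
      unfolding rg by (rule I.line_image [OF zero_in zU, symmetric])
    also have "inv_into U h 0 = x" using H.inv_h [OF xy(1)] h(2) by simp
    also have "inv_into U h z = y" using H.inv_h [OF xy(2)] by (simp add: z_def)
    finally show ?thesis .
  qed
  moreover have "\<gamma> 0 = x" using H.inv_h [OF xy(1)] h(2) by (simp add: \<gamma>_def g_def T_zero)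
  moreover obtain r where r: "T r = cmod z" using T_surj [OF zU] by blast
  then have "\<gamma> r = y" using H.inv_h [OF xy(2)] u(2) by (simp add: \<gamma>_def g_def z_def)
  moreover have "0 < r"
  proof -
    have "T 0 < T r" using r z0 by (simp add: T_zero)
    then show ?thesis using T_mono by (simp add: strict_mono_less)
  qed
  ultimately show ?thesis using that by blast
qed

section \<open>Incidence of faces and uniqueness of labels in a fixed tessellation\<close>

context
  fixes m n :: nat and F :: "complex set set"
  assumes tess: "regular_tessellation U d m n F"
begin

lemma fc_regular: "vs \<in> face_cycles U d F \<Longrightarrow> regular_polygon U d vs"
  and fc_cp: "vs \<in> face_cycles U d F \<Longrightarrow> convex_polygon U d vs"
  and fc_face: "vs \<in> face_cycles U d F \<Longrightarrow> region U d vs \<in> F"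
  by (auto simp: face_cycles_def regular_cp)

lemma face_cycle_exists: "f \<in> F \<Longrightarrow> \<exists>vs\<in>face_cycles U d F. region U d vs = f"
  using tessellation_face [OF tess, of f] by (auto simp: face_cycles_def)

text \<open>\<open>face_cycles\<close> admits every regular corner list of a face, while the
  tessellation promises just one of length \<open>m\<close>; both lists run through the extreme
  points of the face, each once.\<close>

lemma fc_length: assumes "vs \<in> face_cycles U d F" shows "length vs = m"
proof -
  obtain us where us: "length us = m" "regular_polygon U d us" "region U d vs = region U d us"
    using tessellation_face [OF tess fc_face [OF assms]] by blast
  have "set us = set vs" using region_determines [OF regular_cp [OF us(2)] fc_cp [OF assms]] us(3) by simp
  then show ?thesis using card_corners [OF fc_cp [OF assms]] card_corners [OF regular_cp [OF us(2)]] us(1) by simp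
qed

lemma face_at: assumes "x \<in> U" shows "\<exists>vs\<in>face_cycles U d F. x \<in> region U d vs"
proof -
  have "x \<in> \<Union> F" using tessellation_Union [OF tess] assms by simp
  then obtain f where "f \<in> F" "x \<in> f" by blast
  then show ?thesis using face_cycle_exists by blast
qed

text \<open>A common side is given as a point set; segments that agree as sets have the same ends,
  so it is an \<open>edge\<close> of both faces.\<close>

lemma faces_meet:
  assumes uv: "us \<in> face_cycles U d F" "vs \<in> face_cycles U d F" and ne: "region U d us \<noteq> region U d vs"
    and x: "x \<in> region U d us" "x \<in> region U d vs"
  shows "x \<in> set us \<and> x \<in> set vs \<and> region U d us \<inter> region U d vs = {x} \<or>
    (\<exists>a b. edge us a b \<and> edge vs a b \<and> region U d us \<inter> region U d vs = closed_segment a b)"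
proof -
  consider y where "y \<in> set us \<inter> set vs" "region U d us \<inter> region U d vs = {y}"
    | "region U d us \<inter> region U d vs \<in> sides U d us \<inter> sides U d vs"
    using tessellation_Int [OF tess uv ne] x by blast
  then show ?thesis
  proof cases
    case 1
    then show ?thesis using x by auto
  next
    case 2
    then obtain a b a' b' where ab: "edge us a b" "region U d us \<inter> region U d vs = closed_segment a b"
      "edge vs a' b'" "region U d us \<inter> region U d vs = closed_segment a' b'"
      unfolding sides_eq [OF fc_cp [OF uv(1)]] sides_eq [OF fc_cp [OF uv(2)]] by blast
    then have "{a, b} = {a', b'}" by (metis closed_segment_eq)
    then have "edge vs a b" using ab(3) edge_sym [of vs a' b'] by (auto simp: doubleton_eq_iff)
    then show ?thesis using ab by blast
  qed
qed

lemma geom_points_iff: "x \<in> geom_points U d F k \<longleftrightarrow> (\<exists>vs\<in>face_cycles U d F. own_point vs k x)"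
proof -
  have "(\<exists>i. is_midpoint U d (corner vs i) (corner vs (i + 1)) x) \<longleftrightarrow> (\<exists>a b. edge vs a b \<and> is_midpoint U d a b x)" for vs
    unfolding edge_def using midpoint_sym by metis
  then have "x \<in> edge_centres U d F \<longleftrightarrow> (\<exists>vs\<in>face_cycles U d F. \<exists>a b. edge vs a b \<and> is_midpoint U d a b x)"
    by (simp add: edge_centres_def)
  then show ?thesis
    by (auto simp: geom_points_def own_point_def vertices_def face_centres_def)
qed

lemma own_same_region:
  assumes uv: "us \<in> face_cycles U d F" "vs \<in> face_cycles U d F" and e: "region U d us = region U d vs"
    and o: "own_point us k x"
  shows "own_point vs k x"
proof -
  have V: "set us = set vs" by (rule region_determines [OF fc_cp [OF uv(1)] fc_cp [OF uv(2)] e])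
  then have "edge us a b \<Longrightarrow> edge vs a b" for a b using edge_set_eq fc_cp uv by blast
  then show ?thesis using o V unfolding own_point_def is_centre_def by metis
qed

text \<open>Distinct faces meet in a common corner or a common side. On a common side a corner must
  be an end, a midpoint must be the midpoint of that very side by \<open>edges_meet\<close>, and a
  centre cannot occur.\<close>

lemma own_transfer:
  assumes uv: "us \<in> face_cycles U d F" "vs \<in> face_cycles U d F"
    and o: "own_point us k x" and x: "x \<in> region U d vs"
  shows "own_point vs k x"
proof (cases "region U d us = region U d vs")
  case True then show ?thesis using own_same_region uv o by blast
next
  case False
  note ru = fc_regular [OF uv(1)] and cu = fc_cp [OF uv(1)]
  have xu: "x \<in> region U d us" by (rule own_in_region [OF ru o])
  from faces_meet [OF uv False xu x] show ?thesis
  proof (elim disjE conjE exE)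
    assume "x \<in> set us" "x \<in> set vs"
    then have "k = 0" using own_disjoint [OF ru o, of 0] by (simp add: own_point_def)
    then show ?thesis using \<open>x \<in> set vs\<close> by (simp add: own_point_def)
  next
    fix a b assume e: "edge us a b" "edge vs a b" "region U d us \<inter> region U d vs = closed_segment a b"
    then have xs: "x \<in> closed_segment a b" using xu x by blast
    have ab: "a \<in> set us" "b \<in> set us" "a \<in> set vs" "b \<in> set vs"
      using edge_in [OF cu e(1)] edge_in [OF fc_cp [OF uv(2)] e(2)] by auto
    consider "k = 0" "x \<in> set us" | a' b' where "k = 1" "edge us a' b'" "is_midpoint U d a' b' x" | "is_centre U d us x"
      using o unfolding own_point_def by blast
    then show ?thesis
    proof cases
      case 1
      then have "x = a \<or> x = b" using corner_extreme [OF cu _ xs] corner_in_region [OF cu] ab by blast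
      then show ?thesis using 1 ab by (auto simp: own_point_def)
    next
      case 2
      have ab': "a' \<in> U" "b' \<in> U" "a' \<noteq> b'" using edge_in [OF cu 2(2)] cp_sub [OF cu] by auto
      have "x \<in> open_segment a' b'" by (rule midpoint_open_segment [OF ab' 2(3)])
      then have "{a, b} = {a', b'}" by (rule edges_meet [OF cu 2(2) e(1) _ xs])
      then have "is_midpoint U d a b x" using 2(3) midpoint_sym by (auto simp: doubleton_eq_iff)
      then show ?thesis using 2(1) e(2) by (auto simp: own_point_def)
    next
      case 3
      then show ?thesis using centre_not_on_side [OF ru _ e(1)] xs by blast
    qed
  qed
qed

lemma label_unique: "x \<in> geom_points U d F k \<Longrightarrow> x \<in> geom_points U d F l \<Longrightarrow> k = l"
  unfolding geom_points_iff using own_transfer own_disjoint own_in_region fc_regular by metis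

text \<open>A side of one face never enters the interior of another. In \<open>fan\<close> this
  keeps edges out of the angle of a face.\<close>

lemma side_point_transfer:
  assumes uv: "us \<in> face_cycles U d F" "vs \<in> face_cycles U d F"
    and e: "edge us a b" and xs: "x \<in> closed_segment a b" and x: "x \<in> region U d vs"
  shows "\<exists>a' b'. edge vs a' b' \<and> x \<in> closed_segment a' b'"
proof (cases "region U d us = region U d vs")
  case True
  then have "set us = set vs" by (rule region_determines [OF fc_cp [OF uv(1)] fc_cp [OF uv(2)]])
  then have "edge vs a b" using edge_set_eq fc_cp uv e by blast
  then show ?thesis using xs by blast
next
  case False
  have xu: "x \<in> region U d us" using edge_in_region [OF fc_cp [OF uv(1)] e] xs by blast
  from faces_meet [OF uv False xu x] show ?thesis
  proof (elim disjE conjE exE)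
    assume "x \<in> set vs"
    then obtain p q where "wedge vs p x q" using in_set_wedge [of x vs] by blast
    then have "edge vs x p" by (rule wedge_edge)
    then show ?thesis using ends_in_segment(1) by blast
  next
    fix a b assume "edge us a b" "edge vs a b" "region U d us \<inter> region U d vs = closed_segment a b"
    then show ?thesis using xu x by blast
  qed
qed

text \<open>Points just beyond the middle \<open>p\<close> of the side belong to other faces,
  finitely many near \<open>p\<close> and all closed, so one of these contains \<open>p\<close>. As
  \<open>p\<close> is no corner, it lies on a common side, which must be \<open>a b\<close>. Were
  both faces on one side of it, \<open>triangles_overlap\<close> would give a common point off
  \<open>a b\<close>.\<close>

lemma neighbour_face:
  assumes vs: "vs \<in> face_cycles U d F" and e: "edge vs a b"
  shows "\<exists>us\<in>face_cycles U d F. edge us a b \<and>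
     (\<forall>x\<in>set us. \<forall>y\<in>set vs. x \<noteq> a \<longrightarrow> x \<noteq> b \<longrightarrow> y \<noteq> a \<longrightarrow> y \<noteq> b \<longrightarrow> orient a b x * orient a b y < 0)"
proof -
  note cp = fc_cp [OF vs]
  have ab: "a \<in> set vs" "b \<in> set vs" "a \<noteq> b" using edge_in [OF cp e] by auto
  have abU: "a \<in> U" "b \<in> U" using ab cp_sub [OF cp] by auto
  define p where "p = midpoint a b"
  have p: "p \<in> open_segment a b" using ab by (simp add: p_def)
  then have pc: "p \<in> closed_segment a b" "p \<noteq> a" "p \<noteq> b" by (auto simp: open_segment_def)
  have pU: "p \<in> U" using pc seg_in [OF abU] by blast
  obtain r where r: "r > 0" "finite {f \<in> F. \<exists>y \<in> f. d p y < r}" using tessellation_finite [OF tess pU] by blast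
  obtain e0 where e0: "e0 > 0" "\<And>y. y \<in> U \<Longrightarrow> dist y p < e0 \<Longrightarrow> d p y < r" using small_dist [OF pU r(1)] by blast
  obtain e1 where e1: "e1 > 0" "ball p e1 \<subseteq> U" using open_U pU open_contains_ball by blast
  define A where "A = \<Union> {f \<in> F. (\<exists>y \<in> f. d p y < r) \<and> f \<noteq> region U d vs}"
  have "closed A"
    unfolding A_def
  proof (rule closed_Union)
    show "finite {f \<in> F. (\<exists>y \<in> f. d p y < r) \<and> f \<noteq> region U d vs}" by (rule finite_subset [OF _ r(2)]) blast
    show "\<forall>f\<in>{f \<in> F. (\<exists>y \<in> f. d p y < r) \<and> f \<noteq> region U d vs}. closed f"
    proof
      fix f assume "f \<in> {f \<in> F. (\<exists>y \<in> f. d p y < r) \<and> f \<noteq> region U d vs}"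
      then obtain ws where ws: "ws \<in> face_cycles U d F" "region U d ws = f" using face_cycle_exists by blast
      have "f = convex hull (set ws)" using region_eq [OF cp_sub [OF fc_cp [OF ws(1)]]] ws(2) by simp
      then show "closed f" by (simp add: finite_imp_compact_convex_hull compact_imp_closed)
    qed
  qed
  obtain x0 where x0: "x0 \<in> set vs" "x0 \<noteq> a" "x0 \<noteq> b" using third_corner [OF cp e] .
  obtain s where s: "s \<noteq> 0" "\<And>x. x \<in> set vs \<Longrightarrow> x \<noteq> a \<Longrightarrow> x \<noteq> b \<Longrightarrow> s * orient a b x > 0" using edge_support [OF cp e] by metis
  have "p \<in> closure A"
    unfolding closure_approachable
  proof (intro allI impI)
    fix ep :: real assume ep: "ep > 0"
    define e2 where "e2 = min ep (min e0 e1)"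
    have e2: "e2 > 0" using ep e0 e1 by (simp add: e2_def)
    define D where "D = 1 + cmod (x0 - p)"
    \<comment> \<open>\<open>D\<close> exceeds the length of \<open>x0 - p\<close>, so
      \<open>y\<close> is closer to \<open>p\<close> than \<open>e2\<close>; it lies across the side
      from the corner \<open>x0\<close>.\<close>
    define t where "t = e2 / (2 * D)"
    have den: "D > 0" by (simp add: D_def add_pos_nonneg)
    have t: "t > 0" using e2 den by (simp add: t_def)
    define y where "y = p - t *\<^sub>R (x0 - p)"
    have "dist y p = t * cmod (x0 - p)" using t by (simp add: y_def dist_norm)
    also have "\<dots> \<le> t * D" using t by (simp add: D_def)
    also have "\<dots> = e2 / 2" using den by (simp add: t_def)
    finally have dy: "dist y p < e2" using e2 by simp
    have yU: "y \<in> U" using dy e1(2) by (auto simp: e2_def dist_commute)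
    then obtain ws where ws: "ws \<in> face_cycles U d F" "y \<in> region U d ws" using face_at by blast
    have "orient a b y = - t * orient a b x0"
    proof -
      have "y = (1 - (- t)) *\<^sub>R p + (- t) *\<^sub>R x0" by (simp add: y_def algebra_simps)
      then show ?thesis using orient_affine [of a b "- t" p x0] orient_on_segment [OF pc(1)] by simp
    qed
    then have "s * orient a b y = - t * (s * orient a b x0)" by simp
    then have "s * orient a b y < 0" using s(2) [OF x0] t by simp
    then have "y \<notin> region U d vs" using edge_hull(1) [OF cp e s(2,1)] by fastforce
    then have "region U d ws \<noteq> region U d vs" using ws(2) by auto
    moreover have "d p y < r" using e0(2) yU dy by (simp add: e2_def)
    ultimately have "y \<in> A" unfolding A_def using ws fc_face by blast
    then show "\<exists>y\<in>A. dist y p < ep" using dy by (auto simp: e2_def)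
  qed
  then have "p \<in> A" using \<open>closed A\<close> by simp
  then obtain f where f: "f \<in> F" "f \<noteq> region U d vs" "p \<in> f" by (auto simp: A_def)
  then obtain us where us: "us \<in> face_cycles U d F" "region U d us = f" using face_cycle_exists by blast
  have pv: "p \<in> region U d vs" using edge_in_region [OF cp e] pc by blast
  have pn: "p \<notin> set vs"
    using corner_extreme [OF cp _ pc(1)] corner_in_region [OF cp] ab pc by blast
  have pu: "p \<in> region U d us" using us f by simp
  have "region U d us \<noteq> region U d vs" using us f by simp
  from faces_meet [OF us(1) vs this pu pv] pn
  obtain a' b' where e': "edge us a' b'" "edge vs a' b'" "region U d us \<inter> region U d vs = closed_segment a' b'" by blast
  have "p \<in> closed_segment a' b'" using e'(3) pu pv by blast
  then have dd: "{a', b'} = {a, b}" by (rule edges_meet [OF cp e e'(2) p])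
  then have eu: "edge us a b" using e'(1) edge_sym [of us a' b'] by (auto simp: doubleton_eq_iff)
  have I: "region U d us \<inter> region U d vs = closed_segment a b"
    using e'(3) dd closed_segment_eq by metis
  have "orient a b x * orient a b y < 0"
    if xy: "x \<in> set us" "y \<in> set vs" "x \<noteq> a" "x \<noteq> b" "y \<noteq> a" "y \<noteq> b" for x y
  proof (rule ccontr)
    assume "\<not> orient a b x * orient a b y < 0"
    moreover have "orient a b y \<noteq> 0" using s(2) [OF xy(2,5,6)] by auto
    moreover have "orient a b x \<noteq> 0" using edge_support [OF fc_cp [OF us(1)] eu] xy by (metis less_irrefl mult_zero_right)
    ultimately have "0 < orient a b x * orient a b y" by (simp add: not_less less_le)
    then obtain z where z: "z \<in> convex hull {a, b, x}" "z \<in> convex hull {a, b, y}" "orient a b z \<noteq> 0"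
      using triangles_overlap by blast
    have "a \<in> set us" "b \<in> set us" using edge_in [OF fc_cp [OF us(1)] eu] by auto
    then have "convex hull {a, b, x} \<subseteq> region U d us" "convex hull {a, b, y} \<subseteq> region U d vs"
      unfolding region_eq [OF cp_sub [OF cp]] region_eq [OF cp_sub [OF fc_cp [OF us(1)]]]
      using xy ab by (auto intro!: hull_mono)
    then have "z \<in> closed_segment a b" using z I by blast
    then show False using z(3) orient_on_segment by blast
  qed
  then show ?thesis using us(1) eu by blast
qed

lemma barycentric_triangle_iff: "barycentric_triangle U d F v0 v1 v2 \<longleftrightarrow>
    (\<exists>vs\<in>face_cycles U d F. \<exists>b. edge vs v0 b \<and> is_midpoint U d v0 b v1 \<and> is_centre U d vs v2)"
proof -
  have "(\<exists>i. v0 \<in> {corner vs i, corner vs (i + 1)} \<and> is_midpoint U d (corner vs i) (corner vs (i + 1)) v1)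
      \<longleftrightarrow> (\<exists>b. edge vs v0 b \<and> is_midpoint U d v0 b v1)" for vs
    unfolding edge_def using midpoint_sym by blast
  then show ?thesis unfolding barycentric_triangle_def by blast
qed

lemma flag_points:
  assumes "barycentric_triangle U d F (v 0) (v 1) (v 2)"
  obtains vs b where "vs \<in> face_cycles U d F" "edge vs (v 0) b" "is_midpoint U d (v 0) b (v 1)" "is_centre U d vs (v 2)"
    "\<And>k. k < 3 \<Longrightarrow> own_point vs k (v k)"
proof -
  obtain vs b where vs: "vs \<in> face_cycles U d F" "edge vs (v 0) b" "is_midpoint U d (v 0) b (v 1)" "is_centre U d vs (v 2)"
    using assms barycentric_triangle_iff by blast
  have "own_point vs k (v k)" if k3: "k < 3" for k
  proof -
    consider "k = 0" | "k = 1" | "k = 2" using k3 by linarith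
    then show ?thesis using vs edge_in [OF fc_cp [OF vs(1)] vs(2)] unfolding own_point_def by cases auto
  qed
  then show ?thesis using vs that by blast
qed

lemma flag_side_points:
  assumes "flag_side F k l x y"
  shows "x \<in> geom_points U d F k" "y \<in> geom_points U d F l" "x \<noteq> y" "x \<in> U" "y \<in> U"
proof -
  obtain v where v: "k < 3" "l < 3" "k \<noteq> l" "barycentric_triangle U d F (v 0) (v 1) (v 2)" "x = v k" "y = v l"
    using assms unfolding flag_side_def by blast
  obtain vs where vs: "vs \<in> face_cycles U d F" "\<And>k. k < 3 \<Longrightarrow> own_point vs k (v k)"
    using flag_points [of v] v(4) by metis
  then show g: "x \<in> geom_points U d F k" "y \<in> geom_points U d F l" using v geom_points_iff by auto
  show "x \<noteq> y" using vs v own_disjoint [OF fc_regular [OF vs(1)]] by metis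
  have "region U d vs \<subseteq> U" using cp_sub [OF fc_cp [OF vs(1)]] region_eq convex_U by (simp add: hull_minimal)
  then show "x \<in> U" "y \<in> U" using vs v own_in_region [OF fc_regular [OF vs(1)]] by blast+
qed

text \<open>The supporting function of a side is nonnegative at \<open>q\<close> and positive at the
  centre, hence positive on the segment except possibly at \<open>q\<close>.\<close>

lemma no_side_toward_centre:
  assumes r: "regular_polygon U d vs" and c: "is_centre U d vs c" and q: "q \<in> region U d vs"
    and x: "x \<in> closed_segment q c" "x \<noteq> q" and e: "edge vs a b"
  shows "x \<notin> closed_segment a b"
proof
  assume "x \<in> closed_segment a b"
  then have z: "orient a b x = 0" by (rule orient_on_segment)
  note cp = regular_cp [OF r]
  obtain s where s: "s \<noteq> 0" "\<And>x. x \<in> set vs \<Longrightarrow> x \<noteq> a \<Longrightarrow> x \<noteq> b \<Longrightarrow> s * orient a b x > 0" using edge_support [OF cp e] by metis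
  obtain y where y: "y \<in> set vs" "y \<noteq> a" "y \<noteq> b" using third_corner [OF cp e] .
  have "s * orient a b c > 0" using s(2) [OF y] centre_inside(2) [OF r c e y] by (auto simp: zero_less_mult_iff)
  moreover have "s * orient a b q \<ge> 0" by (rule edge_hull(1) [OF cp e s(2,1) q])
  moreover obtain t where t: "0 \<le> t" "t \<le> 1" "x = (1 - t) *\<^sub>R q + t *\<^sub>R c" using x(1) by (auto simp: closed_segment_def)
  moreover have "t \<noteq> 0" using t(3) x(2) by auto
  moreover have "0 = (1 - t) * (s * orient a b q) + t * (s * orient a b c)"
  proof -
    have "(1 - t) * orient a b q + t * orient a b c = 0" using z unfolding t(3) orient_affine .
    then have "s * ((1 - t) * orient a b q + t * orient a b c) = 0" by simp
    then show ?thesis by (simp add: algebra_simps)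
  qed
  moreover have "0 \<le> (1 - t) * (s * orient a b q)" "0 < t * (s * orient a b c)" using calculation by auto
  ultimately show False by linarith
qed

lemma own_on_side:
  assumes r: "regular_polygon U d vs" and o: "own_point vs k x" and k: "k \<noteq> 2"
  shows "\<exists>a b. edge vs a b \<and> x \<in> closed_segment a b"
proof -
  note cp = regular_cp [OF r]
  consider "x \<in> set vs" | a b where "edge vs a b" "is_midpoint U d a b x" using o k unfolding own_point_def by blast
  then show ?thesis
  proof cases
    case 1
    then obtain p q where "wedge vs p x q" using in_set_wedge [of x vs] by blast
    then have "edge vs x p" by (rule wedge_edge)
    then show ?thesis using ends_in_segment(1) by blast
  next
    case 2
    have ab: "a \<in> U" "b \<in> U" "a \<noteq> b" using edge_in [OF cp 2(1)] cp_sub [OF cp] by auto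
    then show ?thesis using midpoint_open_segment [OF ab 2(2)] 2(1) by (auto simp: open_segment_def)
  qed
qed

text \<open>The segment stays in one face, so \<open>own_transfer\<close> makes \<open>z\<close> a
  geometric point of that face. Towards the centre no point of a side follows the start and there is
  no second centre; along the edge, extremality of corners, \<open>edges_meet\<close> and
  \<open>centre_not_on_side\<close> decide.\<close>

lemma flag_side_empty:
  assumes f: "flag_side F k l x y" and z: "z \<in> closed_segment x y" "z \<in> geom_points U d F j"
  shows "z = x \<or> z = y"
proof -
  obtain v where v: "k < 3" "l < 3" "k \<noteq> l" "barycentric_triangle U d F (v 0) (v 1) (v 2)" "x = v k" "y = v l"
    using f unfolding flag_side_def by blast
  obtain vs b where vs: "vs \<in> face_cycles U d F" "edge vs (v 0) b" "is_midpoint U d (v 0) b (v 1)" "is_centre U d vs (v 2)"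
    "\<And>k. k < 3 \<Longrightarrow> own_point vs k (v k)"
    using flag_points [of v] v(4) by metis
  note r = fc_regular [OF vs(1)] and cp = fc_cp [OF vs(1)]
  have reg: "v i \<in> region U d vs" if "i < 3" for i using vs(5) own_in_region [OF r] that by blast
  have "closed_segment x y \<subseteq> region U d vs"
    using reg v convex_region [OF cp] by (simp add: closed_segment_subset)
  then have zr: "z \<in> region U d vs" using z by blast
  obtain us where us: "us \<in> face_cycles U d F" "own_point us j z" using z(2) geom_points_iff by blast
  have zo: "own_point vs j z" by (rule own_transfer [OF us(1) vs(1) us(2) zr])
  have toward: "z = q \<or> z = v 2" if "q \<in> region U d vs" "z \<in> closed_segment q (v 2)" for q
  proof (cases "j = 2")
    case True
    then have "is_centre U d vs z" using zo by (simp add: own_point_def)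
    then show ?thesis using centre_unique [OF r vs(4)] by blast
  next
    case False
    then show ?thesis using own_on_side [OF r zo] no_side_toward_centre [OF r vs(4) that] by blast
  qed
  have along: "z = v 0 \<or> z = v 1" if z01: "z \<in> closed_segment (v 0) (v 1)"
  proof -
    have U: "v 0 \<in> U" "b \<in> U" "v 0 \<noteq> b" using edge_in [OF cp vs(2)] cp_sub [OF cp] by auto
    have v1: "v 1 \<in> open_segment (v 0) b" by (rule midpoint_open_segment [OF U vs(3)])
    then have "closed_segment (v 0) (v 1) \<subseteq> closed_segment (v 0) b"
      by (simp add: subset_closed_segment open_segment_def)
    then have zb: "z \<in> closed_segment (v 0) b" using z01 by blast
    consider "j = 0" "z \<in> set vs" | a' b' where "edge vs a' b'" "is_midpoint U d a' b' z" | "is_centre U d vs z"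
      using zo unfolding own_point_def by blast
    then show ?thesis
    proof cases
      case 1
      then show ?thesis
        using corner_extreme [OF cp 1(2) z01] reg [of 0] reg [of 1] by simp
    next
      case 2
      have U': "a' \<in> U" "b' \<in> U" "a' \<noteq> b'" using edge_in [OF cp 2(1)] cp_sub [OF cp] by auto
      have "z \<in> open_segment a' b'" by (rule midpoint_open_segment [OF U' 2(2)])
      then have "{v 0, b} = {a', b'}" by (rule edges_meet [OF cp 2(1) vs(2) _ zb])
      then have "is_midpoint U d (v 0) b z" using 2(2) midpoint_sym by (auto simp: doubleton_eq_iff)
      then show ?thesis using midpoint_unique [OF U(1,2) _ vs(3)] by blast
    next
      case 3
      then show ?thesis using centre_not_on_side [OF r _ vs(2)] zb by blast
    qed
  qed
  have "k = 0 \<and> l = 1 \<or> k = 1 \<and> l = 0 \<or> k = 2 \<or> l = 2" using v by linarith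
  then show ?thesis
    using toward [of "v k"] toward [of "v l"] along reg v z(1) by (auto simp: closed_segment_commute)
qed

subsection \<open>Continuing a mirror beyond a geometric point\<close>

text \<open>Crossing the side \<open>0 q\<close>: the neighbouring face shares that side, hence by
  \<open>wedge_congruent\<close> has the same angle at 0, laid off on the other side of
  \<open>0 q\<close>.\<close>

lemma next_wedge:
  assumes us: "us \<in> face_cycles U d F" and w: "wedge us p 0 q"
  obtains us' r where "us' \<in> face_cycles U d F" "wedge us' q 0 r" "orient 0 q r * orient 0 q p < 0"
    "d q r = d p q" "d 0 q = d 0 p" "d 0 r = d 0 p" "r \<in> U"
proof -
  note cp = fc_cp [OF us]
  have ep: "edge us 0 p" and eq: "edge us 0 q" using wedge_edge [OF w] by auto
  obtain us' where us': "us' \<in> face_cycles U d F" "edge us' 0 q"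
     "\<forall>x\<in>set us'. \<forall>y\<in>set us. x \<noteq> 0 \<longrightarrow> x \<noteq> q \<longrightarrow> y \<noteq> 0 \<longrightarrow> y \<noteq> q \<longrightarrow> orient 0 q x * orient 0 q y < 0"
    using neighbour_face [OF us eq] by blast
  note cp' = fc_cp [OF us'(1)]
  obtain r where "wedge us' r 0 q" using edge_wedge [OF cp_ne [OF cp'] us'(2)] by blast
  then have w': "wedge us' q 0 r" by (simp add: wedge_sym)
  have ner: "r \<noteq> q" "r \<noteq> 0" using wedge_neq [OF cp' w'] by auto
  have nep: "p \<noteq> q" "p \<noteq> 0" using wedge_neq [OF cp w] by auto
  have er: "edge us' 0 r" by (rule wedge_edge(2) [OF w'])
  have rV: "r \<in> set us'" using edge_in [OF cp' er] by simp
  have pV: "p \<in> set us" using edge_in [OF cp ep] by simp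
  have "orient 0 q r * orient 0 q p < 0" using us'(3) rV pV ner nep by blast
  moreover have "d q r = d q p"
  proof (rule wedge_congruent [OF fc_regular [OF us'(1)] fc_regular [OF us] _ w'])
    show "wedge us q 0 p" using w by (simp add: wedge_sym)
    show "length us' = length us" using fc_length us us'(1) by simp
  qed simp
  moreover have "d 0 q = d 0 p" by (rule edge_length [OF fc_regular [OF us] eq ep])
  moreover have "d 0 r = d 0 q" by (rule edge_length [OF fc_regular [OF us'(1)] er us'(2)])
  moreover have "r \<in> U" using rV cp_sub [OF cp'] by auto
  ultimately show ?thesis using that us'(1) w' d_sym [of q p] by simp
qed

text \<open>The quotient \<open>z\<close> of the two edges of one face repeats from face to face, so
  the edges met are \<open>a * z ^ k\<close>. None may enter the angle of \<open>vs\<close>, so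
  \<open>z\<close> turns through exactly one \<open>N\<close>-th of a circle for some
  \<open>N\<close>. The \<open>N\<close> faces found are distinct and are all the faces at 0, of
  which there are \<open>n\<close>.\<close>

lemma fan:
  assumes vs: "vs \<in> face_cycles U d F" and w: "wedge vs a 0 b"
  obtains z where "root_pair n z" "b = a * z" "\<And>k. \<exists>us\<in>face_cycles U d F. wedge us (a * z ^ k) 0 (a * z ^ (k + 1))"
proof -
  note cp = fc_cp [OF vs]
  have ea: "edge vs 0 a" and eb: "edge vs 0 b" using wedge_edge [OF w] by auto
  have inV: "0 \<in> set vs" "a \<in> set vs" "b \<in> set vs" using edge_in [OF cp ea] edge_in [OF cp eb] by auto
  have U: "a \<in> U" "b \<in> U" using inV cp_sub [OF cp] by auto
  have ne: "a \<noteq> b" "a \<noteq> 0" "b \<noteq> 0" using wedge_neq [OF cp w] by auto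
  have nab: "cmod b = cmod a"
    using edge_length [OF fc_regular [OF vs] eb ea] norm_dist [OF U(2,1)] by simp
  define z where "z = b / a"
  have bz: "b = a * z" using ne by (simp add: z_def)
  have z1: "cmod z = 1" using nab ne by (simp add: z_def norm_divide)
  have z0: "z \<noteq> 0" using z1 by auto
  \<comment> \<open>Besides the wedge, the induction carries membership in \<open>U\<close> and the
    chord length, which \<open>chord_dist\<close> and \<open>unit_chord\<close> need for the next
    face.\<close>
  have fans: "\<exists>us\<in>face_cycles U d F. wedge us (a * z ^ k) 0 (a * z ^ (k + 1)) \<and> a * z ^ k \<in> U \<and>
      a * z ^ (k + 1) \<in> U \<and> d (a * z ^ k) (a * z ^ (k + 1)) = d a b" for k
  proof (induction k)
    case 0
    then show ?case using vs w bz U by auto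
  next
    case (Suc k)
    define p q where "p = a * z ^ k" and "q = a * z ^ (k + 1)"
    obtain us where us: "us \<in> face_cycles U d F" "wedge us p 0 q" "p \<in> U" "q \<in> U" "d p q = d a b"
      using Suc unfolding p_def q_def by blast
    obtain us' r where r: "us' \<in> face_cycles U d F" "wedge us' q 0 r" "orient 0 q r * orient 0 q p < 0"
      "d q r = d p q" "d 0 q = d 0 p" "d 0 r = d 0 p" "r \<in> U"
      using next_wedge [OF us(1,2)] by metis
    have nr: "cmod r = cmod p" "cmod q = cmod p" using norm_dist r us by auto
    have n3: "cmod q = cmod r" "cmod p = cmod q" "cmod q = cmod p" using nr by (metis)+
    have "cmod (q - r) = cmod (p - q)" using chord_dist [OF us(4) r(7) us(3,4) n3] r(4) by blast
    define v where "v = r / q"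
    have q0: "q \<noteq> 0" "p \<noteq> 0" using ne z0 by (auto simp: q_def p_def)
    have v1: "cmod v = 1" using nr q0 by (simp add: v_def norm_divide)
    have qp: "q = p * z" by (simp add: q_def p_def)
    have rv: "r = q * v" using q0 by (simp add: v_def)
    have "cmod (v - 1) = cmod (z - 1)"
    proof -
      have "q - r = q * (1 - v)" "p - q = p * (1 - z)" by (simp_all add: rv qp algebra_simps)
      then have "cmod q * cmod (1 - v) = cmod p * cmod (1 - z)"
        using \<open>cmod (q - r) = cmod (p - q)\<close> by (simp add: norm_mult)
      then show ?thesis using nr q0 by (simp add: norm_minus_commute)
    qed
    then have "v = z \<or> v = cnj z" using unit_chord [OF z1 v1] by simp
    \<comment> \<open>The reversed turn would put \<open>r\<close> back at \<open>p\<close>, but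
      \<open>r\<close> lies across \<open>0 q\<close> from \<open>p\<close>.\<close>
    moreover have "v \<noteq> cnj z"
    proof
      assume "v = cnj z"
      then have "z * v = 1" using z1 complex_norm_square [of z] by simp
      then have "r = p" using rv qp by (simp add: mult.assoc)
      then show False using r(3) by (simp add: mult_less_0_iff)
    qed
    ultimately have "r = q * z" using rv by simp
    then have "r = a * z ^ (Suc k + 1)" by (simp add: q_def)
    moreover have "q = a * z ^ Suc k" by (simp add: q_def)
    ultimately show ?case using r us by auto
  qed
  have ori: "orient 0 a b \<noteq> 0"
    using edge_support [OF cp ea] inV(3) ne by (metis less_irrefl mult_zero_right)
  have iz: "Im z \<noteq> 0"
  proof
    assume "Im z = 0"
    then have "z = of_real (Re z)" by (simp add: complex_eq_iff)
    then have "b = a * of_real (Re z)" using bz by simp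
    then have "orient 0 a b = Im (of_real (Re z) * (a * cnj a))" by (simp add: orient_def)
    also have "\<dots> = 0" by simp
    finally show False using ori by simp
  qed
  \<comment> \<open>An edge strictly inside the angle of \<open>vs\<close> has a point
    \<open>x\<close> that is a strict combination of \<open>a\<close>, \<open>b\<close> and 0;
    \<open>side_point_transfer\<close> puts \<open>x\<close> on a side of \<open>vs\<close>, against
    \<open>interior_combination\<close>.\<close>
  have inner_pt: False
    if us: "us \<in> face_cycles U d F" and e: "edge us 0 q" and q: "q = of_real l * a + of_real k * b" "0 < l" "0 < k" for us q l k
  proof -
    define ep where "ep = 1 / (1 + l + k)"
    have ep: "0 < ep" "ep < 1" "ep * l > 0" "ep * k > 0" using q(2,3) by (auto simp: ep_def)
    have "ep * (1 + l + k) = 1" using q(2,3) by (simp add: ep_def)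
    then have s1: "ep * l + ep * k + ep = 1" by (simp add: algebra_simps)
    define x where "x = ep *\<^sub>R q"
    have x: "x = (ep * l) *\<^sub>R a + (ep * k) *\<^sub>R b + ep *\<^sub>R 0"
      by (simp add: x_def q(1) scaleR_conv_of_real algebra_simps)
    have "x \<in> closed_segment 0 q" using ep unfolding x_def closed_segment_def by auto
    moreover have "x \<in> region U d vs"
    proof -
      have "x \<in> convex hull {a, b, 0}" unfolding convex_hull_3 x using ep s1 by (auto intro: less_imp_le)
      moreover have "convex hull {a, b, 0} \<subseteq> convex hull (set vs)" using inV by (intro hull_mono) auto
      ultimately show ?thesis using region_eq [OF cp_sub [OF cp]] by auto
    qed
    ultimately obtain a' b' where e': "edge vs a' b'" "x \<in> closed_segment a' b'"
      using side_point_transfer [OF us vs e] by blast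
    show False
      using interior_combination [OF cp inV(2,3,1) ne ep(3,4,1) s1 e'(1)] e'(2) x by simp
  qed
  have "z ^ k \<noteq> of_real l + of_real m * z" if lm: "0 < l" "0 < m" for k l m
  proof
    assume "z ^ k = of_real l + of_real m * z"
    then have q: "a * z ^ k = of_real l * a + of_real m * b" by (simp add: bz algebra_simps)
    obtain us where us: "us \<in> face_cycles U d F" "wedge us (a * z ^ k) 0 (a * z ^ (k + 1))" using fans [of k] by blast
    show False by (rule inner_pt [OF us(1) wedge_edge(1) [OF us(2)] q lm])
  qed
  then obtain N :: nat where "(3::nat) \<le> N" "z = cis (2 * pi / N) \<or> z = cis (- (2 * pi / N))"
    using fan_root [OF z1 iz] by blast
  then have N: "root_pair N z" by (simp add: root_pair_def)
  obtain g where g: "\<And>k. g k \<in> face_cycles U d F" "\<And>k. wedge (g k) (a * z ^ k) 0 (a * z ^ (k + 1))"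
    using fans by metis
  have img: "{f \<in> F. 0 \<in> f} = (\<lambda>k. region U d (g k)) ` {..<N}"
  proof
    show "(\<lambda>k. region U d (g k)) ` {..<N} \<subseteq> {f \<in> F. 0 \<in> f}"
    proof
      fix f assume "f \<in> (\<lambda>k. region U d (g k)) ` {..<N}"
      then obtain k where k: "f = region U d (g k)" by blast
      have "0 \<in> set (g k)" using edge_in [OF fc_cp [OF g(1)] wedge_edge(1) [OF g(2)]] by blast
      then show "f \<in> {f \<in> F. 0 \<in> f}" using k fc_face [OF g(1)] corner_in_region [OF fc_cp [OF g(1)]] by simp
    qed
    show "{f \<in> F. 0 \<in> f} \<subseteq> (\<lambda>k. region U d (g k)) ` {..<N}"
    proof
      fix f assume f: "f \<in> {f \<in> F. 0 \<in> f}"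
      then obtain us where us: "us \<in> face_cycles U d F" "region U d us = f" using face_cycle_exists by blast
      note cpu = fc_cp [OF us(1)]
      have "own_point us 0 0"
        by (rule own_transfer [OF vs us(1)]) (use inV us f in \<open>auto simp: own_point_def\<close>)
      then have "0 \<in> set us" by (simp add: own_point_def)
      then obtain p q where wp: "wedge us p 0 q" using in_set_wedge [of 0 us] by blast
      have pq: "p \<in> set us" "q \<in> set us"
        using edge_in [OF cpu wedge_edge(1) [OF wp]] edge_in [OF cpu wedge_edge(2) [OF wp]] by auto
      have npq: "p \<noteq> q" "p \<noteq> 0" "q \<noteq> 0" using wedge_neq [OF cpu wp] by auto
      have opq: "orient 0 p q \<noteq> 0"
        using edge_support [OF cpu wedge_edge(1) [OF wp]] pq npq by (metis less_irrefl mult_zero_right)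
      have s0: "p + q \<noteq> 0"
      proof
        assume "p + q = 0"
        then have "q = - p" by (simp add: add_eq_0_iff)
        then show False using opq by (simp add: orient_def)
      qed
      \<comment> \<open>The direction \<open>p + q\<close>, interior to the angle of the unknown
        face, falls in some closed sector of the fan, so near 0 that face meets
        \<open>g k\<close>.\<close>
      obtain k l m where k: "k < N" "0 \<le> l" "0 \<le> m" "(p + q) / a = (of_real l + of_real m * z) * z ^ k"
        using root_pair_sector [OF N, of "(p + q) / a"] by blast
      define ak bk where "ak = a * z ^ k" and "bk = a * z ^ (k + 1)"
      have pqk: "p + q = of_real l * ak + of_real m * bk"
      proof -
        have "p + q = a * ((p + q) / a)" using ne by simp
        then show ?thesis unfolding k(4) by (simp add: ak_def bk_def algebra_simps)
      qed
      \<comment> \<open>Makes \<open>y\<close> a convex combination both of \<open>p\<close>,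
        \<open>q\<close>, 0, with \<open>1 - 2 * ep\<close> left for 0, and of \<open>ak\<close>,
        \<open>bk\<close>, 0, with \<open>3 * ep\<close> left for 0.\<close>
      define ep where "ep = 1 / (3 + l + m)"
      have D: "3 + l + m > 0" using k by linarith
      have ep: "0 < ep" using D by (simp add: ep_def)
      have "ep * (3 + l + m) = 1" using D by (simp add: ep_def)
      then have eps: "3 * ep + ep * l + ep * m = 1" by (simp add: algebra_simps)
      have el: "0 \<le> ep * l" "0 \<le> ep * m" using ep k by auto
      define y where "y = ep *\<^sub>R (p + q)"
      have y1: "y = ep *\<^sub>R p + ep *\<^sub>R q + (1 - 2 * ep) *\<^sub>R 0" by (simp add: y_def scaleR_add_right)
      have y2: "y = (ep * l) *\<^sub>R ak + (ep * m) *\<^sub>R bk + (3 * ep) *\<^sub>R 0"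
        by (simp add: y_def pqk scaleR_conv_of_real algebra_simps)
      have c1: "0 < 1 - 2 * ep" "ep + ep + (1 - 2 * ep) = 1" using eps el ep by linarith+
      have yu: "y \<in> region U d us"
      proof -
        have "y \<in> convex hull {p, q, 0}" unfolding convex_hull_3 mem_Collect_eq
          by (intro exI [of _ ep] exI [of _ ep] exI [of _ "1 - 2 * ep"]) (use y1 ep c1 in auto)
        moreover have "convex hull {p, q, 0} \<subseteq> convex hull (set us)" using pq \<open>0 \<in> set us\<close> by (intro hull_mono) auto
        ultimately show ?thesis using region_eq [OF cp_sub [OF cpu]] by auto
      qed
      have yg: "y \<in> region U d (g k)"
      proof -
        have "y \<in> convex hull {ak, bk, 0}" unfolding convex_hull_3 mem_Collect_eq
          by (intro exI [of _ "ep * l"] exI [of _ "ep * m"] exI [of _ "3 * ep"]) (use y2 el ep eps in auto)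
        moreover have "{ak, bk, 0} \<subseteq> set (g k)"
          using edge_in [OF fc_cp [OF g(1)] wedge_edge(1) [OF g(2)]] edge_in [OF fc_cp [OF g(1)] wedge_edge(2) [OF g(2)]]
          by (simp add: ak_def bk_def)
        then have "convex hull {ak, bk, 0} \<subseteq> convex hull (set (g k))" by (rule hull_mono)
        ultimately show ?thesis using region_eq [OF cp_sub [OF fc_cp [OF g(1)]]] by auto
      qed
      have y0: "y \<noteq> 0" using s0 ep by (simp add: y_def)
      have zg: "0 \<in> region U d (g k)"
        using edge_in [OF fc_cp [OF g(1)] wedge_edge(1) [OF g(2)]] corner_in_region [OF fc_cp [OF g(1)]] by blast
      \<comment> \<open>Distinct faces could share here neither a single point, as both contain 0
        and \<open>y\<close>, nor a side, as \<open>y\<close> is a strict combination of corners of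
        \<open>us\<close>.\<close>
      have "region U d us = region U d (g k)"
      proof (rule ccontr)
        assume ner: "region U d us \<noteq> region U d (g k)"
        from faces_meet [OF us(1) g(1) ner yu yg] show False
        proof (elim disjE conjE exE)
          assume "region U d us \<inter> region U d (g k) = {y}"
          then show False using zg y0 us f by auto
        next
          fix a' b' assume e: "edge us a' b'" "region U d us \<inter> region U d (g k) = closed_segment a' b'"
          then have "y \<in> closed_segment a' b'" using yu yg by blast
          then show False
            using interior_combination [OF cpu pq \<open>0 \<in> set us\<close> npq ep ep c1(1,2) e(1)] y1 by simp
        qed
      qed
      then show "f \<in> (\<lambda>k. region U d (g k)) ` {..<N}" using us k(1) by blast
    qed
  qed
  \<comment> \<open>Equal regions have the same neighbours of 0, so the powers \<open>k\<close>,
    \<open>k + 1\<close> match \<open>j\<close>, \<open>j + 1\<close> in some order; the crossed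
    match would make \<open>z\<close> real.\<close>
  have inj: "inj_on (\<lambda>k. region U d (g k)) {..<N}"
  proof (rule inj_onI)
    fix j k assume jk: "j \<in> {..<N}" "k \<in> {..<N}" "region U d (g j) = region U d (g k)"
    have V: "set (g k) = set (g j)" by (rule region_determines [OF fc_cp [OF g(1)] fc_cp [OF g(1)] jk(3) [symmetric]])
    have "a * z ^ k = a * z ^ j \<or> a * z ^ k = a * z ^ (j + 1)"
      by (rule wedge_unique [OF fc_cp [OF g(1)] fc_cp [OF g(1)] V g(2) wedge_edge(1) [OF g(2)]])
    moreover have "a * z ^ (k + 1) = a * z ^ j \<or> a * z ^ (k + 1) = a * z ^ (j + 1)"
      by (rule wedge_unique [OF fc_cp [OF g(1)] fc_cp [OF g(1)] V g(2) wedge_edge(2) [OF g(2)]])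
    ultimately have 1: "z ^ k = z ^ j \<or> z ^ k = z ^ (j + 1)" "z ^ (k + 1) = z ^ j \<or> z ^ (k + 1) = z ^ (j + 1)" using ne by auto
    have "z ^ k = z ^ j"
    proof (rule ccontr)
      assume "z ^ k \<noteq> z ^ j"
      then have "z ^ k = z ^ (j + 1)" using 1 by blast
      then have "z ^ (k + 1) = z ^ j * z\<^sup>2" by (simp add: power2_eq_square)
      then have "z ^ j * z\<^sup>2 = z ^ j \<or> z ^ j * z\<^sup>2 = z ^ j * z" using 1(2) by simp
      then have "z\<^sup>2 = 1 \<or> z = 1" using z0 by (auto simp: power2_eq_square)
      then have "z = 1 \<or> z = - 1" by (auto simp: power2_eq_1_iff)
      then show False using iz by auto
    qed
    then show "j = k" using root_pair_inj [OF N] jk by auto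
  qed
  have "card {f \<in> F. 0 \<in> f} = N" unfolding img using card_image [OF inj] by simp
  then have "N = n" using tessellation_card [OF tess vs inV(1)] by simp
  then show ?thesis using that [of z] N bz g by blast
qed

lemma fan_flags:
  assumes bt: "barycentric_triangle U d F 0 v1 v2"
  obtains a z s t where "root_pair n z" "0 < s" "v1 = of_real s * a" "0 < t" "v2 = of_real t * (a * (1 + z))"
    "\<And>k. \<exists>u1 u2 s' t'. barycentric_triangle U d F 0 u1 u2 \<and> 0 < s' \<and> u1 = of_real s' * (a * z ^ k) \<and>
       0 < t' \<and> u2 = of_real t' * (a * z ^ k * (1 + z))"
proof -
  have flag: "\<exists>s t. 0 < s \<and> u1 = of_real s * a \<and> 0 < t \<and> u2 = of_real t * (a * (1 + z))"
    if us: "us \<in> face_cycles U d F" and w: "wedge us a 0 (a * z)" and z: "cmod z = 1"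
      and u: "is_midpoint U d 0 a u1" "is_centre U d us u2" for us a z u1 u2
  proof -
    have a: "a \<in> U" "a \<noteq> 0" using edge_in [OF fc_cp [OF us] wedge_edge(1) [OF w]] cp_sub [OF fc_cp [OF us]] by auto
    show ?thesis
      using midpoint_from_zero [OF a u(1)] centre_direction [OF fc_regular [OF us] w z u(2)] by metis
  qed
  obtain vs a where vs: "vs \<in> face_cycles U d F" "edge vs 0 a" "is_midpoint U d 0 a v1" "is_centre U d vs v2"
    using bt barycentric_triangle_iff by blast
  obtain b where "wedge vs b 0 a" using edge_wedge [OF cp_ne [OF fc_cp [OF vs(1)]] vs(2)] by blast
  then have w: "wedge vs a 0 b" by (simp add: wedge_sym)
  obtain z where z: "root_pair n z" "b = a * z" "\<And>k. \<exists>us\<in>face_cycles U d F. wedge us (a * z ^ k) 0 (a * z ^ (k + 1))"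
    using fan [OF vs(1) w] by metis
  have z1: "cmod z = 1" using z(1) by (auto simp: root_pair_def)
  have new: "\<exists>u1 u2 s' t'. barycentric_triangle U d F 0 u1 u2 \<and> 0 < s' \<and> u1 = of_real s' * (a * z ^ k) \<and>
       0 < t' \<and> u2 = of_real t' * (a * z ^ k * (1 + z))" for k
  proof -
    obtain us where us: "us \<in> face_cycles U d F" "wedge us (a * z ^ k) 0 (a * z ^ (k + 1))" using z(3) by blast
    have e: "edge us 0 (a * z ^ k)" by (rule wedge_edge(1) [OF us(2)])
    have "a * z ^ k \<in> U" using edge_in [OF fc_cp [OF us(1)] e] cp_sub [OF fc_cp [OF us(1)]] by auto
    then obtain u1 u2 where u: "is_midpoint U d 0 (a * z ^ k) u1" "is_centre U d us u2"
      using midpoint_exists [OF zero_in] centre_exists [OF fc_regular [OF us(1)]] by blast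
    have "wedge us (a * z ^ k) 0 (a * z ^ k * z)" using us(2) by (simp add: mult_ac)
    moreover have "barycentric_triangle U d F 0 u1 u2" using us(1) e u barycentric_triangle_iff by blast
    ultimately show ?thesis using flag [OF us(1) _ z1 u] by blast
  qed
  show ?thesis using flag [OF vs(1) w [unfolded z(2)] z1 vs(3,4)] that [OF z(1) _ _ _ _ new] by blast
qed

text \<open>For even \<open>n\<close> the triangle turned by \<open>z ^ (n div 2) = - 1\<close> is
  opposite. For odd \<open>n\<close> an edge direction is opposite to a bisector and conversely, by
  \<open>root_pair_odd\<close> and \<open>root_pair_odd_shift\<close>.\<close>

lemma continue_at_vertex:
  assumes bt: "barycentric_triangle U d F 0 v1 v2"
  shows "\<exists>u1 u2. barycentric_triangle U d F 0 u1 u2 \<and> 0 \<in> closed_segment v1 (if even n then u1 else u2)"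
    and "\<exists>u1 u2. barycentric_triangle U d F 0 u1 u2 \<and> 0 \<in> closed_segment v2 (if even n then u2 else u1)"
proof -
  obtain a z s t where z: "root_pair n z" and v1: "0 < s" "v1 = of_real s * a" and v2: "0 < t" "v2 = of_real t * (a * (1 + z))"
    and new: "\<And>k. \<exists>u1 u2 s' t'. barycentric_triangle U d F 0 u1 u2 \<and> 0 < s' \<and> u1 = of_real s' * (a * z ^ k) \<and>
       0 < t' \<and> u2 = of_real t' * (a * z ^ k * (1 + z))"
    using fan_flags [OF bt] by metis
  obtain u1 u2 s' t' where u: "barycentric_triangle U d F 0 u1 u2" "0 < s'" "u1 = of_real s' * (a * z ^ (n div 2))"
       "0 < t'" "u2 = of_real t' * (a * z ^ (n div 2) * (1 + z))" using new by blast
  have through: "(0 \<in> closed_segment v1 (if even n then u1 else u2)) \<and>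
    (even n \<longrightarrow> 0 \<in> closed_segment v2 u2)"
  proof (cases "even n")
    case True
    then have "z ^ (n div 2) = - 1" by (rule root_pair_even [OF z])
    then have "u1 = of_real (- s') * a" "u2 = of_real (- t') * (a * (1 + z))" by (simp_all add: u)
    then show ?thesis
      using zero_in_segment [OF v1(2), of u1 "- s'"] zero_in_segment [OF v2(2), of u2 "- t'"] v1 v2 u True by simp
  next
    case False
    then obtain r where r: "r > 0" "z ^ (n div 2) * (1 + z) = - of_real r" using root_pair_odd [OF z] by metis
    have "u2 = of_real t' * (a * (z ^ (n div 2) * (1 + z)))" by (simp add: u mult.assoc)
    then have "u2 = of_real (- (t' * r)) * a" unfolding r(2) by simp
    then show ?thesis using zero_in_segment [OF v1(2), of u2 "- (t' * r)"] v1 u r False by simp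
  qed
  then show "\<exists>u1 u2. barycentric_triangle U d F 0 u1 u2 \<and> 0 \<in> closed_segment v1 (if even n then u1 else u2)"
    using u(1) by blast
  show "\<exists>u1 u2. barycentric_triangle U d F 0 u1 u2 \<and> 0 \<in> closed_segment v2 (if even n then u2 else u1)"
  proof (cases "even n")
    case True
    then have "0 \<in> closed_segment v2 (if even n then u2 else u1)" using through by simp
    then show ?thesis using u(1) by blast
  next
    case False
    \<comment> \<open>For odd \<open>n\<close> the edge opposite to a face-centre has index
      \<open>n div 2 + 1\<close>, one more than the sector opposite to an edge.\<close>
    obtain u1 u2 s' where u: "barycentric_triangle U d F 0 u1 u2" "0 < s'" "u1 = of_real s' * (a * z ^ (n div 2 + 1))"
      using new by blast
    obtain r where r: "r > 0" "1 + z = - of_real r * z ^ (n div 2 + 1)" using root_pair_odd_shift [OF z False] by metis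
    have "v2 = of_real (- (t * r)) * (a * z ^ (n div 2 + 1))" unfolding v2 r(2) by simp
    then show ?thesis using zero_in_segment [OF _ u(3), of v2 "- (t * r)"] v2(1) u(1,2) r(1) False by auto
  qed
qed

text \<open>The computation at a vertex repeated inside one face, with \<open>m\<close> for
  \<open>n\<close>: corners are multiples of powers of \<open>w\<close>, and side midpoints lie on
  the bisectors by \<open>midpoint_equal_norm\<close>.\<close>

lemma continue_at_centre:
  assumes bt: "barycentric_triangle U d F v0 v1 0"
  shows "\<exists>u0 u1. barycentric_triangle U d F u0 u1 0 \<and> 0 \<in> closed_segment v0 (if even m then u0 else u1)"
    and "\<exists>u0 u1. barycentric_triangle U d F u0 u1 0 \<and> 0 \<in> closed_segment v1 (if even m then u1 else u0)"
proof -
  obtain vs b where vs: "vs \<in> face_cycles U d F" "edge vs v0 b" "is_midpoint U d v0 b v1" "is_centre U d vs 0"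
    using bt barycentric_triangle_iff by blast
  note cp = fc_cp [OF vs(1)] and r = fc_regular [OF vs(1)]
  let ?c = "corner vs"
  obtain w where w: "w = cis (2 * pi / length vs) \<or> w = cis (- (2 * pi / length vs))" "?c 0 \<noteq> 0" "\<And>i. ?c i = ?c 0 * w ^ i"
    using normal_form [OF r vs(4)] by blast
  have rp: "root_pair m w" using w(1) cp_len [OF cp] fc_length [OF vs(1)] by (simp add: root_pair_def)
  have w1: "cmod w = 1" using w(1) by auto
  have cU: "?c i \<in> U" for i by (rule cp_corner_in [OF cp])
  have cn: "cmod (?c i) = cmod (?c 0)" for i using w(3) [of i] w1 by (simp add: norm_mult norm_power)
  have cadd: "?c (i + j) = ?c i * w ^ j" for i j using w(3) [of i] w(3) [of "i + j"] by (simp add: power_add)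
  define mid where "mid = (\<lambda>i. (1/2) *\<^sub>R (?c i + ?c (i + 1)))"
  have mid: "is_midpoint U d (?c i) (?c (i + 1)) (mid i)" for i
    unfolding mid_def by (rule midpoint_equal_norm [OF cU cU]) (simp only: cn [of i] cn [of "i + 1"])
  have midw: "mid i = of_real (1/2) * (?c i * (1 + w))" for i
    unfolding mid_def cadd by (simp add: scaleR_conv_of_real algebra_simps)
  have tri: "barycentric_triangle U d F (?c i) (mid i) 0" for i
    unfolding barycentric_triangle_iff using vs(1,4) edge_corner mid by blast
  define h where "h = m div 2"
  obtain i where i: "v0 = ?c i" using in_set_corner [of v0 vs] edge_in [OF cp vs(2)] by blast
  have "0 \<in> closed_segment (?c i) (if even m then ?c (i + h) else mid (i + h))" for i
  proof (cases "even m")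
    case True
    then have "?c (i + h) = of_real (- 1) * ?c i" unfolding cadd using root_pair_even [OF rp] by (simp add: h_def)
    then show ?thesis using zero_in_segment [of "?c i" 1 "?c i" "?c (i + h)" "- 1"] True by simp
  next
    case False
    then obtain q where q: "q > 0" "w ^ h * (1 + w) = - of_real q" using root_pair_odd [OF rp] unfolding h_def by metis
    have "mid (i + h) = of_real (1/2) * (?c i * (w ^ h * (1 + w)))" by (simp add: midw cadd mult.assoc)
    then have "mid (i + h) = of_real (- (q / 2)) * ?c i" unfolding q(2) by simp
    then show ?thesis using zero_in_segment [of "?c i" 1 "?c i" "mid (i + h)" "- (q / 2)"] q False by simp
  qed
  then show "\<exists>u0 u1. barycentric_triangle U d F u0 u1 0 \<and> 0 \<in> closed_segment v0 (if even m then u0 else u1)"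
    using tri i by blast
  \<comment> \<open>The side through \<open>v1\<close> may leave \<open>v0\<close> in either
    direction along the list; \<open>j\<close> is the index where it starts, so that
    \<open>v1\<close> is \<open>mid j\<close>.\<close>
  obtain j where j: "v0 = ?c j \<and> b = ?c (j + 1) \<or> v0 = ?c (j + 1) \<and> b = ?c j" using vs(2) unfolding edge_def by blast
  then have "is_midpoint U d (?c j) (?c (j + 1)) v1" using vs(3) midpoint_sym by blast
  then have v1: "v1 = mid j" using midpoint_unique [OF cU cU _ mid] by blast
  show "\<exists>u0 u1. barycentric_triangle U d F u0 u1 0 \<and> 0 \<in> closed_segment v1 (if even m then u1 else u0)"
  proof (cases "even m")
    case True
    then have "w ^ h = - 1" using root_pair_even [OF rp] by (simp add: h_def)
    then have "mid (j + h) = of_real (- 1) * mid j" by (simp add: midw cadd)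
    then have "0 \<in> closed_segment v1 (mid (j + h))" using zero_in_segment [of "mid j" 1 "mid j" "mid (j + h)" "- 1"] v1 by simp
    then show ?thesis using tri [of "j + h"] True by auto
  next
    case False
    then obtain q where q: "q > 0" "1 + w = - of_real q * w ^ (h + 1)" using root_pair_odd_shift [OF rp] unfolding h_def by metis
    have "mid j = of_real (1/2) * (?c j * (- of_real q * w ^ (h + 1)))" unfolding midw q(2) [symmetric] ..
    then have "mid j = of_real (- (q / 2)) * ?c (j + (h + 1))" unfolding cadd by simp
    then have "0 \<in> closed_segment v1 (?c (j + (h + 1)))"
      using zero_in_segment [of "mid j" "- (q / 2)" "?c (j + (h + 1))" "?c (j + (h + 1))" 1] v1 q by simp
    then show ?thesis using tri [of "j + (h + 1)"] False by auto
  qed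
qed

text \<open>Along the side one passes from \<open>v0\<close> to its other end \<open>b\<close>.
  Across it, both face-centres are equidistant from \<open>v0\<close> and \<open>b = - v0\<close>,
  hence on the line of \<open>\<i> * v0\<close>, and the two faces lie on opposite sides.\<close>

lemma continue_at_edge:
  assumes bt: "barycentric_triangle U d F v0 0 v2"
  shows "\<exists>u0. barycentric_triangle U d F u0 0 v2 \<and> 0 \<in> closed_segment v0 u0"
    and "\<exists>u2. barycentric_triangle U d F v0 0 u2 \<and> 0 \<in> closed_segment v2 u2"
proof -
  obtain vs b where vs: "vs \<in> face_cycles U d F" "edge vs v0 b" "is_midpoint U d v0 b 0" "is_centre U d vs v2"
    using bt barycentric_triangle_iff by blast
  note cp = fc_cp [OF vs(1)] and r = fc_regular [OF vs(1)]
  have U: "v0 \<in> U" "b \<in> U" "v0 \<noteq> b" using edge_in [OF cp vs(2)] cp_sub [OF cp] by auto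
  have os: "0 \<in> open_segment v0 b" by (rule midpoint_open_segment [OF U vs(3)])
  have "barycentric_triangle U d F b 0 v2" unfolding barycentric_triangle_iff using vs edge_sym midpoint_sym by metis
  then show "\<exists>u0. barycentric_triangle U d F u0 0 v2 \<and> 0 \<in> closed_segment v0 u0"
    using os by (auto simp: open_segment_def)
  have "d 0 v0 = d 0 b" using vs(3) d_sym [of 0 v0] by (simp add: is_midpoint_def)
  then have nb: "cmod v0 = cmod b" using norm_dist [OF U(1,2)] by simp
  \<comment> \<open>A segment through 0 with ends of equal modulus has 0 at
    \<open>t = 1 / 2\<close>, so the ends are opposite.\<close>
  obtain t where t: "0 < t" "t < 1" "0 = (1 - t) *\<^sub>R v0 + t *\<^sub>R b" using os by (auto simp: in_segment)
  have v00: "v0 \<noteq> 0" using os by (auto simp: open_segment_def)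
  have tb: "t *\<^sub>R b = - ((1 - t) *\<^sub>R v0)" using t(3) by (metis add.commute add_eq_0_iff)
  then have "cmod (t *\<^sub>R b) = cmod ((1 - t) *\<^sub>R v0)" by simp
  then have "t * cmod v0 = (1 - t) * cmod v0" using t nb by simp
  then have th: "t = 1 / 2" using v00 by simp
  have bv: "b = - v0" using tb unfolding th by (simp add: complex_eq_iff)
  obtain us where us: "us \<in> face_cycles U d F" "edge us v0 b"
    "\<forall>x\<in>set us. \<forall>y\<in>set vs. x \<noteq> v0 \<longrightarrow> x \<noteq> b \<longrightarrow> y \<noteq> v0 \<longrightarrow> y \<noteq> b \<longrightarrow> orient v0 b x * orient v0 b y < 0"
    using neighbour_face [OF vs(1,2)] by blast
  obtain u2 where u2: "is_centre U d us u2" using centre_exists [OF fc_regular [OF us(1)]] by blast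
  obtain y where y: "y \<in> set vs" "y \<noteq> v0" "y \<noteq> b" using third_corner [OF cp vs(2)] .
  obtain x where x: "x \<in> set us" "x \<noteq> v0" "x \<noteq> b" using third_corner [OF fc_cp [OF us(1)] us(2)] .
  have "0 < orient v0 b v2 * orient v0 b y" by (rule centre_inside(2) [OF r vs(4,2) y])
  moreover have "0 < orient v0 b u2 * orient v0 b x" by (rule centre_inside(2) [OF fc_regular [OF us(1)] u2 us(2) x])
  moreover have "orient v0 b x * orient v0 b y < 0" using us(3) x y by blast
  ultimately have opp: "orient v0 b v2 * orient v0 b u2 < 0" by (auto simp: zero_less_mult_iff mult_less_0_iff)
  have oq: "orient v0 b q = - 2 * Im (cnj v0 * q)" for q by (simp add: orient_def bv algebra_simps)
  have perp: "q = of_real (Im (cnj v0 * q) / (cmod v0)\<^sup>2) * (\<i> * v0)" if q: "q \<in> U" "d q v0 = d q b" for q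
  proof -
    have "cmod (q - v0) = cmod (q - b)" using equidistant [OF q(1) U(1,2) nb] q(2) by simp
    then have "(cmod (q - v0))\<^sup>2 = (cmod (q + v0))\<^sup>2" by (simp add: bv)
    then have re: "Re (cnj v0 * q) = 0" unfolding cmod_power2 by (simp add: power2_eq_square algebra_simps)
    have "v0 * (cnj v0 * q) = of_real ((cmod v0)\<^sup>2) * q" unfolding complex_norm_square by simp
    moreover have "cnj v0 * q = \<i> * of_real (Im (cnj v0 * q))" using re by (simp add: complex_eq_iff)
    ultimately have "of_real ((cmod v0)\<^sup>2) * q = v0 * (\<i> * of_real (Im (cnj v0 * q)))" by metis
    then show ?thesis using v00 by (simp add: field_simps)
  qed
  have c2: "v2 \<in> U" "d v2 v0 = d v2 b" using vs(4) edge_in [OF cp vs(2)] unfolding is_centre_def by blast+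
  have c2': "u2 \<in> U" "d u2 v0 = d u2 b" using u2 edge_in [OF fc_cp [OF us(1)] us(2)] unfolding is_centre_def by blast+
  have "0 \<in> closed_segment v2 u2"
  proof (rule zero_in_segment [OF perp [OF c2] perp [OF c2']])
    have "Im (cnj v0 * v2) * Im (cnj v0 * u2) < 0" using opp unfolding oq by (auto simp: mult_less_0_iff)
    then show "Im (cnj v0 * v2) / (cmod v0)\<^sup>2 * (Im (cnj v0 * u2) / (cmod v0)\<^sup>2) < 0"
      using v00 by (auto simp: mult_less_0_iff divide_less_0_iff zero_less_divide_iff)
  qed
  moreover have "barycentric_triangle U d F v0 0 u2" unfolding barycentric_triangle_iff using us u2 vs(3) by blast
  ultimately show "\<exists>u2. barycentric_triangle U d F v0 0 u2 \<and> 0 \<in> closed_segment v2 u2" by blast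
qed

lemma continue_at_origin:
  assumes bt: "barycentric_triangle U d F (v 0) (v 1) (v 2)" and l0: "v l = 0" and kl: "k < 3" "l < 3" "k \<noteq> l"
  shows "\<exists>u. barycentric_triangle U d F (u 0) (u 1) (u 2) \<and> u l = 0 \<and> 0 \<in> closed_segment (v k) (u (next_label m n k l))"
proof -
  define tr :: "complex \<Rightarrow> complex \<Rightarrow> complex \<Rightarrow> nat \<Rightarrow> complex" where
    "tr = (\<lambda>a b c i. if i = 0 then a else if i = 1 then b else c)"
  have tr: "tr a b c 0 = a" "tr a b c 1 = b" "tr a b c 2 = c" for a b c by (simp_all add: tr_def)
  have "k = 0 \<and> l = 1 \<or> k = 2 \<and> l = 1 \<or> k = 1 \<and> l = 0 \<or> k = 2 \<and> l = 0 \<or> k = 0 \<and> l = 2 \<or> k = 1 \<and> l = 2" using kl by linarith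
  then consider (a) "k = 0" "l = 1" | (b) "k = 2" "l = 1" | (c) "k = 1" "l = 0" | (d) "k = 2" "l = 0" | (e) "k = 0" "l = 2" | (f) "k = 1" "l = 2" by blast
  then show ?thesis
  proof cases
    case a
    then obtain u0 where "barycentric_triangle U d F u0 0 (v 2)" "0 \<in> closed_segment (v 0) u0"
      using continue_at_edge(1) bt l0 by metis
    then show ?thesis using a by (intro exI [of _ "tr u0 0 (v 2)"]) (simp add: tr_def next_label_def)
  next
    case b
    then obtain u2 where "barycentric_triangle U d F (v 0) 0 u2" "0 \<in> closed_segment (v 2) u2"
      using continue_at_edge(2) bt l0 by metis
    then show ?thesis using b by (intro exI [of _ "tr (v 0) 0 u2"]) (simp add: tr_def next_label_def)
  next
    case c
    then obtain u1 u2 where "barycentric_triangle U d F 0 u1 u2" "0 \<in> closed_segment (v 1) (if even n then u1 else u2)"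
      using continue_at_vertex(1) bt l0 by metis
    then show ?thesis using c by (intro exI [of _ "tr 0 u1 u2"]) (auto simp: tr_def next_label_def)
  next
    case d
    then obtain u1 u2 where "barycentric_triangle U d F 0 u1 u2" "0 \<in> closed_segment (v 2) (if even n then u2 else u1)"
      using continue_at_vertex(2) bt l0 by metis
    then show ?thesis using d by (intro exI [of _ "tr 0 u1 u2"]) (auto simp: tr_def next_label_def)
  next
    case e
    then obtain u0 u1 where "barycentric_triangle U d F u0 u1 0" "0 \<in> closed_segment (v 0) (if even m then u0 else u1)"
      using continue_at_centre(1) bt l0 by metis
    then show ?thesis using e by (intro exI [of _ "tr u0 u1 0"]) (auto simp: tr_def next_label_def)
  next
    case f
    then obtain u0 u1 where "barycentric_triangle U d F u0 u1 0" "0 \<in> closed_segment (v 1) (if even m then u1 else u0)"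
      using continue_at_centre(2) bt l0 by metis
    then show ?thesis using f by (intro exI [of _ "tr u0 u1 0"]) (auto simp: tr_def next_label_def)
  qed
qed

end

text \<open>Move \<open>y\<close> to the origin, continue there and move back. The preceding results
  are applied to the image tessellation \<open>F'\<close>, which is why this stands outside the
  context that fixes \<open>F\<close>.\<close>

lemma continue_flag:
  assumes tess: "regular_tessellation U d m n F" and f: "flag_side F k l x y"
  shows "\<exists>z. flag_side F l (next_label m n k l) y z \<and> y \<in> closed_segment x z"
proof -
  obtain v where v: "k < 3" "l < 3" "k \<noteq> l" "barycentric_triangle U d F (v 0) (v 1) (v 2)" "x = v k" "y = v l"
    using f unfolding flag_side_def by blast
  have xy: "x \<in> U" "y \<in> U" using flag_side_points [OF tess f] by auto
  obtain h where h: "isom U d U d h" "h y = 0" using homogeneous [OF xy(2)] by blast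
  interpret H: isom U d U d h by (rule h)
  interpret I: isom U d U d "inv_into U h" by (rule H.inverse)
  have FU: "\<Union> F \<subseteq> U" using tessellation_Union [OF tess] by simp
  define F' where "F' = (`) h ` F"
  have tess': "regular_tessellation U d m n F'" unfolding F'_def by (rule H.regular_tessellation_image [OF tess])
  have FU': "\<Union> F' \<subseteq> U" using tessellation_Union [OF tess'] by simp
  have F_back: "(`) (inv_into U h) ` F' = F" unfolding F'_def by (rule H.image_family_inverse [OF FU])
  have bt': "barycentric_triangle U d F' (h (v 0)) (h (v 1)) (h (v 2))"
    unfolding F'_def by (rule H.barycentric_triangle_image [OF FU v(4)])
  obtain u where u: "barycentric_triangle U d F' (u 0) (u 1) (u 2)" "u l = 0" "0 \<in> closed_segment (h x) (u (next_label m n k l))"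
    using continue_at_origin [OF tess', of "\<lambda>i. h (v i)" l k] bt' v h(2) by auto
  define g where "g = inv_into U h"
  define j where "j = next_label m n k l"
  have j: "j < 3" "j \<noteq> l" using v(1-3) by (auto simp: j_def next_label_def)
  have "barycentric_triangle U d F (g (u 0)) (g (u 1)) (g (u 2))"
    using I.barycentric_triangle_image [OF FU' u(1)] F_back by (simp add: g_def)
  moreover have g0: "g (u l) = y" using u(2) h(2) xy H.inv_h by (metis g_def)
  ultimately have fs: "flag_side F l j y (g (u j))"
    unfolding flag_side_def using v(2) j by (auto intro!: exI [of _ "\<lambda>i. g (u i)"])
  have "flag_side F' l j 0 (u j)"
    unfolding flag_side_def using u v(2) j by (auto intro!: exI [of _ u])
  then have uU: "u j \<in> U" using flag_side_points [OF tess'] by blast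
  have "0 \<in> seg U d (h x) (u j)" using u(3) seg_eq xy uU by (simp add: j_def)
  then have "h y \<in> seg U d (h x) (h (g (u j)))" using h(2) uU by (simp add: g_def)
  moreover have gU: "g (u j) \<in> U" using uU by (simp add: g_def)
  ultimately have "y \<in> seg U d x (g (u j))" using H.seg_iff [OF xy(1) gU xy(2)] by blast
  then have "y \<in> closed_segment x (g (u j))" using seg_eq [OF xy(1) gU] by simp
  then show ?thesis using fs by (auto simp: j_def)
qed

context
  fixes m n :: nat and F :: "complex set set"
  assumes tess: "regular_tessellation U d m n F"
begin

subsection \<open>Walking along a mirror\<close>

lemma finite_own_points:
  assumes "vs \<in> face_cycles U d F" shows "finite {x. \<exists>k. own_point vs k x}"
proof -
  note cp = fc_cp [OF tess assms]
  have sing: "finite S" if "\<And>x y. x \<in> S \<Longrightarrow> y \<in> S \<Longrightarrow> x = y" for S :: "complex set"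
  proof (cases "S = {}")
    case False
    then obtain x where "x \<in> S" by blast
    then have "S \<subseteq> {x}" using that by blast
    then show ?thesis by (rule finite_subset) simp
  qed simp
  have fm: "finite {x. is_midpoint U d a b x}" if "a \<in> set vs" "b \<in> set vs" for a b
    by (rule sing) (use midpoint_unique that cp_sub [OF cp] in blast)
  have fc: "finite {x. is_centre U d vs x}"
    by (rule sing) (use centre_unique [OF fc_regular [OF tess assms]] in blast)
  have "{x. \<exists>k. own_point vs k x} \<subseteq> set vs \<union> (\<Union>a\<in>set vs. \<Union>b\<in>set vs. {x. is_midpoint U d a b x}) \<union> {x. is_centre U d vs x}"
    unfolding own_point_def using edge_in [OF cp] by blast
  moreover have "finite (set vs \<union> (\<Union>a\<in>set vs. \<Union>b\<in>set vs. {x. is_midpoint U d a b x}) \<union> {x. is_centre U d vs x})"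
    using fm fc by auto
  ultimately show ?thesis by (rule finite_subset)
qed

text \<open>A geometric point near \<open>p\<close> belongs to one of the finitely many faces near
  \<open>p\<close>. A face has several corner lists, but by \<open>own_same_region\<close> one of
  them accounts for all.\<close>

lemma locally_finite_points:
  assumes p: "p \<in> U"
  shows "\<exists>r>0. finite {x. (\<exists>k. x \<in> geom_points U d F k) \<and> d p x < r}"
proof -
  obtain r where r: "r > 0" "finite {f \<in> F. \<exists>y \<in> f. d p y < r}" using tessellation_finite [OF tess p] by blast
  define A where "A = {f \<in> F. \<exists>y \<in> f. d p y < r}"
  define pts where "pts = (\<lambda>f. {x. \<exists>vs\<in>face_cycles U d F. region U d vs = f \<and> (\<exists>k. own_point vs k x)})"
  have "finite (pts f)" if f: "f \<in> A" for f
  proof -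
    obtain vs where vs: "vs \<in> face_cycles U d F" "region U d vs = f" using f face_cycle_exists [OF tess] unfolding A_def by blast
    have "pts f \<subseteq> {x. \<exists>k. own_point vs k x}"
    proof
      fix x assume "x \<in> pts f"
      then obtain us k where us: "us \<in> face_cycles U d F" "region U d us = f" "own_point us k x" unfolding pts_def by blast
      then have "own_point vs k x" using own_same_region [OF tess us(1) vs(1) _ us(3)] vs(2) by simp
      then show "x \<in> {x. \<exists>k. own_point vs k x}" by blast
    qed
    then show ?thesis using finite_own_points [OF vs(1)] by (rule finite_subset)
  qed
  moreover have "finite A" using r(2) by (simp add: A_def)
  ultimately have "finite (\<Union>f\<in>A. pts f)" by blast
  moreover have "{x. (\<exists>k. x \<in> geom_points U d F k) \<and> d p x < r} \<subseteq> (\<Union>f\<in>A. pts f)"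
  proof
    fix x assume "x \<in> {x. (\<exists>k. x \<in> geom_points U d F k) \<and> d p x < r}"
    then obtain k where k: "x \<in> geom_points U d F k" "d p x < r" by blast
    then obtain vs where vs: "vs \<in> face_cycles U d F" "own_point vs k x" using geom_points_iff [OF tess] by blast
    have "x \<in> region U d vs" by (rule own_in_region [OF fc_regular [OF tess vs(1)] vs(2)])
    then have "region U d vs \<in> A" using fc_face [OF tess vs(1)] k(2) unfolding A_def by blast
    moreover have "x \<in> pts (region U d vs)" using vs unfolding pts_def by blast
    ultimately show "x \<in> (\<Union>f\<in>A. pts f)" by blast
  qed
  ultimately have "finite {x. (\<exists>k. x \<in> geom_points U d F k) \<and> d p x < r}" by (rule finite_subset [rotated])
  then show ?thesis using r(1) by blast
qed

section \<open>Walks along one parametrised line\<close>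

context
  fixes \<gamma> :: "real \<Rightarrow> complex" and x0 y0 :: complex
  assumes xy0: "x0 \<in> U" "y0 \<in> U" "x0 \<noteq> y0"
    and iso: "\<And>a b. d (\<gamma> a) (\<gamma> b) = \<bar>a - b\<bar>"
    and range: "range \<gamma> = line_through U d x0 y0"
begin

lemma gamma_line: "\<gamma> a \<in> U" "orient x0 y0 (\<gamma> a) = 0"
proof -
  have "\<gamma> a \<in> line_through U d x0 y0" using range by blast
  then show "\<gamma> a \<in> U" "orient x0 y0 (\<gamma> a) = 0" unfolding line_eq [OF xy0] by auto
qed

lemma gamma_eq_iff: "\<gamma> a = \<gamma> b \<longleftrightarrow> a = b"
  using d_zero [OF gamma_line(1) gamma_line(1), of a b] iso [of a b] by simp

text \<open>The continuation stays on the line because \<open>orient x0 y0\<close> is affine and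
  vanishes at two distinct points of the segment; betweenness of \<open>\<gamma> b\<close> makes the
  parameter increase.\<close>

lemma walk_step:
  assumes f: "flag_side F k l (\<gamma> a) (\<gamma> b)" and ab: "a < b"
  shows "\<exists>c>b. flag_side F l (next_label m n k l) (\<gamma> b) (\<gamma> c)"
proof -
  obtain z where z: "flag_side F l (next_label m n k l) (\<gamma> b) z" "\<gamma> b \<in> closed_segment (\<gamma> a) z"
    using continue_flag [OF tess f] by blast
  have zU: "z \<in> U" "\<gamma> b \<noteq> z" using flag_side_points [OF tess z(1)] by auto
  obtain t where t: "\<gamma> b = (1 - t) *\<^sub>R \<gamma> a + t *\<^sub>R z" using z(2) by (auto simp: closed_segment_def)
  have "t \<noteq> 0" using t gamma_eq_iff [of b a] ab by auto
  moreover have "t * orient x0 y0 z = 0"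
    using gamma_line(2) [of b] gamma_line(2) [of a] unfolding t orient_affine by simp
  ultimately have "z \<in> line_through U d x0 y0" unfolding line_eq [OF xy0] using zU by simp
  then obtain c where c: "z = \<gamma> c" using range by (metis imageE)
  have "\<gamma> b \<in> seg U d (\<gamma> a) (\<gamma> c)" using z(2) seg_eq [OF gamma_line(1) gamma_line(1)] c by simp
  then have "\<bar>a - b\<bar> + \<bar>b - c\<bar> = \<bar>a - c\<bar>" by (simp add: seg_def iso)
  moreover have "b \<noteq> c" using zU c by auto
  ultimately have "b < c" using ab by linarith
  then show ?thesis using z c by blast
qed

text \<open>Bounded times would converge, and infinitely many geometric points would accumulate at
  the limit point of the line, against \<open>locally_finite_points\<close>.\<close>

lemma walk:
  assumes f: "flag_side F (lab 0) (lab 1) (\<gamma> a) (\<gamma> b)" and ab: "a < b"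
    and lab: "\<And>i. lab (i + 2) = next_label m n (lab i) (lab (i + 1))"
  obtains t :: "nat \<Rightarrow> real" where "t 0 = a" "t 1 = b" "strict_mono t"
    "\<And>i. flag_side F (lab i) (lab (i + 1)) (\<gamma> (t i)) (\<gamma> (t (i + 1)))" "\<And>M. \<exists>i. M < t i"
proof -
  \<comment> \<open>The state is a pair of consecutive times; the clause for \<open>i = 0\<close>
    pins the start, which \<open>dependent_nat_choice\<close> by itself leaves open.\<close>
  define P where "P = (\<lambda>i (p, q). p < q \<and> flag_side F (lab i) (lab (i + 1)) (\<gamma> p) (\<gamma> q) \<and> (i = 0 \<longrightarrow> p = a \<and> q = b))"
  have "\<exists>f. \<forall>i. P i (f i) \<and> fst (f (Suc i)) = snd (f i)"
  proof (rule dependent_nat_choice)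
    show "\<exists>x. P 0 x" using f ab by (intro exI [of _ "(a, b)"]) (simp add: P_def)
    fix x i assume "P i x"
    then obtain p q where pq: "x = (p, q)" "p < q" "flag_side F (lab i) (lab (i + 1)) (\<gamma> p) (\<gamma> q)"
      by (cases x) (auto simp: P_def)
    obtain c where c: "q < c" "flag_side F (lab (i + 1)) (next_label m n (lab i) (lab (i + 1))) (\<gamma> q) (\<gamma> c)"
      using walk_step [OF pq(3,2)] by blast
    then have "flag_side F (lab (Suc i)) (lab (Suc i + 1)) (\<gamma> q) (\<gamma> c)" using lab [of i] by simp
    then show "\<exists>y. P (Suc i) y \<and> fst y = snd x" using c pq by (intro exI [of _ "(q, c)"]) (simp add: P_def)
  qed
  then obtain f where f: "\<And>i. P i (f i)" "\<And>i. fst (f (Suc i)) = snd (f i)" by blast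
  define t where "t = (\<lambda>i. fst (f i))"
  have Pf: "t i < t (Suc i) \<and> flag_side F (lab i) (lab (i + 1)) (\<gamma> (t i)) (\<gamma> (t (Suc i))) \<and> (i = 0 \<longrightarrow> t i = a \<and> t (Suc i) = b)" for i
    using f(1) [of i] f(2) [of i] by (auto simp: P_def t_def split_beta)
  have sm: "strict_mono t" using Pf by (simp add: strict_mono_Suc_iff)
  have "\<exists>i. M < t i" for M
  proof (rule ccontr)
    assume "\<not> (\<exists>i. M < t i)"
    then have M: "t i \<le> M" for i by (meson not_le)
    have inc: "incseq t" using sm by (simp add: incseq_def strict_mono_less_eq)
    obtain L where L: "t \<longlonglongrightarrow> L" "\<forall>i. t i \<le> L" using incseq_convergent [OF inc, of M] M by blast
    obtain r where r: "r > 0" "finite {x. (\<exists>k. x \<in> geom_points U d F k) \<and> d (\<gamma> L) x < r}"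
      using locally_finite_points [OF gamma_line(1)] by blast
    obtain i0 where i0: "\<And>i. i \<ge> i0 \<Longrightarrow> dist (t i) L < r" using L(1) r(1) unfolding lim_sequentially by blast
    have "(\<lambda>i. \<gamma> (t i)) ` {i0..} \<subseteq> {x. (\<exists>k. x \<in> geom_points U d F k) \<and> d (\<gamma> L) x < r}"
    proof
      fix x assume "x \<in> (\<lambda>i. \<gamma> (t i)) ` {i0..}"
      then obtain i where i: "x = \<gamma> (t i)" "i \<ge> i0" by auto
      have "x \<in> geom_points U d F (lab i)" using flag_side_points(1) [OF tess] Pf [of i] i(1) by blast
      moreover have "d (\<gamma> L) x < r" using i0 [OF i(2)] i(1) by (simp add: iso dist_real_def abs_minus_commute)
      ultimately show "x \<in> {x. (\<exists>k. x \<in> geom_points U d F k) \<and> d (\<gamma> L) x < r}" by blast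
    qed
    then have "finite ((\<lambda>i. \<gamma> (t i)) ` {i0..})" using r(2) by (rule finite_subset)
    moreover have "inj_on (\<lambda>i. \<gamma> (t i)) {i0..}"
      using sm by (auto simp: inj_on_def gamma_eq_iff strict_mono_eq)
    ultimately have "finite {i0..}" by (rule finite_imageD)
    then show False using infinite_Ici by blast
  qed
  then show ?thesis using that [of t] Pf [of 0] sm Pf by simp
qed

end

text \<open>Two walks from the given side, along \<open>\<gamma>\<close> and along the reversed
  curve, are glued; \<open>rule2\<close> says that the word also obeys the rule when read backwards.
  Every time lies between consecutive \<open>t i\<close>, where \<open>flag_side_empty\<close>
  excludes further geometric points.\<close>

lemma pattern_of_flag:
  fixes w :: "nat list" and j :: int
  defines "V \<equiv> \<lambda>i::int. w ! nat (i mod int (length w))"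
  assumes f: "flag_side F (V j) (V (j + 1)) x y"
    and rule1: "\<And>i. next_label m n (V i) (V (i + 1)) = V (i + 2)"
    and rule2: "\<And>i. next_label m n (V (i + 2)) (V (i + 1)) = V i"
  shows "has_pattern U d F (line_through U d x y) w"
proof -
  have xy: "x \<in> U" "y \<in> U" "x \<noteq> y" using flag_side_points [OF tess f] by auto
  obtain \<gamma> :: "real \<Rightarrow> complex" and s where g: "\<And>a b. d (\<gamma> a) (\<gamma> b) = \<bar>a - b\<bar>"
    "range \<gamma> = line_through U d x y" "\<gamma> 0 = x" "\<gamma> s = y" "0 < s" using geodesic_line [OF xy] by metis
  define \<gamma>' where "\<gamma>' = (\<lambda>s. \<gamma> (- s))"
  have g': "\<And>a b. d (\<gamma>' a) (\<gamma>' b) = \<bar>a - b\<bar>" using g(1) by (simp add: \<gamma>'_def abs_minus_commute)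
  have "\<gamma> a \<in> range \<gamma>'" for a by (rule image_eqI [of _ _ "- a"]) (auto simp: \<gamma>'_def)
  then have r': "range \<gamma>' = line_through U d x y" unfolding g(2) [symmetric] by (auto simp: \<gamma>'_def)
  have f1: "flag_side F (V (j + int 0)) (V (j + int 1)) (\<gamma> 0) (\<gamma> s)" using f g by simp
  have lab1: "V (j + int (i + 2)) = next_label m n (V (j + int i)) (V (j + int (i + 1)))" for i
    using rule1 [of "j + int i"] by (simp add: add.assoc add.commute add.left_commute)
  obtain tf :: "nat \<Rightarrow> real" where tf: "tf 0 = 0" "tf 1 = s" "strict_mono tf"
    "\<And>i. flag_side F (V (j + int i)) (V (j + int (i + 1))) (\<gamma> (tf i)) (\<gamma> (tf (i + 1)))" "\<And>M. \<exists>i. M < tf i"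
    using walk [OF xy g(1,2) f1 g(5) lab1] by metis
  \<comment> \<open>The backward walk also begins with the given side, traversed from
    \<open>y\<close> to \<open>x\<close>; its index 1 is therefore the starting time 0 of the
    forward walk.\<close>
  have f2: "flag_side F (V (j + 1 - int 0)) (V (j + 1 - int 1)) (\<gamma>' (- s)) (\<gamma>' 0)"
    using f g flag_side_sym by (simp add: \<gamma>'_def)
  have lab2: "V (j + 1 - int (i + 2)) = next_label m n (V (j + 1 - int i)) (V (j + 1 - int (i + 1)))" for i
    using rule2 [of "j + 1 - int (i + 2)"] by (simp add: algebra_simps)
  have s0: "- s < 0" using g(5) by simp
  obtain tb :: "nat \<Rightarrow> real" where tb: "tb 0 = - s" "tb 1 = 0" "strict_mono tb"
    "\<And>i. flag_side F (V (j + 1 - int i)) (V (j + 1 - int (i + 1))) (\<gamma>' (tb i)) (\<gamma>' (tb (i + 1)))" "\<And>M. \<exists>i. M < tb i"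
    using walk [OF xy g' r' f2 s0 lab2] by metis
  \<comment> \<open>The offset \<open>j + 1 - i\<close> arises because the backward walk starts at
    index \<open>j + 1\<close>; both formulas give 0 at \<open>i = j\<close>.\<close>
  define t where "t = (\<lambda>i. if i \<ge> j then tf (nat (i - j)) else - tb (nat (j + 1 - i)))"
  have t1: "t i = tf (nat (i - j))" if "i \<ge> j" for i using that by (simp add: t_def)
  have t2: "t i = - tb (nat (j + 1 - i))" if "i \<le> j" for i
  proof (cases "i = j")
    case True then show ?thesis using tf(1) tb(2) by (simp add: t_def)
  qed (use that in \<open>simp add: t_def\<close>)
  have step: "t i < t (i + 1) \<and> flag_side F (V i) (V (i + 1)) (\<gamma> (t i)) (\<gamma> (t (i + 1)))" for i
  proof (cases "i \<ge> j")
    case True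
    define k where "k = nat (i - j)"
    have k: "i = j + int k" using True by (simp add: k_def)
    have "t i = tf k" "t (i + 1) = tf (k + 1)" using t1 k by (simp_all add: nat_add_distrib)
    then show ?thesis using tf(3) tf(4) [of k] k by (simp add: strict_mono_less add.assoc add.commute add.left_commute)
  next
    case False
    define k where "k = nat (j - i)"
    have k: "i = j - int k" "k > 0" using False by (auto simp: k_def)
    have e: "t i = - tb (k + 1)" "t (i + 1) = - tb k"
      using t2 [of i] t2 [of "i + 1"] k by (simp_all add: nat_add_distrib)
    have "tb k < tb (k + 1)" using tb(3) by (simp add: strict_mono_less)
    moreover have "flag_side F (V (i + 1)) (V i) (\<gamma> (t (i + 1))) (\<gamma> (t i))"
    proof -
      have idx: "j + 1 - int k = i + 1" "j + 1 - int (k + 1) = i" using k by simp_all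
      show ?thesis using tb(4) [of k] unfolding idx \<gamma>'_def e .
    qed
    ultimately show ?thesis using e flag_side_sym by simp
  qed
  have sm: "strict_mono t" using step by (intro strict_mono_int_step) simp
  have inj: "\<gamma> a = \<gamma> b \<longleftrightarrow> a = b" for a b by (rule gamma_eq_iff [OF xy g(1,2)])
  have gU: "\<gamma> a \<in> U" for a by (rule gamma_line(1) [OF xy g(1,2)])
  show ?thesis
    unfolding has_pattern_def
  proof (intro exI [of _ \<gamma>] exI [of _ t] conjI allI)
    show "d (\<gamma> r) (\<gamma> s) = \<bar>r - s\<bar>" for r s by (rule g(1))
    show "range \<gamma> = line_through U d x y" by (rule g(2))
    show "strict_mono t" by (rule sm)
    show lbl: "\<gamma> (t i) \<in> geom_points U d F k \<longleftrightarrow> k = w ! nat (i mod int (length w))" for i k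
    proof -
      have "\<gamma> (t i) \<in> geom_points U d F (V i)" using flag_side_points(1) [OF tess] step by blast
      then show ?thesis using label_unique [OF tess] V_def by metis
    qed
    show "{s. \<exists>k. \<gamma> s \<in> geom_points U d F k} = range t"
    proof
      show "range t \<subseteq> {s. \<exists>k. \<gamma> s \<in> geom_points U d F k}" using lbl by blast
      show "{s. \<exists>k. \<gamma> s \<in> geom_points U d F k} \<subseteq> range t"
      proof
        fix a assume "a \<in> {s. \<exists>k. \<gamma> s \<in> geom_points U d F k}"
        then obtain k where k: "\<gamma> a \<in> geom_points U d F k" by blast
        obtain n1 where "a < tf n1" using tf(5) by blast
        then have hi: "a < t (j + int n1)" using t1 by simp
        obtain n2 where "- a < tb n2" using tb(5) by blast
        also have "tb n2 \<le> tb (n2 + 1)" using tb(3) by (simp add: strict_mono_less_eq)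
        finally have lo: "t (j - int n2) \<le> a" using t2 [of "j - int n2"] by (simp add: nat_add_distrib)
        obtain i where i: "t i \<le> a" "a < t (i + 1)" using int_bracket [OF lo hi sm] by blast
        have "\<gamma> a \<in> seg U d (\<gamma> (t i)) (\<gamma> (t (i + 1)))" using i gU by (simp add: seg_def g(1))
        then have "\<gamma> a \<in> closed_segment (\<gamma> (t i)) (\<gamma> (t (i + 1)))" using seg_eq gU by simp
        then have "\<gamma> a = \<gamma> (t i) \<or> \<gamma> a = \<gamma> (t (i + 1))" using flag_side_empty [OF tess] step k by blast
        then show "a \<in> range t" using inj by auto
      qed
    qed
  qed
qed

text \<open>Reduces the conditions on the bi-infinite word to one check per letter of the link, with
  indices taken cyclically.\<close>

lemma pattern_of_flag_word:
  assumes w: "w \<noteq> []" and j: "j < length w"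
    and f: "flag_side F (w ! j) (w ! ((j + 1) mod length w)) x y"
    and r: "\<And>i. i < length w \<Longrightarrow> next_label m n (w ! i) (w ! ((i + 1) mod length w)) = w ! ((i + 2) mod length w)
        \<and> next_label m n (w ! ((i + 2) mod length w)) (w ! ((i + 1) mod length w)) = w ! i"
  shows "has_pattern U d F (line_through U d x y) w"
proof -
  have mod: "nat ((i + int c) mod int (length w)) = (nat (i mod int (length w)) + c) mod length w" for i c
  proof -
    have p: "0 < int (length w)" using w by simp
    have "int ((nat (i mod int (length w)) + c) mod length w) = (i mod int (length w) + int c) mod int (length w)"
      using p by (simp add: zmod_int)
    also have "\<dots> = (i + int c) mod int (length w)" by (simp add: mod_simps)
    finally show ?thesis by (metis nat_int)
  qed
  have b: "nat (i mod int (length w)) < length w" for i using w by (simp add: nat_less_iff)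
  show ?thesis
  proof (rule pattern_of_flag [where j = "int j"])
    have "nat (int j mod int (length w)) = j" using j by (simp flip: zmod_int)
    then show "flag_side F (w ! nat (int j mod int (length w))) (w ! nat ((int j + 1) mod int (length w))) x y"
      using f mod [of "int j" 1] by simp
    show "next_label m n (w ! nat (i mod int (length w))) (w ! nat ((i + 1) mod int (length w))) = w ! nat ((i + 2) mod int (length w))" for i
      using r [OF b [of i]] mod [of i 1] mod [of i 2] by simp
    show "next_label m n (w ! nat ((i + 2) mod int (length w))) (w ! nat ((i + 1) mod int (length w))) = w ! nat (i mod int (length w))" for i
      using r [OF b [of i]] mod [of i 1] mod [of i 2] by simp
  qed
qed

end

end

text \<open>\<open>A\<close>, \<open>B\<close>, \<open>C\<close> stand for the lines of the sides
  01, 12, 02. One predicate for all parities can be carried between models in a single step.\<close>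

definition mirror_patterns ::
  "'a set \<Rightarrow> ('a \<Rightarrow> 'a \<Rightarrow> real) \<Rightarrow> nat \<Rightarrow> nat \<Rightarrow> 'a set set \<Rightarrow> 'a set \<Rightarrow> 'a set \<Rightarrow> 'a set \<Rightarrow> bool" where
  "mirror_patterns X d m n F A B C \<longleftrightarrow>
     (odd m \<and> odd n \<longrightarrow> has_pattern X d F A [0,1,0,2,1,2] \<and> has_pattern X d F B [0,1,0,2,1,2] \<and>
        has_pattern X d F C [0,1,0,2,1,2]) \<and>
     (odd m \<and> even n \<longrightarrow> has_pattern X d F A [0,1] \<and> has_pattern X d F B [0,2,1,2] \<and> has_pattern X d F C [0,2,1,2]) \<and>
     (even m \<and> even n \<longrightarrow> has_pattern X d F A [0,1] \<and> has_pattern X d F B [1,2] \<and> has_pattern X d F C [0,2]) \<and>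
     (even m \<and> odd n \<longrightarrow> has_pattern X d F A [0,1,0,2] \<and> has_pattern X d F C [0,1,0,2] \<and> has_pattern X d F B [1,2])"

lemma (in model_plane) model_patterns:
  assumes tess: "regular_tessellation U d m n F" and bt: "barycentric_triangle U d F v0 v1 v2"
  shows "mirror_patterns U d m n F (line_through U d v0 v1) (line_through U d v1 v2) (line_through U d v0 v2)"
proof -
  have fl: "flag_side F 0 1 v0 v1" "flag_side F 1 2 v1 v2" "flag_side F 0 2 v0 v2"
    unfolding flag_side_def
    using bt by (auto intro!: exI [of _ "\<lambda>i::nat. if i = 0 then v0 else if i = 1 then v1 else v2"])
  have c2: "i = 0 \<or> i = 1" if "i < 2" for i :: nat using that by linarith
  have c4: "i = 0 \<or> i = 1 \<or> i = 2 \<or> i = 3" if "i < 4" for i :: nat using that by linarith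
  have c6: "i = 0 \<or> i = 1 \<or> i = 2 \<or> i = 3 \<or> i = 4 \<or> i = 5" if "i < 6" for i :: nat using that by linarith
  have w2: "has_pattern U d F (line_through U d x y) w"
    if w: "w = [k, l]" and f: "flag_side F k l x y" and r: "next_label m n k l = k" "next_label m n l k = l" for w k l x y
  proof (rule pattern_of_flag_word [OF tess, of _ 0])
    have len: "length w = 2" using w by simp
    show "w \<noteq> []" "0 < length w" "flag_side F (w ! 0) (w ! ((0 + 1) mod length w)) x y" using w f by auto
    fix i assume "i < length w"
    then have "i = 0 \<or> i = 1" using c2 len by simp
    then show "next_label m n (w ! i) (w ! ((i + 1) mod length w)) = w ! ((i + 2) mod length w) \<and>
      next_label m n (w ! ((i + 2) mod length w)) (w ! ((i + 1) mod length w)) = w ! i"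
      unfolding len using w r by (elim disjE) auto
  qed
  have w4: "has_pattern U d F (line_through U d x y) w"
    if w: "w \<in> {[0,2,1,2], [0,1,0,2]}" and j: "j < 4"
      and f: "flag_side F (w ! j) (w ! ((j + 1) mod 4)) x y"
      and p: "w = [0,2,1,2] \<Longrightarrow> odd m \<and> even n" "w = [0,1,0,2] \<Longrightarrow> even m \<and> odd n" for w j x y
  proof (rule pattern_of_flag_word [OF tess, of _ j])
    have l: "length w = 4" using w by auto
    show "w \<noteq> []" "j < length w" using l j by auto
    show "flag_side F (w ! j) (w ! ((j + 1) mod length w)) x y" using f l by simp
    fix i assume "i < length w"
    then have "i = 0 \<or> i = 1 \<or> i = 2 \<or> i = 3" using c4 l by simp
    then show "next_label m n (w ! i) (w ! ((i + 1) mod length w)) = w ! ((i + 2) mod length w) \<and>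
      next_label m n (w ! ((i + 2) mod length w)) (w ! ((i + 1) mod length w)) = w ! i"
      unfolding l using w p by (elim disjE) (auto simp: next_label_def)
  qed
  have w6: "has_pattern U d F (line_through U d x y) w"
    if w: "w = [0,1,0,2,1,2]" and j: "j < 6"
      and f: "flag_side F (w ! j) (w ! ((j + 1) mod 6)) x y" and p: "odd m" "odd n" for w j x y
  proof (rule pattern_of_flag_word [OF tess, of _ j])
    have l: "length w = 6" using w by auto
    show "w \<noteq> []" "j < length w" using l j by auto
    show "flag_side F (w ! j) (w ! ((j + 1) mod length w)) x y" using f l by simp
    fix i assume "i < length w"
    then have "i = 0 \<or> i = 1 \<or> i = 2 \<or> i = 3 \<or> i = 4 \<or> i = 5" using c6 l by simp
    then show "next_label m n (w ! i) (w ! ((i + 1) mod length w)) = w ! ((i + 2) mod length w) \<and>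
      next_label m n (w ! ((i + 2) mod length w)) (w ! ((i + 1) mod length w)) = w ! i"
      unfolding l using w p by (elim disjE) (auto simp: next_label_def)
  qed
  show ?thesis
    unfolding mirror_patterns_def
  proof (intro conjI impI; elim conjE)
    assume o: "odd m" "odd n"
    \<comment> \<open>The numbers given to \<open>w6\<close> and \<open>w4\<close> are positions in
      the link where the two labels of the side stand consecutively: in 010212 the pairs 01, 12, 02
      start at 0, 4, 2.\<close>
    show "has_pattern U d F (line_through U d v0 v1) [0,1,0,2,1,2]"
      by (rule w6 [of _ 0]) (use o fl in simp_all)
    show "has_pattern U d F (line_through U d v1 v2) [0,1,0,2,1,2]"
      by (rule w6 [of _ 4]) (use o fl in simp_all)
    show "has_pattern U d F (line_through U d v0 v2) [0,1,0,2,1,2]"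
      by (rule w6 [of _ 2]) (use o fl in simp_all)
  next
    assume o: "odd m" "even n"
    show "has_pattern U d F (line_through U d v0 v1) [0,1]"
      by (rule w2 [OF refl]) (use o fl in \<open>simp_all add: next_label_def\<close>)
    show "has_pattern U d F (line_through U d v1 v2) [0,2,1,2]"
      by (rule w4 [of _ 2]) (use o fl in simp_all)
    show "has_pattern U d F (line_through U d v0 v2) [0,2,1,2]"
      by (rule w4 [of _ 0]) (use o fl in simp_all)
  next
    assume o: "even m" "even n"
    show "has_pattern U d F (line_through U d v0 v1) [0,1]"
      by (rule w2 [OF refl]) (use o fl in \<open>simp_all add: next_label_def\<close>)
    show "has_pattern U d F (line_through U d v1 v2) [1,2]"
      by (rule w2 [OF refl]) (use o fl in \<open>simp_all add: next_label_def\<close>)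
    show "has_pattern U d F (line_through U d v0 v2) [0,2]"
      by (rule w2 [OF refl]) (use o fl in \<open>simp_all add: next_label_def\<close>)
  next
    assume o: "even m" "odd n"
    show "has_pattern U d F (line_through U d v0 v1) [0,1,0,2]"
      by (rule w4 [of _ 0]) (use o fl in simp_all)
    show "has_pattern U d F (line_through U d v0 v2) [0,1,0,2]"
      by (rule w4 [of _ 2]) (use o fl in simp_all)
    show "has_pattern U d F (line_through U d v1 v2) [1,2]"
      by (rule w2 [OF refl]) (use o fl in \<open>simp_all add: next_label_def\<close>)
  qed
qed

section \<open>Return from the chart to the given plane\<close>

lemma patterns_transfer:
  assumes iso: "isom X d Y e h" and model: "model_plane Y e T"
    and tess: "regular_tessellation X d m n F" and bt: "barycentric_triangle X d F v0 v1 v2"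
  shows "mirror_patterns X d m n F (line_through X d v0 v1) (line_through X d v1 v2) (line_through X d v0 v2)"
proof -
  interpret H: isom X d Y e h by (rule iso)
  interpret I: isom Y e X d "inv_into X h" by (rule H.inverse)
  interpret M: model_plane Y e T by (rule model)
  define F' where "F' = (`) h ` F"
  have FX: "\<Union> F \<subseteq> X" using tessellation_Union [OF tess] by simp
  have tess': "regular_tessellation Y e m n F'" unfolding F'_def by (rule H.regular_tessellation_image [OF tess])
  have FY: "\<Union> F' \<subseteq> Y" using tessellation_Union [OF tess'] by simp
  have bt': "barycentric_triangle Y e F' (h v0) (h v1) (h v2)" unfolding F'_def by (rule H.barycentric_triangle_image [OF FX bt])
  have F_back: "(`) (inv_into X h) ` F' = F" unfolding F'_def by (rule H.image_family_inverse [OF FX])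
  obtain vs i where vs: "vs \<in> face_cycles X d F" "v0 \<in> {corner vs i, corner vs (i + 1)}"
      "is_midpoint X d (corner vs i) (corner vs (i + 1)) v1" "is_centre X d vs v2"
    using bt unfolding barycentric_triangle_def by blast
  have vX: "v0 \<in> X" "v1 \<in> X" "v2 \<in> X"
    using vs H.face_cycles_sub [OF vs(1)] H.corner_in [of vs] by (auto simp: is_midpoint_def is_centre_def)
  have pull: "has_pattern X d F (line_through X d a b) w"
    if "has_pattern Y e F' (line_through Y e (h a) (h b)) w" "a \<in> X" "b \<in> X" for a b w
  proof -
    have "has_pattern X d ((`) (inv_into X h) ` F') (inv_into X h ` line_through Y e (h a) (h b)) w"
      by (rule I.has_pattern_image [OF FY I.line_sub that(1)])
    moreover have "inv_into X h ` line_through Y e (h a) (h b) = line_through X d a b"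
      using I.line_image [of "h a" "h b"] that by simp
    ultimately show ?thesis using F_back by simp
  qed
  show ?thesis
    using M.model_patterns [OF tess' bt'] pull vX unfolding mirror_patterns_def by blast
qed

theorem theorem3p1:
  fixes m n :: nat
    and X :: "complex set" and d :: "complex \<Rightarrow> complex \<Rightarrow> real"
    and F :: "complex set set"
    and v0 v1 v2 :: complex
    and P Q R :: "complex \<Rightarrow> complex"
  assumes "m \<ge> 2" and "n \<ge> 2" and "1 / real m + 1 / real n \<le> 1 / 2"
    and "X = plane m n" and "d = plane_dist m n"
    and "regular_tessellation X d m n F"
    and "barycentric_triangle X d F v0 v1 v2"
    and "is_reflection X d (line_through X d v0 v1) P"
    and "is_reflection X d (line_through X d v1 v2) Q"
    and "is_reflection X d (line_through X d v0 v2) R"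
  shows "(odd m \<and> odd n \<longrightarrow>
            mirrors_have_pattern X d F P [0,1,0,2,1,2] \<and>
            mirrors_have_pattern X d F Q [0,1,0,2,1,2] \<and>
            mirrors_have_pattern X d F R [0,1,0,2,1,2])
       \<and> (odd m \<and> even n \<longrightarrow>
            mirrors_have_pattern X d F P [0,1] \<and>
            mirrors_have_pattern X d F Q [0,2,1,2] \<and>
            mirrors_have_pattern X d F R [0,2,1,2])
       \<and> (even m \<and> even n \<longrightarrow>
            mirrors_have_pattern X d F P [0,1] \<and>
            mirrors_have_pattern X d F Q [1,2] \<and>
            mirrors_have_pattern X d F R [0,2])
       \<and> (even m \<and> odd n \<longrightarrow>
            mirrors_have_pattern X d F P [0,1,0,2] \<and>
            mirrors_have_pattern X d F R [0,1,0,2] \<and>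
            mirrors_have_pattern X d F Q [1,2])"
proof -
  have pat: "mirror_patterns X d m n F (line_through X d v0 v1) (line_through X d v1 v2) (line_through X d v0 v2)"
  proof (cases "1 / real m + 1 / real n = 1 / 2")
    case True
    then have "X = UNIV" "d = dist" using assms(4,5) by (auto simp: plane_def plane_dist_def)
    then show ?thesis using model_plane.model_patterns [OF euclid_model] assms(6,7) by blast
  next
    case False
    then have "X = ball 0 1" "d = hyp_dist" using assms(4,5) by (auto simp: plane_def plane_dist_def)
    then show ?thesis using patterns_transfer [OF poincare_klein_isom klein_model] assms(6,7) by blast
  qed
  have FX: "\<Union> F \<subseteq> X" using tessellation_Union [OF assms(6)] by simp
  show ?thesis
    using pat mirrors_have_pattern_of_mirror [OF FX assms(8)] mirrors_have_pattern_of_mirror [OF FX assms(9)]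
      mirrors_have_pattern_of_mirror [OF FX assms(10)]
    unfolding mirror_patterns_def by blast
qed

end
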